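(* Let $(M,J,g,\theta)$ be a quasi-Vaisman manifold and let $f\colon M\to M$ be an isometry that preserves the quasi-Vaisman structure. Then for every real number $a>0$ the mapping torus $$M_{(f,a)}=(M\times\mathbb{R})/\mathbb{Z},\qquad k\cdot(x,t)=(f^k(x),t+ka),$$ inherits a quasi-Sasakian structure from the quasi-Sasakian structure $(\varphi,\xi,\eta,h)$ on $M\times\mathbb{R}$ given by $h=g+dt\otimes dt$, $\xi=V$, $\eta=h(\xi,-)$, and $\varphi U=\frac{\partial}{\partial t}$, $\varphi\frac{\partial}{\partial t}=-U$, $\varphi V=0$, $\varphi X=JX$ for $X\in\langle U,V\rangle^{\perp}\subset TM$, where $U$ and $V$ are the quasi-Lee and quasi-anti-Lee vector fields of $M$.
   Context: A quasi-Vaisman structure on a manifold $M$ is a triple $(J,g,\theta)$ where $(J,g)$ is a Hermitian structure ($J$ an integrable almost complex structure, $g$ a Riemannian metric with $g(JX,JY)=g(X,Y)$), $\theta$ is a closed $1$-form whose metric dual vector field $U$ is unitary, Killing and satisfies $\mathcal{L}_UJ=0$, and $d\Omega=d\eta_M\wedge\theta$, where $\Omega(X,Y)=g(X,JY)$ and $\eta_M=-\theta\circ J$ is the quasi-anti-Lee $1$-form. $U$ is called the quasi-Lee vector field and $V=JU$, the metric dual of $\eta_M$, the quasi-anti-Lee vector field. An almost contact metric structure on a manifold of odd dimension is a quadruple $(\varphi,\xi,\eta,h)$ of an endomorphism $\varphi$ of the tangent bundle, a vector field $\xi$, a $1$-form $\eta$ and a Riemannian metric $h$ with $\varphi^2=-\mathrm{Id}+\eta\otimes\xi$,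 $\eta(\xi)=1$, $h(\varphi X,\varphi Y)=h(X,Y)-\eta(X)\eta(Y)$. Its fundamental $2$-form is $\Phi(X,Y)=h(X,\varphi Y)$. It is quasi-Sasakian if $N_\varphi+d\eta\otimes\xi=0$ and $d\Phi=0$, where $N_\varphi(X,Y)=\varphi^2[X,Y]-\varphi([\varphi X,Y]+[X,\varphi Y])+[\varphi X,\varphi Y]$ and $d\eta(X,Y)=X\eta(Y)-Y\eta(X)-\eta([X,Y])$. *)

theory Defs
  imports "HOL-Analysis.Analysis"
begin

section \<open>Smooth functions between Euclidean spaces\<close>

text \<open>Only used on open sets, where total differentiability at a point is a local condition.\<close>

primrec Ck_on :: "nat \<Rightarrow> 'e::euclidean_space set \<Rightarrow> ('e \<Rightarrow> 'f::real_normed_vector) \<Rightarrow> bool" where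
  "Ck_on 0 S f \<longleftrightarrow> continuous_on S f"
| "Ck_on (Suc k) S f \<longleftrightarrow>
     (\<forall>x\<in>S. f differentiable (at x)) \<and> (\<forall>v. Ck_on k S (\<lambda>x. frechet_derivative f (at x) v))"

definition smooth_on :: "'e::euclidean_space set \<Rightarrow> ('e \<Rightarrow> 'f::real_normed_vector) \<Rightarrow> bool" where
  "smooth_on S f \<longleftrightarrow> (\<forall>k. Ck_on k S f)"


section \<open>Smooth manifolds\<close>

text \<open>
  A chart is a pair of its domain and its coordinate map (irrelevant outside the domain).
  Besides the topology and the atlas, a manifold carries a preferred chart \<open>chart_at M p\<close> around
  every point \<open>p\<close>. It is used only to identify the tangent space at \<open>p\<close> with the model space
  \<open>'e\<close>: a tangent vector at \<open>p\<close> is given by its components in \<open>chart_at M p\<close>, and its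
  components in any other chart are obtained from the derivative of the coordinate change.
  Fields and tensors are thus functions on points, with values in \<open>'e\<close>, \<open>'e \<Rightarrow> real\<close>,
  \<open>'e \<Rightarrow> 'e\<close>, ...; their values outside \<open>topspace (mtop M)\<close> are irrelevant.
\<close>

type_synonym ('a, 'e) chart = "'a set \<times> ('a \<Rightarrow> 'e)"

record ('a, 'e) manifold =
  mtop :: "'a topology"
  atlas :: "('a, 'e) chart set"
  chart_at :: "'a \<Rightarrow> ('a, 'e) chart"

type_synonym ('a, 'e) vfield = "'a \<Rightarrow> 'e"
type_synonym ('a, 'e) form1 = "'a \<Rightarrow> 'e \<Rightarrow> real"
type_synonym ('a, 'e) bilin = "'a \<Rightarrow> 'e \<Rightarrow> 'e \<Rightarrow> real"
type_synonym ('a, 'e) endo = "'a \<Rightarrow> 'e \<Rightarrow> 'e"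

abbreviation points :: "('a, 'e) manifold \<Rightarrow> 'a set" where
  "points M \<equiv> topspace (mtop M)"

abbreviation cinv :: "('a, 'e) chart \<Rightarrow> 'e \<Rightarrow> 'a" where
  "cinv c \<equiv> inv_into (fst c) (snd c)"

definition is_chart :: "'a topology \<Rightarrow> ('a, 'e::euclidean_space) chart \<Rightarrow> bool" where
  "is_chart X c \<longleftrightarrow> openin X (fst c) \<and> open (snd c ` fst c) \<and>
     homeomorphic_map (subtopology X (fst c)) (top_of_set (snd c ` fst c)) (snd c)"

definition smooth_manifold :: "('a, 'e::euclidean_space) manifold \<Rightarrow> bool" where
  "smooth_manifold M \<longleftrightarrow>
     points M \<noteq> {} \<and> Hausdorff_space (mtop M) \<and> second_countable (mtop M) \<and>
     (\<forall>c\<in>atlas M. is_chart (mtop M) c) \<and>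
     (\<forall>c\<in>atlas M. \<forall>d\<in>atlas M. smooth_on (snd c ` (fst c \<inter> fst d)) (snd d \<circ> cinv c)) \<and>
     (\<forall>p\<in>points M. chart_at M p \<in> atlas M \<and> p \<in> fst (chart_at M p))"

definition smooth_map ::
  "('a, 'e::euclidean_space) manifold \<Rightarrow> ('b, 'f::euclidean_space) manifold \<Rightarrow> ('a \<Rightarrow> 'b) \<Rightarrow> bool" where
  "smooth_map M N f \<longleftrightarrow> continuous_map (mtop M) (mtop N) f \<and>
     (\<forall>c\<in>atlas M. \<forall>d\<in>atlas N. smooth_on (snd c ` {p \<in> fst c. f p \<in> fst d}) (snd d \<circ> f \<circ> cinv c))"

definition tangent_map ::
  "('a, 'e::euclidean_space) manifold \<Rightarrow> ('b, 'f::euclidean_space) manifold \<Rightarrow> ('a \<Rightarrow> 'b) \<Rightarrow> 'a \<Rightarrow> 'e \<Rightarrow> 'f" where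
  "tangent_map M N f p =
     frechet_derivative (snd (chart_at N (f p)) \<circ> f \<circ> cinv (chart_at M p)) (at (snd (chart_at M p) p))"

definition diffeomorphism ::
  "('a, 'e::euclidean_space) manifold \<Rightarrow> ('b, 'f::euclidean_space) manifold \<Rightarrow> ('a \<Rightarrow> 'b) \<Rightarrow> bool" where
  "diffeomorphism M N f \<longleftrightarrow> bij_betw f (points M) (points N) \<and>
     smooth_map M N f \<and> smooth_map N M (inv_into (points M) f)"

definition open_submanifold :: "('a, 'e) manifold \<Rightarrow> 'a set \<Rightarrow> ('a, 'e) manifold" where
  "open_submanifold M W =
     \<lparr> mtop = subtopology (mtop M) W,
       atlas = (\<lambda>c. (fst c \<inter> W, snd c)) ` atlas M,
       chart_at = (\<lambda>p. (fst (chart_at M p) \<inter> W, snd (chart_at M p))) \<rparr>"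

definition local_diffeomorphism ::
  "('a, 'e::euclidean_space) manifold \<Rightarrow> ('b, 'f::euclidean_space) manifold \<Rightarrow> ('a \<Rightarrow> 'b) \<Rightarrow> bool" where
  "local_diffeomorphism M N f \<longleftrightarrow> smooth_map M N f \<and>
     (\<forall>p\<in>points M. \<exists>W. openin (mtop M) W \<and> p \<in> W \<and> openin (mtop N) (f ` W) \<and>
        diffeomorphism (open_submanifold M W) (open_submanifold N (f ` W)) f)"


section \<open>Vector fields and tensors\<close>

text \<open>\<open>tcoord M c p\<close> maps a tangent vector at \<open>p\<close> to its components in the chart \<open>c\<close>;
  \<open>coord_field M c e\<close> is the vector field on \<open>fst c\<close> with constant components \<open>e\<close> in \<open>c\<close>.\<close>

definition tcoord :: "('a, 'e::euclidean_space) manifold \<Rightarrow> ('a, 'e) chart \<Rightarrow> 'a \<Rightarrow> 'e \<Rightarrow> 'e" where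
  "tcoord M c p = frechet_derivative (snd c \<circ> cinv (chart_at M p)) (at (snd (chart_at M p) p))"

definition coord_field :: "('a, 'e::euclidean_space) manifold \<Rightarrow> ('a, 'e) chart \<Rightarrow> 'e \<Rightarrow> ('a, 'e) vfield" where
  "coord_field M c e p = frechet_derivative (snd (chart_at M p) \<circ> cinv c) (at (snd c p)) e"

definition vf_rep :: "('a, 'e::euclidean_space) manifold \<Rightarrow> ('a, 'e) chart \<Rightarrow> ('a, 'e) vfield \<Rightarrow> 'e \<Rightarrow> 'e" where
  "vf_rep M c X y = tcoord M c (cinv c y) (X (cinv c y))"

definition smooth_vfield_on :: "('a, 'e::euclidean_space) manifold \<Rightarrow> 'a set \<Rightarrow> ('a, 'e) vfield \<Rightarrow> bool" where
  "smooth_vfield_on M W X \<longleftrightarrow> openin (mtop M) W \<and>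
     (\<forall>c\<in>atlas M. smooth_on (snd c ` (fst c \<inter> W)) (vf_rep M c X))"

definition smooth_form1 :: "('a, 'e::euclidean_space) manifold \<Rightarrow> ('a, 'e) form1 \<Rightarrow> bool" where
  "smooth_form1 M \<alpha> \<longleftrightarrow> (\<forall>p\<in>points M. linear (\<alpha> p)) \<and>
     (\<forall>c\<in>atlas M. \<forall>e. smooth_on (snd c ` fst c) ((\<lambda>p. \<alpha> p (coord_field M c e p)) \<circ> cinv c))"

definition smooth_endo :: "('a, 'e::euclidean_space) manifold \<Rightarrow> ('a, 'e) endo \<Rightarrow> bool" where
  "smooth_endo M A \<longleftrightarrow> (\<forall>p\<in>points M. linear (A p)) \<and>
     (\<forall>c\<in>atlas M. \<forall>e. smooth_on (snd c ` fst c) (vf_rep M c (\<lambda>p. A p (coord_field M c e p))))"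

definition smooth_bilin :: "('a, 'e::euclidean_space) manifold \<Rightarrow> ('a, 'e) bilin \<Rightarrow> bool" where
  "smooth_bilin M b \<longleftrightarrow>
     (\<forall>p\<in>points M. (\<forall>v. linear (b p v)) \<and> (\<forall>w. linear (\<lambda>v. b p v w))) \<and>
     (\<forall>c\<in>atlas M. \<forall>e e'. smooth_on (snd c ` fst c)
        ((\<lambda>p. b p (coord_field M c e p) (coord_field M c e' p)) \<circ> cinv c))"

definition riemannian_metric :: "('a, 'e::euclidean_space) manifold \<Rightarrow> ('a, 'e) bilin \<Rightarrow> bool" where
  "riemannian_metric M g \<longleftrightarrow> smooth_bilin M g \<and>
     (\<forall>p\<in>points M. (\<forall>v w. g p v w = g p w v) \<and> (\<forall>v. v \<noteq> 0 \<longrightarrow> g p v v > 0))"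

definition metric_dual :: "('a, 'e::euclidean_space) bilin \<Rightarrow> ('a, 'e) form1 \<Rightarrow> ('a, 'e) vfield" where
  "metric_dual g \<alpha> p = (THE u. \<forall>v. g p u v = \<alpha> p v)"

text \<open>\<open>dir_deriv M X F\<close> is \<open>X(F)\<close>. In the bracket, the representative of a field in
  \<open>chart_at M p\<close> takes at the image of \<open>p\<close> the field's own value, so the result is again
  a tangent vector at \<open>p\<close>.\<close>

definition dir_deriv :: "('a, 'e::euclidean_space) manifold \<Rightarrow> ('a, 'e) vfield \<Rightarrow> ('a \<Rightarrow> real) \<Rightarrow> 'a \<Rightarrow> real" where
  "dir_deriv M X F p = frechet_derivative (F \<circ> cinv (chart_at M p)) (at (snd (chart_at M p) p)) (X p)"

definition lie_bracket :: "('a, 'e::euclidean_space) manifold \<Rightarrow> ('a, 'e) vfield \<Rightarrow> ('a, 'e) vfield \<Rightarrow> ('a, 'e) vfield" where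
  "lie_bracket M X Y p =
     (let c = chart_at M p; y = snd c p in
        frechet_derivative (vf_rep M c Y) (at y) (vf_rep M c X y) -
        frechet_derivative (vf_rep M c X) (at y) (vf_rep M c Y y))"

text \<open>The exterior derivatives and the wedge product are unnormalised (no factors 1/2, 1/3).\<close>

definition d1 :: "('a, 'e::euclidean_space) manifold \<Rightarrow> ('a, 'e) form1 \<Rightarrow> ('a, 'e) vfield \<Rightarrow> ('a, 'e) vfield \<Rightarrow> 'a \<Rightarrow> real" where
  "d1 M \<alpha> X Y p =
     dir_deriv M X (\<lambda>q. \<alpha> q (Y q)) p - dir_deriv M Y (\<lambda>q. \<alpha> q (X q)) p - \<alpha> p (lie_bracket M X Y p)"

definition d2 :: "('a, 'e::euclidean_space) manifold \<Rightarrow> ('a, 'e) bilin \<Rightarrow>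
    ('a, 'e) vfield \<Rightarrow> ('a, 'e) vfield \<Rightarrow> ('a, 'e) vfield \<Rightarrow> 'a \<Rightarrow> real" where
  "d2 M \<omega> X Y Z p =
     dir_deriv M X (\<lambda>q. \<omega> q (Y q) (Z q)) p - dir_deriv M Y (\<lambda>q. \<omega> q (X q) (Z q)) p
     + dir_deriv M Z (\<lambda>q. \<omega> q (X q) (Y q)) p
     - \<omega> p (lie_bracket M X Y p) (Z p) + \<omega> p (lie_bracket M X Z p) (Y p)
     - \<omega> p (lie_bracket M Y Z p) (X p)"

definition d1_wedge :: "('a, 'e::euclidean_space) manifold \<Rightarrow> ('a, 'e) form1 \<Rightarrow> ('a, 'e) form1 \<Rightarrow>
    ('a, 'e) vfield \<Rightarrow> ('a, 'e) vfield \<Rightarrow> ('a, 'e) vfield \<Rightarrow> 'a \<Rightarrow> real" where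
  "d1_wedge M \<alpha> \<beta> X Y Z p =
     d1 M \<alpha> X Y p * \<beta> p (Z p) + d1 M \<alpha> Y Z p * \<beta> p (X p) + d1 M \<alpha> Z X p * \<beta> p (Y p)"

definition nijenhuis :: "('a, 'e::euclidean_space) manifold \<Rightarrow> ('a, 'e) endo \<Rightarrow> ('a, 'e) vfield \<Rightarrow> ('a, 'e) vfield \<Rightarrow> ('a, 'e) vfield" where
  "nijenhuis M A X Y p =
     (let AX = (\<lambda>q. A q (X q)); AY = (\<lambda>q. A q (Y q)) in
        A p (A p (lie_bracket M X Y p))
        - A p (lie_bracket M AX Y p + lie_bracket M X AY p)
        + lie_bracket M AX AY p)"

definition fundamental_form :: "('a, 'e::euclidean_space) bilin \<Rightarrow> ('a, 'e) endo \<Rightarrow> ('a, 'e) bilin" where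
  "fundamental_form g A p v w = g p v (A p w)"

text \<open>Identities between tensors are local, so the vector fields they are tested on range over
  the smooth fields on arbitrary open subsets.\<close>

definition closed_form1 :: "('a, 'e::euclidean_space) manifold \<Rightarrow> ('a, 'e) form1 \<Rightarrow> bool" where
  "closed_form1 M \<alpha> \<longleftrightarrow>
     (\<forall>W X Y. smooth_vfield_on M W X \<and> smooth_vfield_on M W Y \<longrightarrow> (\<forall>p\<in>W. d1 M \<alpha> X Y p = 0))"

definition closed_form2 :: "('a, 'e::euclidean_space) manifold \<Rightarrow> ('a, 'e) bilin \<Rightarrow> bool" where
  "closed_form2 M \<omega> \<longleftrightarrow>
     (\<forall>W X Y Z. smooth_vfield_on M W X \<and> smooth_vfield_on M W Y \<and> smooth_vfield_on M W Z \<longrightarrow>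
        (\<forall>p\<in>W. d2 M \<omega> X Y Z p = 0))"

text \<open>\<open>killing\<close> is \<open>\<L>\<^sub>U g = 0\<close>, and \<open>preserves_endo\<close> is \<open>\<L>\<^sub>U A = 0\<close>.\<close>

definition killing :: "('a, 'e::euclidean_space) manifold \<Rightarrow> ('a, 'e) bilin \<Rightarrow> ('a, 'e) vfield \<Rightarrow> bool" where
  "killing M g U \<longleftrightarrow> smooth_vfield_on M (points M) U \<and>
     (\<forall>W X Y. smooth_vfield_on M W X \<and> smooth_vfield_on M W Y \<longrightarrow>
        (\<forall>p\<in>W. dir_deriv M U (\<lambda>q. g q (X q) (Y q)) p
           - g p (lie_bracket M U X p) (Y p) - g p (X p) (lie_bracket M U Y p) = 0))"

definition preserves_endo :: "('a, 'e::euclidean_space) manifold \<Rightarrow> ('a, 'e) endo \<Rightarrow> ('a, 'e) vfield \<Rightarrow> bool" where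
  "preserves_endo M A U \<longleftrightarrow>
     (\<forall>W X. smooth_vfield_on M W X \<longrightarrow>
        (\<forall>p\<in>W. lie_bracket M U (\<lambda>q. A q (X q)) p - A p (lie_bracket M U X p) = 0))"


section \<open>Quasi-Vaisman and quasi-Sasakian structures\<close>

definition integrable_almost_complex :: "('a, 'e::euclidean_space) manifold \<Rightarrow> ('a, 'e) endo \<Rightarrow> bool" where
  "integrable_almost_complex M J \<longleftrightarrow> smooth_endo M J \<and> (\<forall>p\<in>points M. \<forall>v. J p (J p v) = - v) \<and>
     (\<forall>W X Y. smooth_vfield_on M W X \<and> smooth_vfield_on M W Y \<longrightarrow> (\<forall>p\<in>W. nijenhuis M J X Y p = 0))"

definition hermitian :: "('a, 'e::euclidean_space) manifold \<Rightarrow> ('a, 'e) endo \<Rightarrow> ('a, 'e) bilin \<Rightarrow> bool" where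
  "hermitian M J g \<longleftrightarrow> integrable_almost_complex M J \<and> riemannian_metric M g \<and>
     (\<forall>p\<in>points M. \<forall>v w. g p (J p v) (J p w) = g p v w)"

definition quasi_anti_Lee_form :: "('a, 'e::euclidean_space) endo \<Rightarrow> ('a, 'e) form1 \<Rightarrow> ('a, 'e) form1" where
  "quasi_anti_Lee_form J \<theta> p v = - \<theta> p (J p v)"

definition quasi_Lee :: "('a, 'e::euclidean_space) bilin \<Rightarrow> ('a, 'e) form1 \<Rightarrow> ('a, 'e) vfield" where
  "quasi_Lee g \<theta> = metric_dual g \<theta>"

definition quasi_anti_Lee :: "('a, 'e::euclidean_space) endo \<Rightarrow> ('a, 'e) bilin \<Rightarrow> ('a, 'e) form1 \<Rightarrow> ('a, 'e) vfield" where
  "quasi_anti_Lee J g \<theta> p = J p (quasi_Lee g \<theta> p)"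

definition quasi_Vaisman ::
  "('a, 'e::euclidean_space) manifold \<Rightarrow> ('a, 'e) endo \<Rightarrow> ('a, 'e) bilin \<Rightarrow> ('a, 'e) form1 \<Rightarrow> bool" where
  "quasi_Vaisman M J g \<theta> \<longleftrightarrow> smooth_manifold M \<and> hermitian M J g \<and>
     smooth_form1 M \<theta> \<and> closed_form1 M \<theta> \<and>
     (\<forall>p\<in>points M. g p (quasi_Lee g \<theta> p) (quasi_Lee g \<theta> p) = 1) \<and>
     killing M g (quasi_Lee g \<theta>) \<and> preserves_endo M J (quasi_Lee g \<theta>) \<and>
     (\<forall>W X Y Z. smooth_vfield_on M W X \<and> smooth_vfield_on M W Y \<and> smooth_vfield_on M W Z \<longrightarrow>
        (\<forall>p\<in>W. d2 M (fundamental_form g J) X Y Z p = d1_wedge M (quasi_anti_Lee_form J \<theta>) \<theta> X Y Z p))"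

definition almost_contact_metric :: "('a, 'e::euclidean_space) manifold \<Rightarrow> ('a, 'e) endo \<Rightarrow> ('a, 'e) vfield \<Rightarrow>
    ('a, 'e) form1 \<Rightarrow> ('a, 'e) bilin \<Rightarrow> bool" where
  "almost_contact_metric M \<phi> \<xi> \<eta> h \<longleftrightarrow> smooth_manifold M \<and> odd DIM('e) \<and>
     smooth_endo M \<phi> \<and> smooth_vfield_on M (points M) \<xi> \<and> smooth_form1 M \<eta> \<and> riemannian_metric M h \<and>
     (\<forall>p\<in>points M.
        (\<forall>v. \<phi> p (\<phi> p v) = - v + \<eta> p v *\<^sub>R \<xi> p) \<and> \<eta> p (\<xi> p) = 1 \<and>
        (\<forall>v w. h p (\<phi> p v) (\<phi> p w) = h p v w - \<eta> p v * \<eta> p w))"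

definition quasi_Sasakian :: "('a, 'e::euclidean_space) manifold \<Rightarrow> ('a, 'e) endo \<Rightarrow> ('a, 'e) vfield \<Rightarrow>
    ('a, 'e) form1 \<Rightarrow> ('a, 'e) bilin \<Rightarrow> bool" where
  "quasi_Sasakian M \<phi> \<xi> \<eta> h \<longleftrightarrow> almost_contact_metric M \<phi> \<xi> \<eta> h \<and>
     (\<forall>W X Y. smooth_vfield_on M W X \<and> smooth_vfield_on M W Y \<longrightarrow>
        (\<forall>p\<in>W. nijenhuis M \<phi> X Y p + d1 M \<eta> X Y p *\<^sub>R \<xi> p = 0)) \<and>
     closed_form2 M (fundamental_form h \<phi>)"

definition riemannian_isometry :: "('a, 'e::euclidean_space) manifold \<Rightarrow> ('a, 'e) bilin \<Rightarrow> ('a \<Rightarrow> 'a) \<Rightarrow> bool" where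
  "riemannian_isometry M g f \<longleftrightarrow> diffeomorphism M M f \<and>
     (\<forall>p\<in>points M. \<forall>v w. g (f p) (tangent_map M M f p v) (tangent_map M M f p w) = g p v w)"

definition preserves_quasi_Vaisman ::
  "('a, 'e::euclidean_space) manifold \<Rightarrow> ('a, 'e) endo \<Rightarrow> ('a, 'e) bilin \<Rightarrow> ('a, 'e) form1 \<Rightarrow> ('a \<Rightarrow> 'a) \<Rightarrow> bool" where
  "preserves_quasi_Vaisman M J g \<theta> f \<longleftrightarrow>
     (\<forall>p\<in>points M. \<forall>v w.
        tangent_map M M f p (J p v) = J (f p) (tangent_map M M f p v) \<and>
        g (f p) (tangent_map M M f p v) (tangent_map M M f p w) = g p v w \<and>
        \<theta> (f p) (tangent_map M M f p v) = \<theta> p v)"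


section \<open>The product with the real line\<close>

definition times_line :: "('a, 'e) manifold \<Rightarrow> ('a \<times> real, 'e \<times> real) manifold" where
  "times_line M =
     \<lparr> mtop = prod_topology (mtop M) euclideanreal,
       atlas = (\<lambda>c. (fst c \<times> UNIV, map_prod (snd c) id)) ` atlas M,
       chart_at = (\<lambda>(p, t). (fst (chart_at M p) \<times> UNIV, map_prod (snd (chart_at M p)) id)) \<rparr>"

text \<open>By the choice of \<open>chart_at\<close>, a tangent vector of the product at \<open>(p, t)\<close> is a pair
  \<open>(v, s)\<close> of a tangent vector \<open>v\<close> of \<open>M\<close> at \<open>p\<close> and the component \<open>s\<close> of \<open>\<partial>/\<partial>t\<close>.\<close>

definition line_metric :: "('a, 'e) bilin \<Rightarrow> ('a \<times> real, 'e \<times> real) bilin" where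
  "line_metric g = (\<lambda>(p, t) (v, s) (w, r). g p v w + s * r)"

definition line_\<xi> :: "('a, 'e::euclidean_space) endo \<Rightarrow> ('a, 'e) bilin \<Rightarrow> ('a, 'e) form1 \<Rightarrow>
    ('a \<times> real, 'e \<times> real) vfield" where
  "line_\<xi> J g \<theta> = (\<lambda>(p, t). (quasi_anti_Lee J g \<theta> p, 0))"

definition line_\<eta> :: "('a, 'e::euclidean_space) endo \<Rightarrow> ('a, 'e) bilin \<Rightarrow> ('a, 'e) form1 \<Rightarrow>
    ('a \<times> real, 'e \<times> real) form1" where
  "line_\<eta> J g \<theta> z = line_metric g z (line_\<xi> J g \<theta> z)"

text \<open>The linear extension of the prescribed values on \<open>U\<close>, \<open>\<partial>/\<partial>t\<close>, \<open>V\<close> and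
  \<open>\<langle>U, V\<rangle>\<^sup>\<bottom>\<close>: the summand \<open>v - g(U,v) U - g(V,v) V\<close> is the orthogonal projection
  of \<open>v\<close>. See \<open>line_\<phi>_values\<close> below.\<close>

definition line_\<phi> :: "('a, 'e::euclidean_space) endo \<Rightarrow> ('a, 'e) bilin \<Rightarrow> ('a, 'e) form1 \<Rightarrow>
    ('a \<times> real, 'e \<times> real) endo" where
  "line_\<phi> J g \<theta> = (\<lambda>(p, t) (v, s).
     let U = quasi_Lee g \<theta> p; V = quasi_anti_Lee J g \<theta> p in
       (J p (v - g p U v *\<^sub>R U - g p V v *\<^sub>R V) - s *\<^sub>R U, g p U v))"

lemma line_\<phi>_values:
  assumes "quasi_Vaisman M J g \<theta>" "p \<in> points M"
  defines "U \<equiv> quasi_Lee g \<theta> p" and "V \<equiv> quasi_anti_Lee J g \<theta> p"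
  shows "linear (line_\<phi> J g \<theta> (p, t))"
    and "line_\<phi> J g \<theta> (p, t) (U, 0) = (0, 1)"
    and "line_\<phi> J g \<theta> (p, t) (0, 1) = (- U, 0)"
    and "line_\<phi> J g \<theta> (p, t) (V, 0) = (0, 0)"
    and "g p U v = 0 \<Longrightarrow> g p V v = 0 \<Longrightarrow> line_\<phi> J g \<theta> (p, t) (v, 0) = (J p v, 0)"
proof -
  have lg: "linear (g p v)" "linear (\<lambda>w. g p w v)" and sym: "g p v w = g p w v"
    and lJ: "linear (J p)" and JJ: "J p (J p v) = - v"
    and gJ: "g p (J p v) (J p w) = g p v w" and UU: "g p U U = 1" for v w
    using assms unfolding quasi_Vaisman_def hermitian_def riemannian_metric_def smooth_bilin_def
      integrable_almost_complex_def smooth_endo_def by auto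
  have VJ: "V = J p U" by (simp add: V_def U_def quasi_anti_Lee_def)
  have VV: "g p V V = 1" using gJ UU VJ by simp
  have "g p U V = g p (J p U) (J p (J p U))" using gJ VJ by simp
  also have "\<dots> = - g p V U" by (simp add: JJ VJ linear_neg[OF lg(1)])
  finally have UV: "g p U V = 0" "g p V U = 0" using sym by (metis equal_neg_zero)+
  have J0: "J p 0 = 0" and g0: "g p w 0 = 0" for w using lJ lg(1) by (simp_all add: linear_0)
  note unf = line_\<phi>_def Let_def U_def[symmetric] V_def[symmetric]
  show "linear (line_\<phi> J g \<theta> (p, t))"
    by (rule linearI)
      (auto simp: unf linear_add[OF lJ] linear_diff[OF lJ] linear_scale[OF lJ]
        linear_add[OF lg(1)] linear_scale[OF lg(1)] algebra_simps)
  show "line_\<phi> J g \<theta> (p, t) (U, 0) = (0, 1)" by (simp add: unf UU UV J0)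
  show "line_\<phi> J g \<theta> (p, t) (0, 1) = (- U, 0)" by (simp add: unf J0 g0)
  show "line_\<phi> J g \<theta> (p, t) (V, 0) = (0, 0)" by (simp add: unf VV UV J0)
  show "line_\<phi> J g \<theta> (p, t) (v, 0) = (J p v, 0)" if "g p U v = 0" "g p V v = 0"
    using that by (simp add: unf)
qed


section \<open>Quotients and the mapping torus\<close>

definition quotient_topology :: "'a topology \<Rightarrow> ('a \<Rightarrow> 'b) \<Rightarrow> 'b topology" where
  "quotient_topology X q =
     topology (\<lambda>S. S \<subseteq> q ` topspace X \<and> openin X {x \<in> topspace X. q x \<in> S})"

lemma openin_quotient_topology:
  "openin (quotient_topology X q) S \<longleftrightarrow> S \<subseteq> q ` topspace X \<and> openin X {x \<in> topspace X. q x \<in> S}"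
proof -
  have "istopology (\<lambda>S. S \<subseteq> q ` topspace X \<and> openin X {x \<in> topspace X. q x \<in> S})"
    unfolding istopology_def
  proof (intro conjI allI impI)
    fix S T
    assume "S \<subseteq> q ` topspace X \<and> openin X {x \<in> topspace X. q x \<in> S}"
      and "T \<subseteq> q ` topspace X \<and> openin X {x \<in> topspace X. q x \<in> T}"
    moreover have "{x \<in> topspace X. q x \<in> S \<inter> T} =
        {x \<in> topspace X. q x \<in> S} \<inter> {x \<in> topspace X. q x \<in> T}" by auto
    ultimately show "S \<inter> T \<subseteq> q ` topspace X" "openin X {x \<in> topspace X. q x \<in> S \<inter> T}"
      by auto
  next
    fix \<K>
    assume *: "\<forall>K\<in>\<K>. K \<subseteq> q ` topspace X \<and> openin X {x \<in> topspace X. q x \<in> K}"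
    then show "\<Union>\<K> \<subseteq> q ` topspace X" by auto
    have "{x \<in> topspace X. q x \<in> \<Union>\<K>} = (\<Union>K\<in>\<K>. {x \<in> topspace X. q x \<in> K})" by auto
    then show "openin X {x \<in> topspace X. q x \<in> \<Union>\<K>}" using * by auto
  qed
  then show ?thesis by (simp add: quotient_topology_def)
qed

lemma quotient_map_quotient_topology: "quotient_map X (quotient_topology X q) q"
proof -
  have "openin (quotient_topology X q) (q ` topspace X)"
    by (auto simp: openin_quotient_topology intro: openin_subopen[THEN iffD2])
  then have "topspace (quotient_topology X q) = q ` topspace X"
    by (metis openin_quotient_topology openin_subset openin_topspace subset_antisym)
  then show ?thesis by (auto simp: quotient_map_def openin_quotient_topology)
qed

text \<open>The smooth structure on the quotient of \<open>N\<close> by a covering projection \<open>q\<close>: charts are the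
  local inverses of \<open>q\<close> followed by charts of \<open>N\<close>.\<close>

definition quotient_manifold :: "('a, 'e) manifold \<Rightarrow> ('a \<Rightarrow> 'b) \<Rightarrow> ('b, 'e) manifold" where
  "quotient_manifold N q =
     (let A = {(q ` W, snd c \<circ> inv_into W q) | W c.
                 c \<in> atlas N \<and> openin (mtop N) W \<and> W \<subseteq> fst c \<and> inj_on q W} in
      \<lparr> mtop = quotient_topology (mtop N) q,
        atlas = A,
        chart_at = (\<lambda>y. SOME c. c \<in> A \<and> y \<in> fst c) \<rparr>)"

definition int_iterate :: "'a set \<Rightarrow> ('a \<Rightarrow> 'a) \<Rightarrow> int \<Rightarrow> 'a \<Rightarrow> 'a" where
  "int_iterate S f k = (if k \<ge> 0 then f ^^ nat k else inv_into S f ^^ nat (- k))"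

definition torus_orbit :: "('a, 'e) manifold \<Rightarrow> ('a \<Rightarrow> 'a) \<Rightarrow> real \<Rightarrow> 'a \<times> real \<Rightarrow> ('a \<times> real) set" where
  "torus_orbit M f a = (\<lambda>(x, t). {(int_iterate (points M) f k x, t + of_int k * a) | k :: int. True})"

definition mapping_torus :: "('a, 'e) manifold \<Rightarrow> ('a \<Rightarrow> 'a) \<Rightarrow> real \<Rightarrow> (('a \<times> real) set, 'e \<times> real) manifold" where
  "mapping_torus M f a = quotient_manifold (times_line M) (torus_orbit M f a)"

definition almost_contact_related ::
  "('a, 'e::euclidean_space) manifold \<Rightarrow> ('a, 'e) endo \<Rightarrow> ('a, 'e) vfield \<Rightarrow> ('a, 'e) form1 \<Rightarrow> ('a, 'e) bilin \<Rightarrow>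
   ('b, 'f::euclidean_space) manifold \<Rightarrow> ('b, 'f) endo \<Rightarrow> ('b, 'f) vfield \<Rightarrow> ('b, 'f) form1 \<Rightarrow> ('b, 'f) bilin \<Rightarrow>
   ('a \<Rightarrow> 'b) \<Rightarrow> bool" where
  "almost_contact_related N \<phi> \<xi> \<eta> h N' \<phi>' \<xi>' \<eta>' h' q \<longleftrightarrow>
     (\<forall>z\<in>points N. let dq = tangent_map N N' q z in
        dq (\<xi> z) = \<xi>' (q z) \<and>
        (\<forall>v. dq (\<phi> z v) = \<phi>' (q z) (dq v) \<and> \<eta>' (q z) (dq v) = \<eta> z v) \<and>
        (\<forall>v w. h' (q z) (dq v) (dq w) = h z v w))"

end

theory Submission
  imports Defs
begin

text \<open>
  The quasi-Vaisman identities enter as follows. Since \<open>\<theta>\<close> is closed with \<open>\<theta>(U) = 1\<close>,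
  \<open>\<L>\<^sub>U \<theta> = 0\<close>. Integrability of \<open>J\<close> turns \<open>\<L>\<^sub>U J = 0\<close> into
  \<open>\<L>\<^sub>V J = 0\<close>, so \<open>[U, V] = 0\<close> and both \<open>U\<close> and \<open>V\<close> annihilate \<open>d\<eta>\<close>.
  Writing \<open>\<phi>(v, s) = (J v - \<theta>(v) V + (\<eta>(v) - s) U, \<theta>(v))\<close>, these facts make all terms of
  \<open>N\<^sub>\<phi> + d\<eta> \<otimes> \<xi>\<close> cancel (\<open>nijenhuis_algebra\<close>). The fundamental form is
  \<open>\<Phi> = \<Omega> + \<theta> \<and> \<eta> + dt \<and> \<theta>\<close>, and \<open>d\<Omega> = d\<eta> \<and> \<theta>\<close> is precisely what makes it
  closed (\<open>closed_line\<close>). This settles \<open>M \<times> \<real>\<close>.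

  A map preserving \<open>J\<close>, \<open>g\<close> and \<open>\<theta>\<close> also preserves \<open>U\<close> and \<open>V\<close>, so the maps
  \<open>(x, t) \<mapsto> (f\<^sup>k x, t + k a)\<close> are symmetries of the structure on \<open>M \<times> \<real>\<close>
  (\<open>symmetry_line\<close>). As they move \<open>t\<close> by multiples of \<open>a\<close>, they act freely and properly
  discontinuously; hence the quotient is a manifold, the projection is a local diffeomorphism, the
  tensors descend, and the quasi-Sasakian identities, being local, descend with them.

  The identities are stated for arbitrary local vector fields, while the computations are done at a
  point and in coordinates. The lemmas \<open>d1_chart\<close>, \<open>d2_chart\<close>, \<open>nijenhuis_chart\<close> and
  \<open>lie_deriv_endo_chart\<close> translate between the two in any chart. They rest on the fact that the
  Lie bracket, defined in the preferred chart of the point, can be computed in every chart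
  (\<open>lie_bracket_chart\<close>), which is the symmetry of second derivatives (\<open>D_D_sym\<close>). The freedom
  of the chart is needed for the quotient: its charts are charts of \<open>M \<times> \<real>\<close> composed with local
  inverses of the projection, in which the descended tensors have literally the components of the
  original ones, but they need not come from preferred charts. Being quasi-Sasakian thus becomes a
  condition on components alone (\<open>quasi_Sasakian_flat\<close>, \<open>quasi_SasakianI\<close>), proved once.
\<close>

section \<open>Calculus of smooth functions on open sets\<close>

abbreviation Dat ("\<D>") where "\<D> f x \<equiv> frechet_derivative f (at x)"

lemma D_eqI: "(f has_derivative f') (at x) \<Longrightarrow> \<D> f x = f'"
  using frechet_derivative_at by metis

lemma D_works: "f differentiable (at x) \<Longrightarrow> (f has_derivative \<D> f x) (at x)"
  using frechet_derivative_works by blast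

lemma has_derivative_cong_open:
  assumes "open S" "x \<in> S" "\<And>y. y \<in> S \<Longrightarrow> f y = g y"
  shows "(f has_derivative f') (at x) \<longleftrightarrow> (g has_derivative f') (at x)"
proof
  show "(g has_derivative f') (at x)" if "(f has_derivative f') (at x)"
    using has_derivative_transform_within_open[OF that assms] .
  show "(f has_derivative f') (at x)" if "(g has_derivative f') (at x)"
    by (rule has_derivative_transform_within_open[OF that assms(1,2)]) (simp add: assms(3))
qed

lemma D_cong:
  assumes "open S" "x \<in> S" "\<And>y. y \<in> S \<Longrightarrow> f y = g y"
  shows "\<D> f x = \<D> g x"
  using has_derivative_cong_open[OF assms] unfolding frechet_derivative_def by auto

lemma differentiable_cong_open:
  assumes "open S" "x \<in> S" "\<And>y. y \<in> S \<Longrightarrow> f y = g y"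
  shows "f differentiable (at x) \<longleftrightarrow> g differentiable (at x)"
  using has_derivative_cong_open[OF assms] unfolding differentiable_def by auto

lemma D_compose:
  assumes "f differentiable (at x)" "g differentiable (at (f x))"
  shows "\<D> (\<lambda>x. g (f x)) x v = \<D> g (f x) (\<D> f x v)"
proof -
  have "((\<lambda>x. g (f x)) has_derivative (\<lambda>v. \<D> g (f x) (\<D> f x v))) (at x)"
    using diff_chain_at[OF D_works[OF assms(1)] D_works[OF assms(2)]] by (simp add: o_def)
  then show ?thesis by (simp add: D_eqI)
qed

lemma D_linear: "f differentiable (at x) \<Longrightarrow> linear (\<D> f x)"
  by (rule linear_frechet_derivative)

lemma Ck_on_cong:
  assumes "open S" "\<And>x. x \<in> S \<Longrightarrow> f x = g x"
  shows "Ck_on k S f \<longleftrightarrow> Ck_on k S g"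
  using assms(2)
proof (induction k arbitrary: f g)
  case 0
  then show ?case by (simp cong: continuous_on_cong)
next
  case (Suc k)
  have "\<D> f x = \<D> g x" "f differentiable (at x) \<longleftrightarrow> g differentiable (at x)" if "x \<in> S" for x
    using D_cong[OF assms(1) that] differentiable_cong_open[OF assms(1) that] Suc.prems by metis+
  then show ?case using Suc.IH[of "\<lambda>x. \<D> f x v" "\<lambda>x. \<D> g x v" for v] by auto
qed

lemma Ck_on_subset: "Ck_on k S f \<Longrightarrow> T \<subseteq> S \<Longrightarrow> Ck_on k T f"
  by (induction k arbitrary: f) (auto intro: continuous_on_subset)

lemma Ck_on_local:
  assumes "\<And>x. x \<in> S \<Longrightarrow> \<exists>T. open T \<and> x \<in> T \<and> Ck_on k T f"
  shows "Ck_on k S f"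
  using assms
proof (induction k arbitrary: f)
  case 0
  have "isCont f x" if "x \<in> S" for x
    using 0[OF that] by (auto simp: continuous_on_eq_continuous_at)
  then show ?case by (simp add: continuous_at_imp_continuous_on)
next
  case (Suc k)
  show ?case unfolding Ck_on.simps
  proof (intro conjI ballI allI)
    show "f differentiable (at x)" if "x \<in> S" for x using Suc.prems[OF that] by auto
    show "Ck_on k S (\<lambda>x. \<D> f x v)" for v
      by (rule Suc.IH) (use Suc.prems in force)
  qed
qed

lemma Ck_on_SucD: "Ck_on (Suc k) S f \<Longrightarrow> Ck_on k S f"
proof (induction k arbitrary: f)
  case 0
  then show ?case
    by (auto simp: continuous_at_imp_continuous_on differentiable_imp_continuous_within)
next
  case (Suc k)
  then show ?case by (metis Ck_on.simps(2))
qed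

lemma Ck_on_const: "Ck_on k S (\<lambda>x. c)"
proof (induction k arbitrary: c)
  case (Suc k) then show ?case by simp
qed simp

lemma Ck_on_bounded_linear:
  assumes "bounded_linear L" "open S" "Ck_on k S f"
  shows "Ck_on k S (\<lambda>x. L (f x))"
  using assms(3)
proof (induction k arbitrary: f)
  case 0
  then show ?case using assms(1) by (simp add: bounded_linear.continuous_on)
next
  case (Suc k)
  have hd: "((\<lambda>x. L (f x)) has_derivative (\<lambda>v. L (\<D> f x v))) (at x)" if "x \<in> S" for x
    using bounded_linear.has_derivative[OF assms(1) D_works] Suc.prems that by auto
  have "Ck_on k S (\<lambda>x. \<D> (\<lambda>x. L (f x)) x v)" for v
    using Ck_on_cong[OF assms(2), of "\<lambda>x. \<D> (\<lambda>x. L (f x)) x v" "\<lambda>x. L (\<D> f x v)"]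
      Suc.IH[of "\<lambda>x. \<D> f x v"] Suc.prems D_eqI[OF hd] by auto
  then show ?case using hd by (auto simp: differentiable_def)
qed

lemma Ck_on_add:
  assumes "open S" "Ck_on k S f" "Ck_on k S g"
  shows "Ck_on k S (\<lambda>x. f x + g x)"
  using assms(2,3)
proof (induction k arbitrary: f g)
  case 0
  then show ?case by (simp add: continuous_on_add)
next
  case (Suc k)
  have hd: "((\<lambda>x. f x + g x) has_derivative (\<lambda>v. \<D> f x v + \<D> g x v)) (at x)" if "x \<in> S" for x
    by (intro has_derivative_add D_works) (use Suc.prems that in auto)
  have "Ck_on k S (\<lambda>x. \<D> (\<lambda>x. f x + g x) x v)" for v
    using Ck_on_cong[OF assms(1), of "\<lambda>x. \<D> (\<lambda>x. f x + g x) x v" "\<lambda>x. \<D> f x v + \<D> g x v"]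
      Suc.IH[of "\<lambda>x. \<D> f x v" "\<lambda>x. \<D> g x v"] Suc.prems D_eqI[OF hd] by auto
  then show ?case using hd by (auto simp: differentiable_def)
qed

lemma Ck_on_sum:
  assumes "open S" "\<And>i. i \<in> I \<Longrightarrow> Ck_on k S (f i)"
  shows "Ck_on k S (\<lambda>x. \<Sum>i\<in>I. f i x)"
  using assms(2)
proof (induction I rule: infinite_finite_induct)
  case (insert i I)
  then show ?case using Ck_on_add[OF assms(1), of k "f i"] by auto
qed (auto simp: Ck_on_const)

lemma Ck_on_bilinear:
  assumes b: "bounded_bilinear b" and "open S" "Ck_on k S f" "Ck_on k S g"
  shows "Ck_on k S (\<lambda>x. b (f x) (g x))"
  using assms(3,4)
proof (induction k arbitrary: f g)
  case 0
  then show ?case using b by (simp add: bounded_bilinear.continuous_on)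
next
  case (Suc k)
  have hd: "((\<lambda>x. b (f x) (g x)) has_derivative (\<lambda>v. b (f x) (\<D> g x v) + b (\<D> f x v) (g x))) (at x)"
    if "x \<in> S" for x
    by (intro bounded_bilinear.FDERIV[OF b] D_works) (use Suc.prems that in auto)
  have "Ck_on k S (\<lambda>x. \<D> (\<lambda>x. b (f x) (g x)) x v)" for v
    using Ck_on_cong[OF assms(2), of "\<lambda>x. \<D> (\<lambda>x. b (f x) (g x)) x v"
        "\<lambda>x. b (f x) (\<D> g x v) + b (\<D> f x v) (g x)"]
      Suc.prems D_eqI[OF hd] Ck_on_add[OF assms(2) Suc.IH[OF Ck_on_SucD, of f "\<lambda>x. \<D> g x v"]
        Suc.IH[OF _ Ck_on_SucD, of "\<lambda>x. \<D> f x v" g]] by auto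
  then show ?case using hd by (auto simp: differentiable_def)
qed

text \<open>The directional derivative of \<open>g \<circ> f\<close> is written as a finite sum over a basis, so that it
  is again built from products and compositions of functions of lower order.\<close>

lemma Ck_on_compose:
  fixes f :: "'a::euclidean_space \<Rightarrow> 'b::euclidean_space" and g :: "'b \<Rightarrow> 'c::real_normed_vector"
  assumes "open S" "Ck_on k S f" "Ck_on k T g" "f ` S \<subseteq> T"
  shows "Ck_on k S (\<lambda>x. g (f x))"
  using assms(2,3)
proof (induction k arbitrary: g)
  case 0
  then show ?case using assms(4) by (auto intro: continuous_on_compose2)
next
  case (Suc k)
  have df: "f differentiable (at x)" and dg: "g differentiable (at (f x))" if "x \<in> S" for x
    using Suc.prems that assms(4) by auto
  have hd: "((\<lambda>x. g (f x)) has_derivative (\<lambda>v. \<D> g (f x) (\<D> f x v))) (at x)" if "x \<in> S" for x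
    using diff_chain_at[OF D_works[OF df] D_works[OF dg]] that by (simp add: o_def)
  have lin: "linear (\<D> g (f x))" if "x \<in> S" for x by (rule D_linear[OF dg[OF that]])
  have ex: "\<D> (\<lambda>x. g (f x)) x v = (\<Sum>b\<in>Basis. (\<D> f x v \<bullet> b) *\<^sub>R \<D> g (f x) b)" if "x \<in> S" for x v
  proof -
    have "\<D> (\<lambda>x. g (f x)) x v = \<D> g (f x) (\<Sum>b\<in>Basis. (\<D> f x v \<bullet> b) *\<^sub>R b)"
      using D_eqI[OF hd[OF that]] by (simp add: euclidean_representation)
    then show ?thesis using lin[OF that] by (simp add: linear_sum linear_scale)
  qed
  have "Ck_on k S (\<lambda>x. \<Sum>b\<in>Basis. (\<D> f x v \<bullet> b) *\<^sub>R \<D> g (f x) b)" for v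
  proof (intro Ck_on_sum Ck_on_bilinear[OF bounded_bilinear_scaleR] assms(1))
    fix b :: 'b
    show "Ck_on k S (\<lambda>x. \<D> f x v \<bullet> b)"
      using Suc.prems by (intro Ck_on_bounded_linear[OF bounded_linear_inner_left] assms(1)) auto
    show "Ck_on k S (\<lambda>x. \<D> g (f x) b)"
      using Suc.prems by (intro Suc.IH Ck_on_SucD[of k S f]) auto
  qed
  then have "Ck_on k S (\<lambda>x. \<D> (\<lambda>x. g (f x)) x v)" for v
    by (subst Ck_on_cong[OF assms(1) ex]) auto
  then show ?case using hd by (auto simp: differentiable_def)
qed

lemma smooth_on_cong:
  assumes "open S" "\<And>x. x \<in> S \<Longrightarrow> f x = g x"
  shows "smooth_on S f \<longleftrightarrow> smooth_on S g"
  using Ck_on_cong[OF assms] by (simp add: smooth_on_def)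

lemma smooth_on_transform:
  assumes "smooth_on S g" "open S" "\<And>x. x \<in> S \<Longrightarrow> f x = g x"
  shows "smooth_on S f"
  using assms smooth_on_cong[of S f g] by simp

lemma smooth_on_subset: "smooth_on S f \<Longrightarrow> T \<subseteq> S \<Longrightarrow> smooth_on T f"
  unfolding smooth_on_def by (blast intro: Ck_on_subset)

lemma smooth_on_local:
  assumes "\<And>x. x \<in> S \<Longrightarrow> \<exists>T. open T \<and> x \<in> T \<and> smooth_on T f"
  shows "smooth_on S f"
  unfolding smooth_on_def by (intro allI Ck_on_local) (use assms in \<open>force simp: smooth_on_def\<close>)

lemma smooth_on_const [simp, intro]: "smooth_on S (\<lambda>x. c)"
  by (simp add: smooth_on_def Ck_on_const)

lemma smooth_on_imp_differentiable: "smooth_on S f \<Longrightarrow> x \<in> S \<Longrightarrow> f differentiable (at x)"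
  unfolding smooth_on_def by (metis Ck_on.simps(2))

lemma smooth_on_imp_continuous_on: "smooth_on S f \<Longrightarrow> continuous_on S f"
  unfolding smooth_on_def by (metis Ck_on.simps(1))

lemma smooth_on_D: "smooth_on S f \<Longrightarrow> smooth_on S (\<lambda>x. \<D> f x v)"
  unfolding smooth_on_def by (metis Ck_on.simps(2))

lemma smooth_on_bounded_linear:
  "bounded_linear L \<Longrightarrow> open S \<Longrightarrow> smooth_on S f \<Longrightarrow> smooth_on S (\<lambda>x. L (f x))"
  unfolding smooth_on_def by (blast intro: Ck_on_bounded_linear)

lemma smooth_on_id: "open S \<Longrightarrow> smooth_on S (\<lambda>x. x)"
proof -
  have "Ck_on k S (\<lambda>x. x)" for k by (induction k) (auto simp: Ck_on_const)
  then show ?thesis by (simp add: smooth_on_def)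
qed

lemma smooth_on_add:
  "open S \<Longrightarrow> smooth_on S f \<Longrightarrow> smooth_on S g \<Longrightarrow> smooth_on S (\<lambda>x. f x + g x)"
  unfolding smooth_on_def by (blast intro: Ck_on_add)

lemma smooth_on_sum:
  "open S \<Longrightarrow> (\<And>i. i \<in> I \<Longrightarrow> smooth_on S (f i)) \<Longrightarrow> smooth_on S (\<lambda>x. \<Sum>i\<in>I. f i x)"
  unfolding smooth_on_def by (blast intro: Ck_on_sum)

lemma smooth_on_bilinear:
  "bounded_bilinear b \<Longrightarrow> open S \<Longrightarrow> smooth_on S f \<Longrightarrow> smooth_on S g \<Longrightarrow> smooth_on S (\<lambda>x. b (f x) (g x))"
  unfolding smooth_on_def by (blast intro: Ck_on_bilinear)

lemmas smooth_on_scaleR = smooth_on_bilinear[OF bounded_bilinear_scaleR]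
lemmas smooth_on_uminus = smooth_on_bounded_linear[OF bounded_linear_minus[OF bounded_linear_ident]]

lemma smooth_on_diff:
  "open S \<Longrightarrow> smooth_on S f \<Longrightarrow> smooth_on S g \<Longrightarrow> smooth_on S (\<lambda>x. f x - g x)"
  using smooth_on_add[of S f "\<lambda>x. - g x"] smooth_on_uminus[of S g] by simp

lemma smooth_on_compose:
  fixes f :: "'a::euclidean_space \<Rightarrow> 'b::euclidean_space"
  assumes "open S" "smooth_on S f" "smooth_on T g" "f ` S \<subseteq> T"
  shows "smooth_on S (\<lambda>x. g (f x))"
  using Ck_on_compose[OF assms(1) _ _ assms(4)] assms(2,3) by (auto simp: smooth_on_def)

lemma smooth_on_Pair:
  assumes "open S" "smooth_on S f" "smooth_on S g"
  shows "smooth_on S (\<lambda>x. (f x, g x))"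
proof -
  have "smooth_on S (\<lambda>x. (f x, 0) + (0, g x))"
    by (intro smooth_on_add assms smooth_on_bounded_linear[OF bounded_linear_Pair]
        bounded_linear_ident bounded_linear_zero smooth_on_bounded_linear[where f=f and L="\<lambda>x. (x, 0)"]
        smooth_on_bounded_linear[where f=g and L="\<lambda>x. (0, x)"])
  then show ?thesis by simp
qed

lemmas linear_simps = linear_add linear_diff linear_scale linear_neg

lemma linear_expand:
  fixes v :: "'e::euclidean_space"
  assumes "linear L"
  shows "L v = (\<Sum>b\<in>Basis. (v \<bullet> b) *\<^sub>R L b)"
proof -
  have "L v = L (\<Sum>b\<in>Basis. (v \<bullet> b) *\<^sub>R b)" by (simp add: euclidean_representation)
  then show ?thesis using assms by (simp add: linear_sum linear_scale)
qed

lemma smooth_on_apply: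
  fixes w :: "'x::euclidean_space \<Rightarrow> 'e::euclidean_space"
  assumes "open S" "\<And>x. x \<in> S \<Longrightarrow> linear (A x)" "\<And>v. smooth_on S (\<lambda>x. A x v)" "smooth_on S w"
  shows "smooth_on S (\<lambda>x. A x (w x))"
proof -
  have "smooth_on S (\<lambda>x. w x \<bullet> b)" for b
    by (rule smooth_on_bounded_linear[OF bounded_linear_inner_left assms(1,4)])
  then have "smooth_on S (\<lambda>x. \<Sum>b\<in>Basis. (w x \<bullet> b) *\<^sub>R A x b)"
    by (intro smooth_on_sum smooth_on_scaleR assms(1,3))
  moreover have "A x (w x) = (\<Sum>b\<in>Basis. (w x \<bullet> b) *\<^sub>R A x b)" if "x \<in> S" for x
    by (rule linear_expand[OF assms(2)[OF that]])
  ultimately show ?thesis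
    using smooth_on_cong[OF assms(1), of "\<lambda>x. A x (w x)" "\<lambda>x. \<Sum>b\<in>Basis. (w x \<bullet> b) *\<^sub>R A x b"] by simp
qed

text \<open>The Leibniz rule for a field of linear maps applied to a vector field. Tensor components are
  given by their values on constant vectors, so the derivative of \<open>A\<close> enters only through
  \<open>\<lambda>x. A x v\<close> with the vector \<open>v\<close> frozen at the point of differentiation.\<close>

lemma has_derivative_apply:
  fixes w :: "'x::euclidean_space \<Rightarrow> 'e::euclidean_space"
  assumes "open S" "\<And>x. x \<in> S \<Longrightarrow> linear (A x)" "\<And>v. smooth_on S (\<lambda>x. A x v)"
    and "w differentiable (at x)" "x \<in> S" "v = w x"
  shows "((\<lambda>x. A x (w x)) has_derivative (\<lambda>a. \<D> (\<lambda>x. A x v) x a + A x (\<D> w x a))) (at x)"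
proof -
  let ?S = "\<lambda>x. \<Sum>b\<in>Basis. (w x \<bullet> b) *\<^sub>R A x b"
  have dA: "((\<lambda>x. A x v) has_derivative \<D> (\<lambda>x. A x v) x) (at x)" for v
    using D_works smooth_on_imp_differentiable assms by blast
  have dw: "((\<lambda>x. w x \<bullet> b) has_derivative (\<lambda>a. \<D> w x a \<bullet> b)) (at x)" for b
    using bounded_linear.has_derivative[OF bounded_linear_inner_left D_works[OF assms(4)]] .
  have "(?S has_derivative (\<lambda>a. \<Sum>b\<in>Basis. (w x \<bullet> b) *\<^sub>R \<D> (\<lambda>x. A x b) x a + (\<D> w x a \<bullet> b) *\<^sub>R A x b)) (at x)"
    by (intro has_derivative_sum has_derivative_scaleR dA dw)
  moreover have "((\<lambda>x. \<Sum>b\<in>Basis. (v \<bullet> b) *\<^sub>R A x b) has_derivative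
      (\<lambda>a. \<Sum>b\<in>Basis. (v \<bullet> b) *\<^sub>R \<D> (\<lambda>x. A x b) x a)) (at x)"
    by (intro has_derivative_sum has_derivative_scaleR_right dA)
  then have "((\<lambda>x. A x v) has_derivative (\<lambda>a. \<Sum>b\<in>Basis. (v \<bullet> b) *\<^sub>R \<D> (\<lambda>x. A x b) x a)) (at x)"
    using has_derivative_cong_open[OF assms(1,5), of "\<lambda>x. A x v" "\<lambda>x. \<Sum>b\<in>Basis. (v \<bullet> b) *\<^sub>R A x b"]
      linear_expand[OF assms(2)] by blast
  then have "\<D> (\<lambda>x. A x v) x = (\<lambda>a. \<Sum>b\<in>Basis. (v \<bullet> b) *\<^sub>R \<D> (\<lambda>x. A x b) x a)"
    by (rule D_eqI)
  moreover have "A x (\<D> w x a) = (\<Sum>b\<in>Basis. (\<D> w x a \<bullet> b) *\<^sub>R A x b)" for a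
    using linear_expand[OF assms(2)[OF assms(5)]] .
  moreover have "((\<lambda>x. A x (w x)) has_derivative f') (at x) \<longleftrightarrow> (?S has_derivative f') (at x)" for f'
    using has_derivative_cong_open[OF assms(1,5), of "\<lambda>x. A x (w x)" ?S] linear_expand[OF assms(2)] by blast
  ultimately show ?thesis using assms(6) by (simp add: sum.distrib)
qed

lemma D_apply:
  fixes w :: "'x::euclidean_space \<Rightarrow> 'e::euclidean_space"
  assumes "open S" "\<And>x. x \<in> S \<Longrightarrow> linear (A x)" "\<And>v. smooth_on S (\<lambda>x. A x v)"
    and "w differentiable (at x)" "x \<in> S"
  shows "\<D> (\<lambda>y. A y (w y)) x a = \<D> (\<lambda>y. A y (w x)) x a + A x (\<D> w x a)"
  using D_eqI[OF has_derivative_apply[OF assms refl]] by simp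

text \<open>The second difference of \<open>f\<close> over the parallelogram spanned by \<open>h v\<close> and \<open>h w\<close> is
  symmetric in \<open>v\<close> and \<open>w\<close>; two applications of the mean value theorem express it
  as \<open>h\<^sup>2\<close> times a mixed second derivative at a point of the parallelogram.\<close>

lemma second_difference_mvt:
  fixes f :: "'e::euclidean_space \<Rightarrow> real"
  assumes "h > 0" and S: "\<And>s t. 0 \<le> s \<Longrightarrow> s \<le> h \<Longrightarrow> 0 \<le> t \<Longrightarrow> t \<le> h \<Longrightarrow> x + s *\<^sub>R v + t *\<^sub>R w \<in> S"
    and f: "smooth_on S f"
  obtains s t where "0 < s" "s < h" "0 < t" "t < h"
    "f (x + h *\<^sub>R v + h *\<^sub>R w) - f (x + h *\<^sub>R v) - f (x + h *\<^sub>R w) + f x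
       = h * h * \<D> (\<lambda>y. \<D> f y v) (x + s *\<^sub>R v + t *\<^sub>R w) w"
proof -
  have lineD: "((\<lambda>s. F (c + s *\<^sub>R u)) has_real_derivative \<D> F (c + s *\<^sub>R u) u) (at s)"
    if "F differentiable (at (c + s *\<^sub>R u))" for F :: "'e \<Rightarrow> real" and c u s
  proof -
    have "((\<lambda>s. c + s *\<^sub>R u) has_derivative (\<lambda>r. r *\<^sub>R u)) (at s)"
      by (auto intro!: derivative_eq_intros)
    from diff_chain_at[OF this D_works[OF that]]
    have "((\<lambda>s. F (c + s *\<^sub>R u)) has_derivative (\<lambda>r. \<D> F (c + s *\<^sub>R u) (r *\<^sub>R u))) (at s)"
      by (simp add: o_def)
    moreover have "(\<lambda>r. \<D> F (c + s *\<^sub>R u) (r *\<^sub>R u)) = (*) (\<D> F (c + s *\<^sub>R u) u)"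
      using linear_scale[OF D_linear[OF that]] by (auto simp: mult.commute)
    ultimately show ?thesis by (simp add: has_field_derivative_def)
  qed
  have df: "f differentiable (at y)" "(\<lambda>y. \<D> f y v) differentiable (at y)" if "y \<in> S" for y
    using smooth_on_imp_differentiable[OF f that] smooth_on_imp_differentiable[OF smooth_on_D[OF f] that] .
  let ?p = "\<lambda>s. f ((x + h *\<^sub>R w) + s *\<^sub>R v) - f (x + s *\<^sub>R v)"
  let ?p' = "\<lambda>s. \<D> f ((x + h *\<^sub>R w) + s *\<^sub>R v) v - \<D> f (x + s *\<^sub>R v) v"
  have "DERIV ?p s :> ?p' s" if "0 \<le> s" "s \<le> h" for s
    using S[of s h] S[of s 0] that \<open>h > 0\<close>
    by (intro DERIV_diff lineD df) (auto simp: algebra_simps)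
  from MVT2[OF \<open>h > 0\<close> this] obtain s where s: "0 < s" "s < h" "?p h - ?p 0 = h * ?p' s" by auto
  let ?r = "\<lambda>t. \<D> f ((x + s *\<^sub>R v) + t *\<^sub>R w) v"
  let ?r' = "\<lambda>t. \<D> (\<lambda>y. \<D> f y v) ((x + s *\<^sub>R v) + t *\<^sub>R w) w"
  have "DERIV ?r t :> ?r' t" if "0 \<le> t" "t \<le> h" for t
    by (rule lineD, rule df) (use S[of s t] s that in auto)
  from MVT2[OF \<open>h > 0\<close> this] obtain t where t: "0 < t" "t < h" "?r h - ?r 0 = h * ?r' t" by auto
  have "?p' s = ?r h - ?r 0" by (simp add: algebra_simps)
  with s(3) t(3) have "?p h - ?p 0 = h * h * ?r' t" by simp
  with s t that show ?thesis by (simp add: algebra_simps)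
qed

lemma D_D_sym_real:
  fixes f :: "'e::euclidean_space \<Rightarrow> real"
  assumes "open S" "smooth_on S f" "x \<in> S"
  shows "\<D> (\<lambda>y. \<D> f y v) x w = \<D> (\<lambda>y. \<D> f y w) x v"
proof -
  let ?a = "\<lambda>y. \<D> (\<lambda>y. \<D> f y v) y w" and ?b = "\<lambda>y. \<D> (\<lambda>y. \<D> f y w) y v"
  have cont: "isCont ?a x" "isCont ?b x"
    using smooth_on_imp_continuous_on[OF smooth_on_D[OF smooth_on_D[OF assms(2)]]] assms(1,3)
    by (auto simp: continuous_on_eq_continuous_at)
  have "\<bar>?a x - ?b x\<bar> < e" if "e > 0" for e
  proof -
    obtain d1 where d1: "d1 > 0" "\<And>y. dist y x < d1 \<Longrightarrow> dist (?a y) (?a x) < e/2"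
      using cont(1) \<open>e > 0\<close> unfolding continuous_at_eps_delta by (meson half_gt_zero)
    obtain d2 where d2: "d2 > 0" "\<And>y. dist y x < d2 \<Longrightarrow> dist (?b y) (?b x) < e/2"
      using cont(2) \<open>e > 0\<close> unfolding continuous_at_eps_delta by (meson half_gt_zero)
    obtain d3 where d3: "d3 > 0" "ball x d3 \<subseteq> S"
      using assms openE by blast
    define d where "d = Min {d1, d2, d3}"
    have d: "d > 0" "d \<le> d1" "d \<le> d2" "d \<le> d3" using d1 d2 d3 by (auto simp: d_def)
    \<comment> \<open>so small that the parallelogram spanned by \<open>h v\<close> and \<open>h w\<close> lies in the ball of radius \<open>d\<close>\<close>
    define h where "h = d / (2 * (norm v + norm w + 1))"
    have pos: "norm v + norm w + 1 > 0" by (smt (verit) norm_ge_zero)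
    then have h: "h > 0" using d by (simp add: h_def)
    have near: "dist (x + s *\<^sub>R v + t *\<^sub>R w) x < d" if "0 \<le> s" "s \<le> h" "0 \<le> t" "t \<le> h" for s t
    proof -
      have "dist (x + s *\<^sub>R v + t *\<^sub>R w) x \<le> s * norm v + t * norm w"
        using that norm_triangle_ineq[of "s *\<^sub>R v" "t *\<^sub>R w"] by (simp add: dist_norm algebra_simps)
      also have "\<dots> \<le> h * norm v + h * norm w"
        using that by (intro add_mono mult_right_mono) auto
      also have "\<dots> \<le> h * (norm v + norm w + 1)" using h by (simp add: algebra_simps)
      also have "\<dots> = d / 2" using pos by (simp add: h_def field_split_simps)
      also have "\<dots> < d" using d by simp
      finally show ?thesis .
    qed
    have inS: "x + s *\<^sub>R v + t *\<^sub>R w \<in> S" if "0 \<le> s" "s \<le> h" "0 \<le> t" "t \<le> h" for s t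
      using near[OF that] d d3 by (auto simp: dist_commute subset_iff)
    obtain s t where st: "0 < s" "s < h" "0 < t" "t < h"
      "f (x + h *\<^sub>R v + h *\<^sub>R w) - f (x + h *\<^sub>R v) - f (x + h *\<^sub>R w) + f x
         = h * h * ?a (x + s *\<^sub>R v + t *\<^sub>R w)"
      using second_difference_mvt[OF h inS assms(2)] by blast
    have inS': "x + t *\<^sub>R w + s *\<^sub>R v \<in> S" if "0 \<le> t" "t \<le> h" "0 \<le> s" "s \<le> h" for s t
      using inS[of s t] that by (simp add: algebra_simps)
    obtain t' s' where st': "0 < t'" "t' < h" "0 < s'" "s' < h"
      "f (x + h *\<^sub>R w + h *\<^sub>R v) - f (x + h *\<^sub>R w) - f (x + h *\<^sub>R v) + f x
         = h * h * ?b (x + t' *\<^sub>R w + s' *\<^sub>R v)"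
      using second_difference_mvt[OF h inS' assms(2)] by blast
    have "h * h * ?a (x + s *\<^sub>R v + t *\<^sub>R w) = h * h * ?b (x + s' *\<^sub>R v + t' *\<^sub>R w)"
      using st(5) st'(5) by (simp add: algebra_simps)
    then have eq: "?a (x + s *\<^sub>R v + t *\<^sub>R w) = ?b (x + s' *\<^sub>R v + t' *\<^sub>R w)" using h by simp
    have "dist (?a (x + s *\<^sub>R v + t *\<^sub>R w)) (?a x) < e/2"
      using near[of s t] st d by (intro d1) auto
    moreover have "dist (?b (x + s' *\<^sub>R v + t' *\<^sub>R w)) (?b x) < e/2"
      using near[of s' t'] st' d by (intro d2) auto
    ultimately show ?thesis using eq unfolding dist_real_def by argo
  qed
  then have "\<bar>?a x - ?b x\<bar> \<le> 0" by (meson le_less_linear less_irrefl)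
  then show ?thesis by simp
qed

lemma D_D_sym:
  fixes f :: "'e::euclidean_space \<Rightarrow> 'f::euclidean_space"
  assumes "open S" "smooth_on S f" "x \<in> S"
  shows "\<D> (\<lambda>y. \<D> f y v) x w = \<D> (\<lambda>y. \<D> f y w) x v"
proof (rule euclidean_eqI)
  fix b :: 'f
  have comp: "\<D> (\<lambda>y. F y \<bullet> b) y u = \<D> F y u \<bullet> b" if "smooth_on S F" "y \<in> S" for F y u
    using D_eqI[OF bounded_linear.has_derivative[OF bounded_linear_inner_left
          D_works[OF smooth_on_imp_differentiable[OF that]]]] by simp
  have *: "\<D> (\<lambda>y. \<D> (\<lambda>y. f y \<bullet> b) y u) x u' = \<D> (\<lambda>y. \<D> f y u) x u' \<bullet> b" for u u'
    using D_cong[OF assms(1,3), of "\<lambda>y. \<D> (\<lambda>y. f y \<bullet> b) y u" "\<lambda>y. \<D> f y u \<bullet> b"]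
      comp[OF assms(2)] comp[OF smooth_on_D[OF assms(2)] assms(3)] by simp
  show "\<D> (\<lambda>y. \<D> f y v) x w \<bullet> b = \<D> (\<lambda>y. \<D> f y w) x v \<bullet> b"
    using D_D_sym_real[OF assms(1) smooth_on_bounded_linear[OF bounded_linear_inner_left assms(1,2)] assms(3)]
    unfolding *[symmetric] .
qed

section \<open>Charts, components and coordinate expressions\<close>

text \<open>Continuity of the inverse of a chart is used below as openness of the chart.\<close>

lemma is_chart_iff:
  "is_chart X c \<longleftrightarrow> openin X (fst c) \<and> open (snd c ` fst c) \<and> inj_on (snd c) (fst c) \<and>
     continuous_map (subtopology X (fst c)) euclidean (snd c) \<and>
     (\<forall>T. openin X T \<and> T \<subseteq> fst c \<longrightarrow> open (snd c ` T))"
  (is "?L \<longleftrightarrow> ?R")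
proof (cases "openin X (fst c) \<and> open (snd c ` fst c)")
  case True
  then have sub: "fst c \<subseteq> topspace X" by (simp add: openin_subset)
  have "open_map (subtopology X (fst c)) (top_of_set (snd c ` fst c)) (snd c) \<longleftrightarrow>
      (\<forall>T. openin X T \<and> T \<subseteq> fst c \<longrightarrow> open (snd c ` T))"
    unfolding open_map_def using True
    by (auto simp: openin_open_subtopology openin_open_eq image_mono)
  note open_iff = this
  have top: "topspace (subtopology X (fst c)) = fst c" using sub by auto
  show ?thesis
  proof
    assume ?L
    then have "homeomorphic_map (subtopology X (fst c)) (top_of_set (snd c ` fst c)) (snd c)"
      by (simp add: is_chart_def)
    then show ?R
      using True open_iff top homeomorphic_imp_continuous_map homeomorphic_imp_open_map
        homeomorphic_imp_injective_map continuous_map_in_subtopology by metis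
  next
    assume ?R
    then have "homeomorphic_map (subtopology X (fst c)) (top_of_set (snd c ` fst c)) (snd c)"
      using open_iff top by (intro bijective_open_imp_homeomorphic_map) (auto simp: continuous_map_in_subtopology)
    then show ?L using True by (simp add: is_chart_def)
  qed
qed (auto simp: is_chart_def)

text \<open>The derivative of a coordinate change. Since a tangent vector is stored by its components in the
  preferred chart, \<open>tcoord\<close> and \<open>coord_field\<close> are the cases in which one of the two charts
  is the preferred one, and they are mutually inverse by the chain rule.\<close>

definition jac :: "('a, 'e::euclidean_space) chart \<Rightarrow> ('a, 'e) chart \<Rightarrow> 'a \<Rightarrow> 'e \<Rightarrow> 'e" where
  "jac c d p = \<D> (snd d \<circ> cinv c) (snd c p)"

lemma tcoord_jac: "tcoord M c p = jac (chart_at M p) c p"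
  by (simp add: tcoord_def jac_def)

lemma coord_field_jac: "coord_field M c e p = jac c (chart_at M p) p e"
  by (simp add: coord_field_def jac_def)

definition endo_rep :: "('a, 'e::euclidean_space) manifold \<Rightarrow> ('a, 'e) chart \<Rightarrow> ('a, 'e) endo \<Rightarrow> 'e \<Rightarrow> 'e \<Rightarrow> 'e" where
  "endo_rep M c A y v = vf_rep M c (\<lambda>p. A p (coord_field M c v p)) y"

definition form_rep :: "('a, 'e::euclidean_space) manifold \<Rightarrow> ('a, 'e) chart \<Rightarrow> ('a, 'e) form1 \<Rightarrow> 'e \<Rightarrow> 'e \<Rightarrow> real" where
  "form_rep M c \<alpha> y v = \<alpha> (cinv c y) (coord_field M c v (cinv c y))"

definition bilin_rep :: "('a, 'e::euclidean_space) manifold \<Rightarrow> ('a, 'e) chart \<Rightarrow> ('a, 'e) bilin \<Rightarrow> 'e \<Rightarrow> 'e \<Rightarrow> 'e \<Rightarrow> real" where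
  "bilin_rep M c b y v w = b (cinv c y) (coord_field M c v (cinv c y)) (coord_field M c w (cinv c y))"

lemma smooth_endo_rep:
  "smooth_endo M A \<longleftrightarrow> (\<forall>p\<in>points M. linear (A p)) \<and>
     (\<forall>c\<in>atlas M. \<forall>e. smooth_on (snd c ` fst c) (\<lambda>y. endo_rep M c A y e))"
  by (simp add: smooth_endo_def endo_rep_def)

lemma smooth_form1_rep:
  "smooth_form1 M \<alpha> \<longleftrightarrow> (\<forall>p\<in>points M. linear (\<alpha> p)) \<and>
     (\<forall>c\<in>atlas M. \<forall>e. smooth_on (snd c ` fst c) (\<lambda>y. form_rep M c \<alpha> y e))"
  by (simp add: smooth_form1_def form_rep_def o_def)

lemma smooth_bilin_rep:
  "smooth_bilin M b \<longleftrightarrow> (\<forall>p\<in>points M. (\<forall>v. linear (b p v)) \<and> (\<forall>w. linear (\<lambda>v. b p v w))) \<and>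
     (\<forall>c\<in>atlas M. \<forall>e e'. smooth_on (snd c ` fst c) (\<lambda>y. bilin_rep M c b y e e'))"
  by (simp add: smooth_bilin_def bilin_rep_def o_def)

text \<open>These are the values on constant fields \<open>u\<close>, \<open>v\<close>, \<open>w\<close>, with the brackets
  written out: \<open>[v, w] = 0\<close>, while \<open>[A v, w]\<close> is minus the derivative of \<open>A v\<close> along
  \<open>w\<close>.\<close>

definition d1_flat :: "('e::euclidean_space \<Rightarrow> 'e \<Rightarrow> real) \<Rightarrow> 'e \<Rightarrow> 'e \<Rightarrow> 'e \<Rightarrow> real" where
  "d1_flat \<alpha> y v w = \<D> (\<lambda>y. \<alpha> y w) y v - \<D> (\<lambda>y. \<alpha> y v) y w"

definition d2_flat :: "('e::euclidean_space \<Rightarrow> 'e \<Rightarrow> 'e \<Rightarrow> real) \<Rightarrow> 'e \<Rightarrow> 'e \<Rightarrow> 'e \<Rightarrow> 'e \<Rightarrow> real" where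
  "d2_flat \<omega> y u v w = \<D> (\<lambda>y. \<omega> y v w) y u - \<D> (\<lambda>y. \<omega> y u w) y v + \<D> (\<lambda>y. \<omega> y u v) y w"

definition nijenhuis_flat :: "('e::euclidean_space \<Rightarrow> 'e \<Rightarrow> 'e) \<Rightarrow> 'e \<Rightarrow> 'e \<Rightarrow> 'e \<Rightarrow> 'e" where
  "nijenhuis_flat A y v w =
     \<D> (\<lambda>y. A y w) y (A y v) - \<D> (\<lambda>y. A y v) y (A y w) +
     A y (\<D> (\<lambda>y. A y v) y w - \<D> (\<lambda>y. A y w) y v)"

locale smooth_mfd =
  fixes M :: "('a, 'e::euclidean_space) manifold"
  assumes smooth_manifold: "smooth_manifold M"
begin

lemma atlas_is_chart: "c \<in> atlas M \<Longrightarrow> is_chart (mtop M) c"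
  using smooth_manifold by (auto simp: smooth_manifold_def)

lemma chart_at_in: "p \<in> points M \<Longrightarrow> chart_at M p \<in> atlas M" "p \<in> points M \<Longrightarrow> p \<in> fst (chart_at M p)"
  using smooth_manifold by (auto simp: smooth_manifold_def)

lemma transition_smooth:
  "c \<in> atlas M \<Longrightarrow> d \<in> atlas M \<Longrightarrow> smooth_on (snd c ` (fst c \<inter> fst d)) (snd d \<circ> cinv c)"
  using smooth_manifold by (auto simp: smooth_manifold_def)

lemma chart_dom_open: "c \<in> atlas M \<Longrightarrow> openin (mtop M) (fst c)"
  using atlas_is_chart by (auto simp: is_chart_iff)

lemma chart_dom_points: "c \<in> atlas M \<Longrightarrow> p \<in> fst c \<Longrightarrow> p \<in> points M"
  using chart_dom_open openin_subset by blast

lemma chart_inj: "c \<in> atlas M \<Longrightarrow> inj_on (snd c) (fst c)"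
  using atlas_is_chart by (auto simp: is_chart_iff)

lemma chart_image_open: "c \<in> atlas M \<Longrightarrow> openin (mtop M) W \<Longrightarrow> open (snd c ` (fst c \<inter> W))"
  using atlas_is_chart[of c] by (auto simp: is_chart_iff)

lemma chart_range_open: "c \<in> atlas M \<Longrightarrow> open (snd c ` fst c)"
  using atlas_is_chart[of c] by (auto simp: is_chart_iff)

lemma cinv_chart [simp]: "c \<in> atlas M \<Longrightarrow> p \<in> fst c \<Longrightarrow> cinv c (snd c p) = p"
  using chart_inj by (simp add: inv_into_f_f)

lemma jac_differentiable:
  assumes "c \<in> atlas M" "d \<in> atlas M" "p \<in> fst c" "p \<in> fst d"
  shows "(snd d \<circ> cinv c) differentiable (at (snd c p))"
  by (rule smooth_on_imp_differentiable[OF transition_smooth[OF assms(1,2)]]) (use assms in auto)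

lemma jac_linear:
  assumes "c \<in> atlas M" "d \<in> atlas M" "p \<in> fst c" "p \<in> fst d"
  shows "linear (jac c d p)"
  unfolding jac_def by (rule D_linear[OF jac_differentiable[OF assms]])

lemma jac_self:
  assumes "c \<in> atlas M" "p \<in> fst c"
  shows "jac c c p v = v"
proof -
  have "\<D> (snd c \<circ> cinv c) (snd c p) = \<D> (\<lambda>y. y) (snd c p)"
    by (rule D_cong[OF chart_range_open[OF assms(1)]]) (use assms in auto)
  then show ?thesis by (simp add: jac_def)
qed

lemma jac_jac:
  assumes "c \<in> atlas M" "d \<in> atlas M" "e \<in> atlas M" "p \<in> fst c" "p \<in> fst d" "p \<in> fst e"
  shows "jac d e p (jac c d p v) = jac c e p v"
proof -
  let ?S = "snd c ` (fst c \<inter> (fst d \<inter> fst e))"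
  have S: "open ?S" using assms by (intro chart_image_open openin_Int chart_dom_open)
  have "\<D> (snd e \<circ> cinv c) (snd c p) v = \<D> (\<lambda>x. (snd e \<circ> cinv d) ((snd d \<circ> cinv c) x)) (snd c p) v"
    by (subst D_cong[OF S]) (use assms in auto)
  also have "\<dots> = \<D> (snd e \<circ> cinv d) ((snd d \<circ> cinv c) (snd c p)) (\<D> (snd d \<circ> cinv c) (snd c p) v)"
    by (rule D_compose) (use jac_differentiable[of c d p] jac_differentiable[of d e p] assms in \<open>simp_all add: o_def\<close>)
  finally show ?thesis using assms by (simp add: jac_def)
qed

lemma tcoord_coord_field [simp]:
  "c \<in> atlas M \<Longrightarrow> p \<in> fst c \<Longrightarrow> tcoord M c p (coord_field M c v p) = v"
  using chart_at_in[of p] chart_dom_points[of c p]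
  by (simp add: tcoord_jac coord_field_jac jac_jac jac_self)

lemma coord_field_tcoord [simp]:
  "c \<in> atlas M \<Longrightarrow> p \<in> fst c \<Longrightarrow> coord_field M c (tcoord M c p v) p = v"
  using chart_at_in[of p] chart_dom_points[of c p]
  by (simp add: tcoord_jac coord_field_jac jac_jac jac_self)

lemma linear_tcoord: "c \<in> atlas M \<Longrightarrow> p \<in> fst c \<Longrightarrow> linear (tcoord M c p)"
  using chart_at_in[of p] chart_dom_points[of c p] by (simp add: tcoord_jac jac_linear)

lemma linear_coord_field: "c \<in> atlas M \<Longrightarrow> p \<in> fst c \<Longrightarrow> linear (\<lambda>v. coord_field M c v p)"
  using chart_at_in[of p] chart_dom_points[of c p] jac_linear[of c "chart_at M p" p]
  by (simp add: coord_field_jac[abs_def])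

lemma tcoord_chart_at: "p \<in> points M \<Longrightarrow> tcoord M (chart_at M p) p v = v"
  using chart_at_in[of p] by (simp add: tcoord_jac jac_self)

lemma vf_rep_at: "c \<in> atlas M \<Longrightarrow> p \<in> fst c \<Longrightarrow> vf_rep M c X (snd c p) = tcoord M c p (X p)"
  by (simp add: vf_rep_def)

lemma vf_rep_endo:
  "c \<in> atlas M \<Longrightarrow> y \<in> snd c ` fst c \<Longrightarrow>
     vf_rep M c (\<lambda>q. A q (X q)) y = endo_rep M c A y (vf_rep M c X y)"
  by (auto simp: endo_rep_def vf_rep_at)

lemma form_rep_vf:
  "c \<in> atlas M \<Longrightarrow> y \<in> snd c ` fst c \<Longrightarrow> \<alpha> (cinv c y) (X (cinv c y)) = form_rep M c \<alpha> y (vf_rep M c X y)"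
  by (auto simp: form_rep_def vf_rep_at)

lemma bilin_rep_vf:
  "c \<in> atlas M \<Longrightarrow> y \<in> snd c ` fst c \<Longrightarrow>
     b (cinv c y) (X (cinv c y)) (Y (cinv c y)) = bilin_rep M c b y (vf_rep M c X y) (vf_rep M c Y y)"
  by (auto simp: bilin_rep_def vf_rep_at)

lemma endo_rep_at: "c \<in> atlas M \<Longrightarrow> p \<in> fst c \<Longrightarrow>
    endo_rep M c A (snd c p) v = tcoord M c p (A p (coord_field M c v p))"
  by (simp add: endo_rep_def vf_rep_at)

lemma form_rep_at: "c \<in> atlas M \<Longrightarrow> p \<in> fst c \<Longrightarrow>
    form_rep M c \<alpha> (snd c p) v = \<alpha> p (coord_field M c v p)"
  by (simp add: form_rep_def)

lemma bilin_rep_at: "c \<in> atlas M \<Longrightarrow> p \<in> fst c \<Longrightarrow>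
    bilin_rep M c b (snd c p) v w = b p (coord_field M c v p) (coord_field M c w p)"
  by (simp add: bilin_rep_def)

lemma linear_endo_rep:
  assumes "\<forall>p\<in>points M. linear (A p)" "c \<in> atlas M" "y \<in> snd c ` fst c"
  shows "linear (endo_rep M c A y)"
proof -
  obtain p where p: "p \<in> fst c" "y = snd c p" using assms by auto
  have "linear (\<lambda>v. tcoord M c p (A p (coord_field M c v p)))"
    using linear_compose[OF linear_compose[OF linear_coord_field[OF assms(2) p(1)], of "A p"]
        linear_tcoord[OF assms(2) p(1)]] assms(1) chart_dom_points[OF assms(2) p(1)] by (simp add: o_def)
  then show ?thesis using endo_rep_at[OF assms(2) p(1), of A] p by presburger
qed

lemma linear_form_rep:
  assumes "\<forall>p\<in>points M. linear (\<alpha> p)" "c \<in> atlas M" "y \<in> snd c ` fst c"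
  shows "linear (form_rep M c \<alpha> y)"
proof -
  obtain p where p: "p \<in> fst c" "y = snd c p" using assms by auto
  have "linear (\<lambda>v. \<alpha> p (coord_field M c v p))"
    using linear_compose[OF linear_coord_field[OF assms(2) p(1)], of "\<alpha> p"] assms(1)
      chart_dom_points[OF assms(2) p(1)] by (simp add: o_def)
  then show ?thesis using form_rep_at[OF assms(2) p(1), of \<alpha>] p by presburger
qed

lemma linear_bilin_rep:
  assumes "\<forall>p\<in>points M. (\<forall>v. linear (b p v)) \<and> (\<forall>w. linear (\<lambda>v. b p v w))" "c \<in> atlas M" "y \<in> snd c ` fst c"
  shows "linear (bilin_rep M c b y v)" "linear (\<lambda>v. bilin_rep M c b y v w)"
proof -
  obtain p where p: "p \<in> fst c" "y = snd c p" using assms by auto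
  note lc = linear_coord_field[OF assms(2) p(1)]
  have "linear (\<lambda>w. b p (coord_field M c v p) (coord_field M c w p))"
    using linear_compose[OF lc, of "b p (coord_field M c v p)"] assms(1)
      chart_dom_points[OF assms(2) p(1)] by (simp add: o_def)
  then show "linear (bilin_rep M c b y v)" using bilin_rep_at[OF assms(2) p(1), of b] p by presburger
  have "linear (\<lambda>v. b p (coord_field M c v p) (coord_field M c w p))"
    using linear_compose[OF lc, of "\<lambda>v. b p v (coord_field M c w p)"] assms(1)
      chart_dom_points[OF assms(2) p(1)] by (simp add: o_def)
  then show "linear (\<lambda>v. bilin_rep M c b y v w)" using bilin_rep_at[OF assms(2) p(1), of b] p by presburger
qed

lemma smooth_vf_rep:
  "smooth_vfield_on M W X \<Longrightarrow> c \<in> atlas M \<Longrightarrow> smooth_on (snd c ` (fst c \<inter> W)) (vf_rep M c X)"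
  by (simp add: smooth_vfield_on_def)

lemma smooth_vfield_endo:
  assumes "smooth_endo M A" "smooth_vfield_on M W X"
  shows "smooth_vfield_on M W (\<lambda>q. A q (X q))"
  unfolding smooth_vfield_on_def
proof (intro conjI ballI)
  show W: "openin (mtop M) W" using assms by (simp add: smooth_vfield_on_def)
  fix c assume c: "c \<in> atlas M"
  let ?S = "snd c ` (fst c \<inter> W)"
  have S: "open ?S" by (rule chart_image_open[OF c W])
  have "smooth_on ?S (\<lambda>y. endo_rep M c A y (vf_rep M c X y))"
  proof (rule smooth_on_apply[OF S, where A="endo_rep M c A" and w="vf_rep M c X"])
    show "linear (endo_rep M c A y)" if "y \<in> ?S" for y
      using linear_endo_rep[OF _ c, of A y] assms(1) that by (auto simp: smooth_endo_rep)
    show "smooth_on ?S (\<lambda>y. endo_rep M c A y v)" for v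
      using assms(1) c smooth_on_subset[of "snd c ` fst c" "\<lambda>y. endo_rep M c A y v" ?S]
      by (auto simp: smooth_endo_rep)
    show "smooth_on ?S (vf_rep M c X)" by (rule smooth_vf_rep[OF assms(2) c])
  qed
  then show "smooth_on ?S (vf_rep M c (\<lambda>q. A q (X q)))"
    using smooth_on_cong[OF S, of "vf_rep M c (\<lambda>q. A q (X q))" "\<lambda>y. endo_rep M c A y (vf_rep M c X y)"]
      vf_rep_endo[OF c, of _ A X] by auto
qed

lemma vf_rep_coord_field:
  "c \<in> atlas M \<Longrightarrow> y \<in> snd c ` fst c \<Longrightarrow> vf_rep M c (coord_field M c e) y = e"
  by (auto simp: vf_rep_at)

lemma smooth_coord_field:
  assumes c: "c \<in> atlas M"
  shows "smooth_vfield_on M (fst c) (coord_field M c e)"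
  unfolding smooth_vfield_on_def
proof (intro conjI ballI)
  show "openin (mtop M) (fst c)" by (rule chart_dom_open[OF c])
  fix d assume d: "d \<in> atlas M"
  let ?S = "snd d ` (fst d \<inter> fst c)"
  have S: "open ?S" by (rule chart_image_open[OF d chart_dom_open[OF c]])
  have "smooth_on ?S (\<lambda>y. \<D> (snd d \<circ> cinv c) ((snd c \<circ> cinv d) y) e)"
    by (rule smooth_on_compose[OF S transition_smooth[OF d c] smooth_on_D[OF transition_smooth[OF c d]]])
      (use c d in auto)
  moreover have "vf_rep M d (coord_field M c e) y = \<D> (snd d \<circ> cinv c) ((snd c \<circ> cinv d) y) e" if y: "y \<in> ?S" for y
  proof -
    obtain p where p: "p \<in> fst d" "p \<in> fst c" "y = snd d p" using y by auto
    then show ?thesis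
      using c d chart_at_in[of p] chart_dom_points[of c p]
      by (simp add: vf_rep_at coord_field_jac tcoord_jac jac_jac) (simp add: jac_def)
  qed
  ultimately show "smooth_on ?S (vf_rep M d (coord_field M c e))"
    by (rule smooth_on_transform[OF _ S])
qed

lemma dir_deriv_chart:
  assumes c: "c \<in> atlas M" "p \<in> fst c" and F: "(F \<circ> cinv c) differentiable (at (snd c p))"
  shows "dir_deriv M X F p = \<D> (F \<circ> cinv c) (snd c p) (vf_rep M c X (snd c p))"
proof -
  let ?k = "chart_at M p"
  have k: "?k \<in> atlas M" "p \<in> fst ?k" using chart_at_in chart_dom_points c by auto
  let ?S = "snd ?k ` (fst ?k \<inter> fst c)"
  have S: "open ?S" by (rule chart_image_open[OF k(1) chart_dom_open[OF c(1)]])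
  have "\<D> (F \<circ> cinv ?k) (snd ?k p) (X p) = \<D> (\<lambda>x. (F \<circ> cinv c) ((snd c \<circ> cinv ?k) x)) (snd ?k p) (X p)"
    by (subst D_cong[OF S]) (use c k in auto)
  also have "\<dots> = \<D> (F \<circ> cinv c) ((snd c \<circ> cinv ?k) (snd ?k p)) (\<D> (snd c \<circ> cinv ?k) (snd ?k p) (X p))"
    by (rule D_compose) (use jac_differentiable[of ?k c p] c k F in \<open>simp_all add: o_def\<close>)
  finally show ?thesis using c k by (simp add: dir_deriv_def vf_rep_at tcoord_jac jac_def)
qed

text \<open>Differentiating the transformation law of the components of a field produces, besides the
  transformed derivative, a second derivative of the coordinate change. Its symmetry makes this
  term cancel in the bracket, so that the bracket may be computed in any chart.\<close>

lemma lie_bracket_chart: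
  assumes X: "smooth_vfield_on M W X" and Y: "smooth_vfield_on M W Y"
    and c: "c \<in> atlas M" "p \<in> fst c" and pW: "p \<in> W"
  shows "tcoord M c p (lie_bracket M X Y p) =
     \<D> (vf_rep M c Y) (snd c p) (vf_rep M c X (snd c p)) - \<D> (vf_rep M c X) (snd c p) (vf_rep M c Y (snd c p))"
proof -
  let ?k = "chart_at M p"
  have k: "?k \<in> atlas M" "p \<in> fst ?k" using chart_at_in chart_dom_points c by auto
  have W: "openin (mtop M) W" using X by (simp add: smooth_vfield_on_def)
  define T where "T = snd ?k \<circ> cinv c"
  let ?y = "snd c p"
  let ?S = "snd c ` (fst c \<inter> (fst ?k \<inter> W))"
  have S: "open ?S" by (intro chart_image_open c openin_Int chart_dom_open k W)
  have y: "?y \<in> ?S" using c k pW by auto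
  have Ty: "T ?y = snd ?k p" using c by (simp add: T_def)
  have T: "smooth_on ?S T"
    unfolding T_def by (rule smooth_on_subset[OF transition_smooth[OF c(1) k(1)]]) auto
  have Tdiff: "T differentiable (at y)" if "y \<in> ?S" for y
    by (rule smooth_on_imp_differentiable[OF T that])
  have Tlin: "linear (\<D> T y)" if "y \<in> ?S" for y by (rule D_linear[OF Tdiff[OF that]])
  have law: "vf_rep M ?k Z (T y) = \<D> T y (vf_rep M c Z y)" if yS: "y \<in> ?S" for y Z
  proof -
    obtain q where q: "y = snd c q" "q \<in> fst c" "q \<in> fst ?k" using yS by blast
    show ?thesis using q c k chart_at_in[of q] chart_dom_points[of c q]
      by (simp add: T_def vf_rep_at jac_def[symmetric] tcoord_jac jac_jac)
  qed
  have main: "\<D> (vf_rep M ?k Z) (T ?y) (\<D> T ?y a) =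
      \<D> (\<lambda>y. \<D> T y (vf_rep M c Z ?y)) ?y a + \<D> T ?y (\<D> (vf_rep M c Z) ?y a)"
    if Z: "smooth_vfield_on M W Z" for Z a
  proof -
    have zc: "vf_rep M c Z differentiable (at ?y)"
      by (rule smooth_on_imp_differentiable[OF smooth_vf_rep[OF Z c(1)]]) (use c pW in auto)
    have zk: "vf_rep M ?k Z differentiable (at (T ?y))"
      unfolding Ty by (rule smooth_on_imp_differentiable[OF smooth_vf_rep[OF Z k(1)]]) (use k pW in auto)
    have "\<D> (vf_rep M ?k Z) (T ?y) (\<D> T ?y a) = \<D> (\<lambda>y. vf_rep M ?k Z (T y)) ?y a"
      by (rule D_compose[symmetric, OF Tdiff[OF y] zk])
    also have "\<D> (\<lambda>y. vf_rep M ?k Z (T y)) ?y = \<D> (\<lambda>y. \<D> T y (vf_rep M c Z y)) ?y"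
      by (rule D_cong[OF S y law])
    also have "\<dots> a = \<D> (\<lambda>y. \<D> T y (vf_rep M c Z ?y)) ?y a + \<D> T ?y (\<D> (vf_rep M c Z) ?y a)"
      by (rule D_apply[OF S Tlin smooth_on_D[OF T] zc y])
    finally show ?thesis .
  qed
  have "lie_bracket M X Y p = \<D> (vf_rep M ?k Y) (T ?y) (vf_rep M ?k X (T ?y))
      - \<D> (vf_rep M ?k X) (T ?y) (vf_rep M ?k Y (T ?y))"
    by (simp add: lie_bracket_def Let_def Ty)
  also have "\<dots> = \<D> T ?y (\<D> (vf_rep M c Y) ?y (vf_rep M c X ?y) - \<D> (vf_rep M c X) ?y (vf_rep M c Y ?y))"
    using D_D_sym[OF S T y, of "vf_rep M c X ?y" "vf_rep M c Y ?y"]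
    by (simp add: law[OF y] main[OF X] main[OF Y] linear_diff[OF Tlin[OF y]])
  also have "\<D> T ?y = (\<lambda>v. coord_field M c v p)"
    by (simp add: T_def coord_field_jac jac_def)
  finally show ?thesis using c by simp
qed

text \<open>In the coordinate expressions of \<open>d\<alpha>\<close>, \<open>d\<omega>\<close>, \<open>N\<^sub>A\<close> and
  \<open>\<L>\<^sub>U A\<close> the derivatives of the argument fields cancel against those in the
  brackets. What is left depends on the fields only through their values at the point, so these
  lemmas contain the tensoriality of the four expressions.\<close>

lemma form_dir_deriv:
  assumes \<alpha>: "smooth_form1 M \<alpha>" and Y: "smooth_vfield_on M W Y"
    and c: "c \<in> atlas M" "p \<in> fst c" and pW: "p \<in> W"
  shows "dir_deriv M X (\<lambda>q. \<alpha> q (Y q)) p =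
     \<D> (\<lambda>y. form_rep M c \<alpha> y (vf_rep M c Y (snd c p))) (snd c p) (vf_rep M c X (snd c p)) +
     form_rep M c \<alpha> (snd c p) (\<D> (vf_rep M c Y) (snd c p) (vf_rep M c X (snd c p)))"
proof -
  let ?y = "snd c p"
  let ?S = "snd c ` (fst c \<inter> W)"
  have S: "open ?S" by (rule chart_image_open[OF c(1)]) (use Y in \<open>simp add: smooth_vfield_on_def\<close>)
  have y: "?y \<in> ?S" using c pW by auto
  have lin: "linear (form_rep M c \<alpha> z)" if "z \<in> ?S" for z
    using linear_form_rep[OF _ c(1), of \<alpha> z] \<alpha> that by (auto simp: smooth_form1_rep)
  have sm: "smooth_on ?S (\<lambda>z. form_rep M c \<alpha> z v)" for v
    by (rule smooth_on_subset[of "snd c ` fst c"]) (use \<alpha> c in \<open>auto simp: smooth_form1_rep\<close>)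
  have dY: "vf_rep M c Y differentiable (at ?y)"
    by (rule smooth_on_imp_differentiable[OF smooth_vf_rep[OF Y c(1)] y])
  have eq: "((\<lambda>q. \<alpha> q (Y q)) \<circ> cinv c) z = form_rep M c \<alpha> z (vf_rep M c Y z)" if "z \<in> ?S" for z
    using form_rep_vf[OF c(1), of z \<alpha> Y] that by auto
  have hd: "((\<lambda>z. form_rep M c \<alpha> z (vf_rep M c Y z)) has_derivative
     (\<lambda>a. \<D> (\<lambda>z. form_rep M c \<alpha> z (vf_rep M c Y ?y)) ?y a + form_rep M c \<alpha> ?y (\<D> (vf_rep M c Y) ?y a))) (at ?y)"
    by (rule has_derivative_apply[OF S lin sm dY y refl])
  then have hd': "((\<lambda>q. \<alpha> q (Y q)) \<circ> cinv c has_derivative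
     (\<lambda>a. \<D> (\<lambda>z. form_rep M c \<alpha> z (vf_rep M c Y ?y)) ?y a + form_rep M c \<alpha> ?y (\<D> (vf_rep M c Y) ?y a))) (at ?y)"
    using has_derivative_cong_open[OF S y, of "(\<lambda>q. \<alpha> q (Y q)) \<circ> cinv c" "\<lambda>z. form_rep M c \<alpha> z (vf_rep M c Y z)"] eq
    by simp
  then show ?thesis
    using dir_deriv_chart[OF c differentiableI[OF hd'], of X] D_eqI[OF hd'] by simp
qed

lemma d1_chart:
  assumes \<alpha>: "smooth_form1 M \<alpha>" and X: "smooth_vfield_on M W X" and Y: "smooth_vfield_on M W Y"
    and c: "c \<in> atlas M" "p \<in> fst c" and pW: "p \<in> W"
  shows "d1 M \<alpha> X Y p = d1_flat (form_rep M c \<alpha>) (snd c p) (vf_rep M c X (snd c p)) (vf_rep M c Y (snd c p))"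
proof -
  have "\<alpha> p (lie_bracket M X Y p) = form_rep M c \<alpha> (snd c p) (tcoord M c p (lie_bracket M X Y p))"
    using c by (simp add: form_rep_at)
  moreover have "linear (form_rep M c \<alpha> (snd c p))"
    using linear_form_rep[OF _ c(1), of \<alpha>] \<alpha> c by (auto simp: smooth_form1_rep)
  ultimately show ?thesis
    unfolding d1_def form_dir_deriv[OF \<alpha> Y c pW] form_dir_deriv[OF \<alpha> X c pW]
    by (simp add: lie_bracket_chart[OF X Y c pW] linear_diff d1_flat_def)
qed

lemma bilin_dir_deriv:
  assumes b: "smooth_bilin M b" and Y: "smooth_vfield_on M W Y" and Z: "smooth_vfield_on M W Z"
    and c: "c \<in> atlas M" "p \<in> fst c" and pW: "p \<in> W"
  shows "dir_deriv M X (\<lambda>q. b q (Y q) (Z q)) p =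
     \<D> (\<lambda>y. bilin_rep M c b y (vf_rep M c Y (snd c p)) (vf_rep M c Z (snd c p))) (snd c p) (vf_rep M c X (snd c p)) +
     bilin_rep M c b (snd c p) (vf_rep M c Y (snd c p)) (\<D> (vf_rep M c Z) (snd c p) (vf_rep M c X (snd c p))) +
     bilin_rep M c b (snd c p) (\<D> (vf_rep M c Y) (snd c p) (vf_rep M c X (snd c p))) (vf_rep M c Z (snd c p))"
proof -
  let ?y = "snd c p" let ?b = "bilin_rep M c b" let ?Y = "vf_rep M c Y" let ?Z = "vf_rep M c Z"
  let ?S = "snd c ` (fst c \<inter> W)"
  have S: "open ?S" by (rule chart_image_open[OF c(1)]) (use Y in \<open>simp add: smooth_vfield_on_def\<close>)
  have y: "?y \<in> ?S" using c pW by auto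
  have lin: "linear (?b z v)" "linear (\<lambda>v. ?b z v w)" if "z \<in> ?S" for z v w
    using linear_bilin_rep[OF _ c(1), of b z] b that by (auto simp: smooth_bilin_rep)
  have sm: "smooth_on ?S (\<lambda>z. ?b z v w)" for v w
    by (rule smooth_on_subset[of "snd c ` fst c"]) (use b c in \<open>auto simp: smooth_bilin_rep\<close>)
  have dY: "?Y differentiable (at ?y)" and dZ: "?Z differentiable (at ?y)"
    by (rule smooth_on_imp_differentiable[OF smooth_vf_rep[OF _ c(1)] y], fact)+
  have eq: "((\<lambda>q. b q (Y q) (Z q)) \<circ> cinv c) z = ?b z (?Y z) (?Z z)" if "z \<in> ?S" for z
    using bilin_rep_vf[OF c(1), of z b Y Z] that by auto
  have sm2: "smooth_on ?S (\<lambda>z. ?b z v (?Z z))" for v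
    by (rule smooth_on_apply[OF S, where A="\<lambda>z. ?b z v" and w="?Z"]) (use lin sm smooth_vf_rep[OF Z c(1)] in auto)
  have "((\<lambda>z. ?b z (?Y z) (?Z z)) has_derivative
     (\<lambda>a. \<D> (\<lambda>z. ?b z (?Y ?y) (?Z z)) ?y a + ?b ?y (\<D> ?Y ?y a) (?Z ?y))) (at ?y)"
    using has_derivative_apply[OF S, of "\<lambda>z v. ?b z v (?Z z)" ?Y ?y "?Y ?y"] lin(2) sm2 dY y by simp
  then have hd': "((\<lambda>q. b q (Y q) (Z q)) \<circ> cinv c has_derivative
     (\<lambda>a. \<D> (\<lambda>z. ?b z (?Y ?y) (?Z z)) ?y a + ?b ?y (\<D> ?Y ?y a) (?Z ?y))) (at ?y)"
    using has_derivative_cong_open[OF S y, of "(\<lambda>q. b q (Y q) (Z q)) \<circ> cinv c" "\<lambda>z. ?b z (?Y z) (?Z z)"] eq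
    by simp
  show ?thesis
    using dir_deriv_chart[OF c differentiableI[OF hd'], of X] D_eqI[OF hd']
      D_apply[OF S, of "\<lambda>z. ?b z (?Y ?y)" ?Z ?y] lin(1) sm dZ y by simp
qed

lemma d2_chart:
  assumes b: "smooth_bilin M b" and alt: "\<And>p v w. p \<in> points M \<Longrightarrow> b p v w = - b p w v"
    and X: "smooth_vfield_on M W X" and Y: "smooth_vfield_on M W Y" and Z: "smooth_vfield_on M W Z"
    and c: "c \<in> atlas M" "p \<in> fst c" and pW: "p \<in> W"
  shows "d2 M b X Y Z p = d2_flat (bilin_rep M c b) (snd c p)
     (vf_rep M c X (snd c p)) (vf_rep M c Y (snd c p)) (vf_rep M c Z (snd c p))"
proof -
  let ?y = "snd c p" let ?b = "bilin_rep M c b"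
  have lin: "linear (?b ?y v)" "linear (\<lambda>v. ?b ?y v w)" for v w
    using linear_bilin_rep[OF _ c(1), of b ?y] b c by (auto simp: smooth_bilin_rep)
  have alt': "?b ?y v w = - ?b ?y w v" for v w
    unfolding bilin_rep_at[OF c] by (rule alt[OF chart_dom_points[OF c]])
  have br: "b p (lie_bracket M A B p) (C p) = ?b ?y (\<D> (vf_rep M c B) ?y (vf_rep M c A ?y)) (vf_rep M c C ?y)
      - ?b ?y (\<D> (vf_rep M c A) ?y (vf_rep M c B ?y)) (vf_rep M c C ?y)"
    if "smooth_vfield_on M W A" "smooth_vfield_on M W B" for A B C
  proof -
    have "b p (lie_bracket M A B p) (C p) = ?b ?y (tcoord M c p (lie_bracket M A B p)) (vf_rep M c C ?y)"
      using c by (simp add: bilin_rep_at vf_rep_at)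
    then show ?thesis by (simp add: lie_bracket_chart[OF that c pW] linear_diff[OF lin(2)])
  qed
  show ?thesis
    unfolding d2_def bilin_dir_deriv[OF b Y Z c pW] bilin_dir_deriv[OF b X Z c pW]
      bilin_dir_deriv[OF b X Y c pW] br[OF X Y] br[OF X Z] br[OF Y Z] d2_flat_def
    using alt'[of "vf_rep M c X ?y"] alt'[of "vf_rep M c Y ?y"] by (simp add: algebra_simps)
qed

lemma D_endo_vf:
  assumes A: "smooth_endo M A" and X: "smooth_vfield_on M W X"
    and c: "c \<in> atlas M" "p \<in> fst c" and pW: "p \<in> W"
  shows "\<D> (vf_rep M c (\<lambda>q. A q (X q))) (snd c p) a =
     \<D> (\<lambda>y. endo_rep M c A y (vf_rep M c X (snd c p))) (snd c p) a +
     endo_rep M c A (snd c p) (\<D> (vf_rep M c X) (snd c p) a)"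
proof -
  let ?S = "snd c ` (fst c \<inter> W)"
  have S: "open ?S" by (rule chart_image_open[OF c(1)]) (use X in \<open>simp add: smooth_vfield_on_def\<close>)
  have y: "snd c p \<in> ?S" using c pW by auto
  have lin: "linear (endo_rep M c A z)" if "z \<in> ?S" for z
    using linear_endo_rep[OF _ c(1), of A z] A that by (auto simp: smooth_endo_rep)
  have sm: "smooth_on ?S (\<lambda>z. endo_rep M c A z v)" for v
    by (rule smooth_on_subset[of "snd c ` fst c"]) (use A c in \<open>auto simp: smooth_endo_rep\<close>)
  have "\<D> (vf_rep M c (\<lambda>q. A q (X q))) (snd c p) = \<D> (\<lambda>z. endo_rep M c A z (vf_rep M c X z)) (snd c p)"
    by (rule D_cong[OF S y]) (use vf_rep_endo[OF c(1), of _ A X] in auto)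
  then show ?thesis
    using D_apply[OF S, of "endo_rep M c A" "vf_rep M c X" "snd c p" a] lin sm y
      smooth_on_imp_differentiable[OF smooth_vf_rep[OF X c(1)] y] by simp
qed

lemma nijenhuis_chart:
  assumes A: "smooth_endo M A" and X: "smooth_vfield_on M W X" and Y: "smooth_vfield_on M W Y"
    and c: "c \<in> atlas M" "p \<in> fst c" and pW: "p \<in> W"
  shows "tcoord M c p (nijenhuis M A X Y p) =
     nijenhuis_flat (endo_rep M c A) (snd c p) (vf_rep M c X (snd c p)) (vf_rep M c Y (snd c p))"
proof -
  let ?y = "snd c p" let ?A = "endo_rep M c A ?y"
  note AX = smooth_vfield_endo[OF A X] and AY = smooth_vfield_endo[OF A Y]
  have yS: "?y \<in> snd c ` fst c" using c by auto
  have lA: "linear ?A" using linear_endo_rep[OF _ c(1) yS, of A] A by (auto simp: smooth_endo_rep)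
  have pA: "tcoord M c p (A p v) = ?A (tcoord M c p v)" for v using c by (simp add: endo_rep_at)
  have lin: "linear (tcoord M c p)" by (rule linear_tcoord[OF c])
  show ?thesis
    unfolding nijenhuis_def Let_def
    by (simp add: linear_add[OF lin] linear_diff[OF lin] pA lie_bracket_chart[OF X Y c pW]
        lie_bracket_chart[OF AX Y c pW] lie_bracket_chart[OF X AY c pW] lie_bracket_chart[OF AX AY c pW]
        D_endo_vf[OF A X c pW] D_endo_vf[OF A Y c pW] vf_rep_endo[OF c(1) yS]
        linear_add[OF lA] linear_diff[OF lA] nijenhuis_flat_def)
qed

lemma lie_deriv_endo_chart:
  assumes A: "smooth_endo M A" and U: "smooth_vfield_on M W U" and X: "smooth_vfield_on M W X"
    and c: "c \<in> atlas M" "p \<in> fst c" and pW: "p \<in> W"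
  shows "tcoord M c p (lie_bracket M U (\<lambda>q. A q (X q)) p - A p (lie_bracket M U X p)) =
     \<D> (\<lambda>y. endo_rep M c A y (vf_rep M c X (snd c p))) (snd c p) (vf_rep M c U (snd c p))
     - \<D> (vf_rep M c U) (snd c p) (endo_rep M c A (snd c p) (vf_rep M c X (snd c p)))
     + endo_rep M c A (snd c p) (\<D> (vf_rep M c U) (snd c p) (vf_rep M c X (snd c p)))"
proof -
  let ?y = "snd c p" let ?A = "endo_rep M c A ?y"
  have yS: "?y \<in> snd c ` fst c" using c by auto
  have lA: "linear ?A" using linear_endo_rep[OF _ c(1) yS, of A] A by (auto simp: smooth_endo_rep)
  have pA: "tcoord M c p (A p v) = ?A (tcoord M c p v)" for v using c by (simp add: endo_rep_at)
  have lin: "linear (tcoord M c p)" by (rule linear_tcoord[OF c])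
  show ?thesis
    by (simp add: linear_diff[OF lin] pA lie_bracket_chart[OF U X c pW]
        lie_bracket_chart[OF U smooth_vfield_endo[OF A X] c pW] D_endo_vf[OF A X c pW]
        vf_rep_endo[OF c(1) yS] linear_diff[OF lA])
qed

end

section \<open>The structure on the product, in coordinates\<close>

text \<open>The normality of the structure on the product, at one point. The symbols \<open>DJ a\<close>,
  \<open>D\<theta> a\<close> and \<open>DU a\<close> stand for the derivatives of the components of \<open>J\<close>,
  \<open>\<theta>\<close> and \<open>U\<close> in the direction \<open>a\<close>. The hypotheses on them are the derivatives of
  \<open>J\<^sup>2 = -1\<close>, \<open>\<theta>(U) = 1\<close> and \<open>\<theta>(V) = 0\<close>, followed by
  \<open>\<L>\<^sub>U J = 0\<close>, \<open>N\<^sub>J = 0\<close> and \<open>d\<theta> = 0\<close>. The vectors \<open>\<phi>v\<close> and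
  \<open>\<phi>w\<close> are the \<open>M\<close>-parts of \<open>\<phi>(v, s)\<close> and \<open>\<phi>(w, r)\<close>, whose
  \<open>\<partial>/\<partial>t\<close>-parts are \<open>\<theta> v\<close> and \<open>\<theta> w\<close>. The two conclusions are the
  \<open>\<partial>/\<partial>t\<close>-part and the \<open>M\<close>-part of \<open>N\<^sub>\<phi> + d\<eta> \<otimes> \<xi> = 0\<close>; the
  vector \<open>b\<close> is the argument of the outer \<open>\<phi>\<close> in \<open>N\<^sub>\<phi>\<close>.\<close>

lemma nijenhuis_algebra:
  fixes J DU :: "'e::real_vector \<Rightarrow> 'e" and DJ :: "'e \<Rightarrow> 'e \<Rightarrow> 'e" and \<theta> :: "'e \<Rightarrow> real"
    and D\<theta> :: "'e \<Rightarrow> 'e \<Rightarrow> real" and U v w :: 'e and r s :: real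
  assumes lin: "linear J" "\<And>v. linear (\<lambda>a. DJ a v)" "linear \<theta>" "\<And>v. linear (\<lambda>a. D\<theta> a v)" "linear DU"
    and JJ: "\<And>v. J (J v) = - v"
    and DJJ: "\<And>a v. DJ a (J v) = - J (DJ a v)"
    and D\<theta>U: "\<And>a. D\<theta> a U = - \<theta> (DU a)"
    and D\<theta>V: "\<And>a. D\<theta> a (J U) = - \<theta> (DJ a U + J (DU a))"
    and \<theta>U: "\<theta> U = 1" and \<theta>V: "\<theta> (J U) = 0"
    and LUJ: "\<And>v. DJ U v = DU (J v) - J (DU v)"
    and NJ: "\<And>v w. DJ (J v) w - DJ (J w) v + J (DJ w v - DJ v w) = 0"
    and closed: "\<And>a v. D\<theta> a v = D\<theta> v a"
  defines "V \<equiv> J U" and "\<eta> \<equiv> \<lambda>v. - \<theta> (J v)" and "DV \<equiv> \<lambda>a. DJ a U + J (DU a)"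
    and "D\<eta> \<equiv> \<lambda>a v. - D\<theta> a (J v) - \<theta> (DJ a v)"
  defines "\<phi>v \<equiv> J v - \<theta> v *\<^sub>R V + (\<eta> v - s) *\<^sub>R U" and "\<phi>w \<equiv> J w - \<theta> w *\<^sub>R V + (\<eta> w - r) *\<^sub>R U"
    and "D\<phi>v \<equiv> \<lambda>a. DJ a v - D\<theta> a v *\<^sub>R V - \<theta> v *\<^sub>R DV a + D\<eta> a v *\<^sub>R U + (\<eta> v - s) *\<^sub>R DU a"
    and "D\<phi>w \<equiv> \<lambda>a. DJ a w - D\<theta> a w *\<^sub>R V - \<theta> w *\<^sub>R DV a + D\<eta> a w *\<^sub>R U + (\<eta> w - r) *\<^sub>R DU a"
  defines "b \<equiv> D\<phi>v w - D\<phi>w v"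
  shows "D\<theta> \<phi>v w - D\<theta> \<phi>w v + \<theta> b = 0"
    and "D\<phi>w \<phi>v - D\<phi>v \<phi>w + (J b - \<theta> b *\<^sub>R V + \<eta> b *\<^sub>R U) + (D\<eta> v w - D\<eta> w v) *\<^sub>R V = 0"
proof -
  note lJ = linear_simps[OF lin(1)]
  note l\<theta> = linear_simps[OF lin(3)]
  note lDU = linear_simps[OF lin(5)]
  note lDJ = linear_simps[OF lin(2)]
  note lD\<theta> = linear_simps[OF lin(4)]
  have JV: "J V = - U" by (simp add: V_def JJ)
  have \<eta>: "\<eta> U = 0" "\<eta> V = 1" using \<theta>U \<theta>V by (simp_all add: \<eta>_def JJ l\<theta> V_def)
  have l\<eta>: "\<eta> (a + c) = \<eta> a + \<eta> c" "\<eta> (a - c) = \<eta> a - \<eta> c" "\<eta> (x *\<^sub>R a) = x * \<eta> a" for a c x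
    by (simp_all add: \<eta>_def lJ l\<theta>)
  have linV: "linear DV"
    unfolding DV_def using lin by (auto intro!: linearI simp: lJ lDU lDJ algebra_simps)
  note lDV = linear_simps[OF linV]
  have lD\<eta>: "D\<eta> (a + c) x = D\<eta> a x + D\<eta> c x" "D\<eta> (a - c) x = D\<eta> a x - D\<eta> c x"
    "D\<eta> (k *\<^sub>R a) x = k * D\<eta> a x" for a c x k
    by (simp_all add: D\<eta>_def lD\<theta> l\<theta> lDJ algebra_simps)
  \<comment> \<open>The integrability of \<open>J\<close> turns \<open>\<L>\<^sub>U J = 0\<close> into \<open>\<L>\<^sub>V J = 0\<close>.\<close>
  have LVJ: "DJ V x = DV (J x) - J (DV x)" for x
    using NJ[of U x] by (simp add: V_def DV_def lJ JJ LUJ algebra_simps)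
  have UV: "DV U = DU V" by (simp add: DV_def V_def LUJ)
  have D\<eta>U: "D\<eta> U x = - \<eta> (DU x)" for x
    using closed[of U "J x"] by (simp add: D\<eta>_def \<eta>_def LUJ l\<theta> D\<theta>U)
  have D\<theta>V': "D\<theta> a V = - \<theta> (DV a)" for a using D\<theta>V by (simp add: V_def DV_def)
  have D\<eta>V: "D\<eta> V x = - \<eta> (DV x)" for x
    using closed[of V "J x"] by (simp add: D\<eta>_def \<eta>_def LVJ l\<theta> D\<theta>V')
  have NJ\<eta>: "D\<eta> (J x) z - D\<eta> (J z) x + \<eta> (DJ z x - DJ x z) = 0" for x z
    using arg_cong[OF NJ[of x z], of \<theta>] closed[of "J x" "J z"] linear_0[OF lin(3)]
    by (simp add: D\<eta>_def \<eta>_def l\<theta> lJ)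
  define \<beta> \<gamma> where "\<beta> = \<eta> v - s" and "\<gamma> = \<eta> w - r"
  have b: "b = DJ w v - DJ v w - \<theta> v *\<^sub>R DV w + \<theta> w *\<^sub>R DV v + (D\<eta> w v - D\<eta> v w) *\<^sub>R U
      + \<beta> *\<^sub>R DU w - \<gamma> *\<^sub>R DU v"
    using closed[of v w] by (simp add: b_def D\<phi>v_def D\<phi>w_def \<beta>_def \<gamma>_def algebra_simps)
  have D\<theta>\<phi>: "D\<theta> \<phi>v w = D\<theta> w (J v) + \<theta> v * \<theta> (DV w) - \<beta> * \<theta> (DU w)"
    "D\<theta> \<phi>w v = D\<theta> v (J w) + \<theta> w * \<theta> (DV v) - \<gamma> * \<theta> (DU v)"
    using closed[of "J v" w] closed[of V w] closed[of U w] closed[of "J w" v] closed[of V v] closed[of U v]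
    by (simp_all add: \<phi>v_def \<phi>w_def lD\<theta> D\<theta>U D\<theta>V' \<beta>_def \<gamma>_def)
  show 2: "D\<theta> \<phi>v w - D\<theta> \<phi>w v + \<theta> b = 0"
    unfolding D\<theta>\<phi> b by (simp add: l\<theta> \<theta>U D\<eta>_def)
  have D\<eta>\<phi>: "D\<eta> \<phi>v w = D\<eta> (J v) w + \<theta> v * \<eta> (DV w) - \<beta> * \<eta> (DU w)"
    "D\<eta> \<phi>w v = D\<eta> (J w) v + \<theta> w * \<eta> (DV v) - \<gamma> * \<eta> (DU v)"
    by (simp_all add: \<phi>v_def \<phi>w_def lD\<eta> D\<eta>U D\<eta>V \<beta>_def \<gamma>_def)
  have U0: "D\<eta> \<phi>v w - D\<eta> \<phi>w v + \<eta> b = 0"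
    using NJ\<eta>[of v w] unfolding D\<eta>\<phi> b by (simp add: l\<eta> \<eta>)
  have DJ\<phi>: "DJ \<phi>v w = DJ (J v) w - \<theta> v *\<^sub>R (DV (J w) - J (DV w)) + \<beta> *\<^sub>R (DU (J w) - J (DU w))"
    "DJ \<phi>w v = DJ (J w) v - \<theta> w *\<^sub>R (DV (J v) - J (DV v)) + \<gamma> *\<^sub>R (DU (J v) - J (DU v))"
    by (simp_all add: \<phi>v_def \<phi>w_def lDJ LUJ LVJ \<beta>_def \<gamma>_def)
  have DV\<phi>: "DV \<phi>v = DV (J v) - \<theta> v *\<^sub>R DV V + \<beta> *\<^sub>R DU V" "DV \<phi>w = DV (J w) - \<theta> w *\<^sub>R DV V + \<gamma> *\<^sub>R DU V"
    by (simp_all add: \<phi>v_def \<phi>w_def lDV UV \<beta>_def \<gamma>_def)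
  have DU\<phi>: "DU \<phi>v = DU (J v) - \<theta> v *\<^sub>R DU V + \<beta> *\<^sub>R DU U" "DU \<phi>w = DU (J w) - \<theta> w *\<^sub>R DU V + \<gamma> *\<^sub>R DU U"
    by (simp_all add: \<phi>v_def \<phi>w_def lDU \<beta>_def \<gamma>_def)
  have Jb: "J b = J (DJ w v - DJ v w) - \<theta> v *\<^sub>R J (DV w) + \<theta> w *\<^sub>R J (DV v) + (D\<eta> w v - D\<eta> v w) *\<^sub>R V
      + \<beta> *\<^sub>R J (DU w) - \<gamma> *\<^sub>R J (DU v)"
    by (simp add: b lJ V_def)
  have "D\<phi>w \<phi>v - D\<phi>v \<phi>w + (J b - \<theta> b *\<^sub>R V + \<eta> b *\<^sub>R U) + (D\<eta> v w - D\<eta> w v) *\<^sub>R V =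
      (DJ \<phi>w v - DJ \<phi>w v) + (DJ \<phi>v w - DJ \<phi>w v) - \<theta> w *\<^sub>R DV \<phi>v + \<theta> v *\<^sub>R DV \<phi>w + \<gamma> *\<^sub>R DU \<phi>v - \<beta> *\<^sub>R DU \<phi>w
      + J b + (D\<eta> v w - D\<eta> w v) *\<^sub>R V
      - (D\<theta> \<phi>v w - D\<theta> \<phi>w v + \<theta> b) *\<^sub>R V + (D\<eta> \<phi>v w - D\<eta> \<phi>w v + \<eta> b) *\<^sub>R U"
    by (simp add: D\<phi>v_def D\<phi>w_def \<beta>_def \<gamma>_def algebra_simps)
  also have "\<dots> = (DJ \<phi>v w - DJ \<phi>w v) - \<theta> w *\<^sub>R DV \<phi>v + \<theta> v *\<^sub>R DV \<phi>w + \<gamma> *\<^sub>R DU \<phi>v - \<beta> *\<^sub>R DU \<phi>w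
      + J b + (D\<eta> v w - D\<eta> w v) *\<^sub>R V"
    unfolding 2 U0 by simp
  also have "\<dots> = DJ (J v) w - DJ (J w) v + J (DJ w v - DJ v w)"
    unfolding DJ\<phi> DV\<phi> DU\<phi> Jb by (simp add: algebra_simps)
  finally show "D\<phi>w \<phi>v - D\<phi>v \<phi>w + (J b - \<theta> b *\<^sub>R V + \<eta> b *\<^sub>R U) + (D\<eta> v w - D\<eta> w v) *\<^sub>R V = 0"
    using NJ by simp
qed

text \<open>The differential part of a quasi-Sasakian structure, in terms of its components in one chart. It
  refers to nothing but the component functions, hence passes unchanged to any other manifold that
  has a chart with the same components.\<close>

definition quasi_Sasakian_flat :: "'e::euclidean_space set \<Rightarrow> ('e \<Rightarrow> 'e \<Rightarrow> 'e) \<Rightarrow> ('e \<Rightarrow> 'e) \<Rightarrow> ('e \<Rightarrow> 'e \<Rightarrow> real) \<Rightarrow>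
    ('e \<Rightarrow> 'e \<Rightarrow> 'e \<Rightarrow> real) \<Rightarrow> bool" where
  "quasi_Sasakian_flat S \<phi> \<xi> \<eta> h \<longleftrightarrow>
     (\<forall>v. smooth_on S (\<lambda>y. \<phi> y v)) \<and> smooth_on S \<xi> \<and> (\<forall>v. smooth_on S (\<lambda>y. \<eta> y v)) \<and>
     (\<forall>v w. smooth_on S (\<lambda>y. h y v w)) \<and>
     (\<forall>y\<in>S. \<forall>v w. nijenhuis_flat \<phi> y v w + d1_flat \<eta> y v w *\<^sub>R \<xi> y = 0) \<and>
     (\<forall>y\<in>S. \<forall>u v w. d2_flat (\<lambda>y v w. h y v (\<phi> y w)) y u v w = 0)"

lemma quasi_Sasakian_flat_transform:
  assumes "quasi_Sasakian_flat S \<phi> \<xi> \<eta> h" "T \<subseteq> S" "open T"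
    and eq: "\<And>y v. y \<in> T \<Longrightarrow> \<phi>' y v = \<phi> y v" "\<And>y. y \<in> T \<Longrightarrow> \<xi>' y = \<xi> y"
      "\<And>y v. y \<in> T \<Longrightarrow> \<eta>' y v = \<eta> y v" "\<And>y v w. y \<in> T \<Longrightarrow> h' y v w = h y v w"
  shows "quasi_Sasakian_flat T \<phi>' \<xi>' \<eta>' h'"
proof -
  have D: "\<D> (\<lambda>y. \<phi>' y v) y = \<D> (\<lambda>y. \<phi> y v) y" "\<D> (\<lambda>y. \<eta>' y v) y = \<D> (\<lambda>y. \<eta> y v) y"
    "\<D> (\<lambda>y. h' y v (\<phi>' y w)) y = \<D> (\<lambda>y. h y v (\<phi> y w)) y"
    if "y \<in> T" for y v w
    by (rule D_cong[OF assms(3) that]; simp add: eq)+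
  have sm: "smooth_on T F'" if "smooth_on S F" "\<And>y. y \<in> T \<Longrightarrow> F' y = F y"
    for F F' :: "'a \<Rightarrow> 'x::real_normed_vector"
    by (rule smooth_on_transform[OF smooth_on_subset[OF that(1) assms(2)] assms(3) that(2)])
  have sms: "smooth_on T (\<lambda>y. \<phi>' y v)" "smooth_on T \<xi>'" "smooth_on T (\<lambda>y. \<eta>' y v)" "smooth_on T (\<lambda>y. h' y v w)" for v w
    using assms(1) by (auto simp: quasi_Sasakian_flat_def eq intro: sm[of "\<lambda>y. \<phi> y v"] sm[of \<xi>] sm[of "\<lambda>y. \<eta> y v"] sm[of "\<lambda>y. h y v w"])
  show ?thesis
    using assms(1) assms(2) sms
    unfolding quasi_Sasakian_flat_def nijenhuis_flat_def d1_flat_def d2_flat_def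
    by (auto simp: D eq subset_iff)
qed

lemma has_derivative_comp_fst:
  assumes "G differentiable (at y)"
  shows "((\<lambda>z. G (fst z)) has_derivative (\<lambda>a. \<D> G y (fst a))) (at (y, t))"
  using diff_chain_at[OF bounded_linear_imp_has_derivative[OF bounded_linear_fst], of G "\<D> G y" "(y, t)"] D_works[OF assms]
  by (simp add: o_def)

locale flat_quasi_Vaisman =
  fixes S :: "'e::euclidean_space set" and J :: "'e \<Rightarrow> 'e \<Rightarrow> 'e" and g :: "'e \<Rightarrow> 'e \<Rightarrow> 'e \<Rightarrow> real"
    and \<theta> :: "'e \<Rightarrow> 'e \<Rightarrow> real" and U :: "'e \<Rightarrow> 'e"
  assumes S: "open S"
    and linJ: "y \<in> S \<Longrightarrow> linear (J y)" and smJ: "smooth_on S (\<lambda>y. J y v)"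
    and lin\<theta>: "y \<in> S \<Longrightarrow> linear (\<theta> y)" and sm\<theta>: "smooth_on S (\<lambda>y. \<theta> y v)"
    and smU: "smooth_on S U"
    and ling: "y \<in> S \<Longrightarrow> linear (g y v)" and smg: "smooth_on S (\<lambda>y. g y v w)"
    and JJ: "y \<in> S \<Longrightarrow> J y (J y v) = - v"
    and \<theta>U: "y \<in> S \<Longrightarrow> \<theta> y (U y) = 1" and \<theta>V: "y \<in> S \<Longrightarrow> \<theta> y (J y (U y)) = 0"
    and gU: "y \<in> S \<Longrightarrow> g y v (U y) = \<theta> y v" and gV: "y \<in> S \<Longrightarrow> g y v (J y (U y)) = - \<theta> y (J y v)"
    and NJ: "y \<in> S \<Longrightarrow> nijenhuis_flat J y v w = 0"
    and closed: "y \<in> S \<Longrightarrow> d1_flat \<theta> y v w = 0"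
    and LUJ: "y \<in> S \<Longrightarrow> \<D> (\<lambda>y. J y v) y (U y) - \<D> U y (J y v) + J y (\<D> U y v) = 0"
    and d\<Omega>: "y \<in> S \<Longrightarrow> d2_flat (\<lambda>y v w. g y v (J y w)) y u v w =
       d1_flat (\<lambda>y v. - \<theta> y (J y v)) y u v * \<theta> y w + d1_flat (\<lambda>y v. - \<theta> y (J y v)) y v w * \<theta> y u +
       d1_flat (\<lambda>y v. - \<theta> y (J y v)) y w u * \<theta> y v"
begin

abbreviation "V y \<equiv> J y (U y)"
abbreviation "\<eta> y v \<equiv> - \<theta> y (J y v)"

definition "\<phi> = (\<lambda>(y, t::real) (v, s::real). (J y v - \<theta> y v *\<^sub>R V y + (\<eta> y v - s) *\<^sub>R U y, \<theta> y v))"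

lemma differentiable_data:
  assumes "y \<in> S"
  shows "(\<lambda>y. J y v) differentiable (at y)" "(\<lambda>y. \<theta> y v) differentiable (at y)" "U differentiable (at y)"
    "V differentiable (at y)" "(\<lambda>y. \<eta> y v) differentiable (at y)"
proof -
  have "smooth_on S V" by (rule smooth_on_apply[OF S linJ smJ smU])
  moreover have "smooth_on S (\<lambda>y. \<theta> y (J y v))" by (rule smooth_on_apply[OF S lin\<theta> sm\<theta> smJ])
  ultimately show "(\<lambda>y. J y v) differentiable (at y)" "(\<lambda>y. \<theta> y v) differentiable (at y)"
    "U differentiable (at y)" "V differentiable (at y)" "(\<lambda>y. \<eta> y v) differentiable (at y)"
    using smooth_on_imp_differentiable[OF _ assms] smJ sm\<theta> smU smooth_on_uminus[OF S] by metis+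
qed

lemma D_V: "y \<in> S \<Longrightarrow> \<D> V y a = \<D> (\<lambda>z. J z (U y)) y a + J y (\<D> U y a)"
  by (rule D_apply[OF S linJ smJ differentiable_data(3)])

lemma D_\<eta>: "y \<in> S \<Longrightarrow> \<D> (\<lambda>y. \<eta> y v) y a = - \<D> (\<lambda>z. \<theta> z (J y v)) y a - \<theta> y (\<D> (\<lambda>z. J z v) y a)"
  using D_eqI[OF has_derivative_minus[OF has_derivative_apply[OF S lin\<theta> sm\<theta>, of "\<lambda>z. J z v" y "J y v"]]]
    differentiable_data(1)[of y v] by simp

lemma point_identities:
  assumes y: "y \<in> S"
  shows "\<D> (\<lambda>z. J z (J y v)) y a = - J y (\<D> (\<lambda>z. J z v) y a)"
    "\<D> (\<lambda>z. \<theta> z (U y)) y a = - \<theta> y (\<D> U y a)"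
    "\<D> (\<lambda>z. \<theta> z (V y)) y a = - \<theta> y (\<D> (\<lambda>z. J z (U y)) y a + J y (\<D> U y a))"
    "\<D> (\<lambda>z. \<theta> z v) y a = \<D> (\<lambda>z. \<theta> z a) y v"
proof -
  have "\<D> (\<lambda>z. J z (J z v)) y = \<D> (\<lambda>z. - v) y" by (rule D_cong[OF S y JJ])
  then show "\<D> (\<lambda>z. J z (J y v)) y a = - J y (\<D> (\<lambda>z. J z v) y a)"
    using D_apply[OF S linJ smJ differentiable_data(1)[OF y, of v] y, of a] by (simp add: eq_neg_iff_add_eq_0)
  have "\<D> (\<lambda>z. \<theta> z (U z)) y = \<D> (\<lambda>z. 1) y" by (rule D_cong[OF S y \<theta>U])
  then show "\<D> (\<lambda>z. \<theta> z (U y)) y a = - \<theta> y (\<D> U y a)"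
    using D_apply[OF S lin\<theta> sm\<theta> differentiable_data(3)[OF y] y, of a] by (simp add: eq_neg_iff_add_eq_0)
  have "\<D> (\<lambda>z. \<theta> z (V z)) y = \<D> (\<lambda>z. 0) y" by (rule D_cong[OF S y \<theta>V])
  then show "\<D> (\<lambda>z. \<theta> z (V y)) y a = - \<theta> y (\<D> (\<lambda>z. J z (U y)) y a + J y (\<D> U y a))"
    using D_apply[OF S lin\<theta> sm\<theta> differentiable_data(4)[OF y] y, of a] by (simp add: eq_neg_iff_add_eq_0 D_V[OF y])
  show "\<D> (\<lambda>z. \<theta> z v) y a = \<D> (\<lambda>z. \<theta> z a) y v"
    using closed[OF y, of a v] by (simp add: d1_flat_def)
qed

lemma D_\<phi>:
  assumes y: "y \<in> S"
  shows "\<D> (\<lambda>z. \<phi> z (v, s)) (y, t) (a, r) =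
    (\<D> (\<lambda>z. J z v) y a - \<D> (\<lambda>z. \<theta> z v) y a *\<^sub>R V y - \<theta> y v *\<^sub>R \<D> V y a
       + \<D> (\<lambda>z. \<eta> z v) y a *\<^sub>R U y + (\<eta> y v - s) *\<^sub>R \<D> U y a, \<D> (\<lambda>z. \<theta> z v) y a)"
proof -
  note hd = differentiable_data[OF y, THEN has_derivative_comp_fst, where t=t]
  have "((\<lambda>z. (J (fst z) v - \<theta> (fst z) v *\<^sub>R V (fst z) + (\<eta> (fst z) v - s) *\<^sub>R U (fst z), \<theta> (fst z) v))
     has_derivative (\<lambda>a. (\<D> (\<lambda>z. J z v) y (fst a)
       - (\<theta> (fst (y, t)) v *\<^sub>R \<D> V y (fst a) + \<D> (\<lambda>z. \<theta> z v) y (fst a) *\<^sub>R V (fst (y, t)))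
       + ((\<eta> (fst (y, t)) v - s) *\<^sub>R \<D> U y (fst a) + (\<D> (\<lambda>z. \<eta> z v) y (fst a) - 0) *\<^sub>R U (fst (y, t))),
       \<D> (\<lambda>z. \<theta> z v) y (fst a)))) (at (y, t))"
    by (intro has_derivative_Pair has_derivative_add has_derivative_diff has_derivative_scaleR
        has_derivative_const hd)
  then have "((\<lambda>z. \<phi> z (v, s)) has_derivative (\<lambda>a. (\<D> (\<lambda>z. J z v) y (fst a)
       - (\<theta> (fst (y, t)) v *\<^sub>R \<D> V y (fst a) + \<D> (\<lambda>z. \<theta> z v) y (fst a) *\<^sub>R V (fst (y, t)))
       + ((\<eta> (fst (y, t)) v - s) *\<^sub>R \<D> U y (fst a) + (\<D> (\<lambda>z. \<eta> z v) y (fst a) - 0) *\<^sub>R U (fst (y, t))),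
       \<D> (\<lambda>z. \<theta> z v) y (fst a)))) (at (y, t))"
    by (simp add: \<phi>_def case_prod_beta)
  from D_eqI[OF this] show ?thesis by (simp add: algebra_simps)
qed

lemma nijenhuis_line:
  assumes y: "y \<in> S"
  shows "nijenhuis_flat \<phi> (y, t) v w + d1_flat (\<lambda>z a. \<eta> (fst z) (fst a)) (y, t) v w *\<^sub>R (V y, 0) = 0"
proof -
  obtain v' s w' r where vw: "v = (v', s)" "w = (w', r)" by (metis surj_pair)
  have d\<eta>: "d1_flat (\<lambda>z a. \<eta> (fst z) (fst a)) (y, t) v w = \<D> (\<lambda>z. \<eta> z w') y v' - \<D> (\<lambda>z. \<eta> z v') y w'"
    using D_eqI[OF has_derivative_comp_fst[OF differentiable_data(5)[OF y, of w']], of t]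
      D_eqI[OF has_derivative_comp_fst[OF differentiable_data(5)[OF y, of v']], of t] by (simp add: d1_flat_def vw)
  have N: "\<D> (\<lambda>z. J z w) y (J y v) - \<D> (\<lambda>z. J z v) y (J y w)
      + J y (\<D> (\<lambda>z. J z v) y w - \<D> (\<lambda>z. J z w) y v) = 0" for v w
    using NJ[OF y] by (simp add: nijenhuis_flat_def)
  have L: "\<D> (\<lambda>z. J z v) y (U y) = \<D> U y (J y v) - J y (\<D> U y v)" for v
    using LUJ[OF y, of v] by (simp add: algebra_simps)
  have lins: "linear (\<lambda>a. \<D> (\<lambda>z. J z v) y a)" "linear (\<lambda>a. \<D> (\<lambda>z. \<theta> z v) y a)" "linear (\<D> U y)" for v
    using differentiable_data[OF y] D_linear by blast+
  note alg = nijenhuis_algebra[of "J y" "\<lambda>a v. \<D> (\<lambda>z. J z v) y a" "\<theta> y" "\<lambda>a v. \<D> (\<lambda>z. \<theta> z v) y a" "\<D> U y" "U y",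
      OF linJ[OF y] lins(1) lin\<theta>[OF y] lins(2,3) JJ[OF y] point_identities(1-3)[OF y] \<theta>U[OF y] \<theta>V[OF y] L N
        point_identities(4)[OF y], where v=v' and w=w' and s=s and r=r]
  note alg' = alg[folded D_V[OF y] D_\<eta>[OF y]]
  have \<phi>: "\<phi> (y, t) (a, x) = (J y a - \<theta> y a *\<^sub>R V y + (\<eta> y a - x) *\<^sub>R U y, \<theta> y a)" for a x
    by (simp add: \<phi>_def)
  have sym: "\<D> (\<lambda>z. \<theta> z v') y w' - \<D> (\<lambda>z. \<theta> z w') y v' = 0"
    using point_identities(4)[OF y] by simp
  show ?thesis
    unfolding d\<eta>[unfolded vw] nijenhuis_flat_def vw \<phi> D_\<phi>[OF y] diff_Pair add_Pair sym scaleR_Pair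
    using alg' by (simp add: zero_prod_def)
qed

definition "h = (\<lambda>(y, t::real) (v, s::real) (w, r::real). g y v w + s * r)"

text \<open>Here \<open>\<Phi> = \<Omega> + \<theta> \<and> \<eta> + dt \<and> \<theta>\<close>, so that
  \<open>d\<Phi> = d\<Omega> - \<theta> \<and> d\<eta> = 0\<close> once \<open>d\<theta> = 0\<close>.\<close>

lemma closed_line:
  assumes y: "y \<in> S"
  shows "d2_flat (\<lambda>z v w. h z v (\<phi> z w)) (y, t) u v w = 0"
proof -
  have Phi: "h z v (\<phi> z w) = g (fst z) (fst v) (J (fst z) (fst w)) - \<theta> (fst z) (fst w) * \<eta> (fst z) (fst v)
      + (\<eta> (fst z) (fst w) - snd w) * \<theta> (fst z) (fst v) + snd v * \<theta> (fst z) (fst w)"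
    if "z \<in> S \<times> UNIV" for z v w
  proof -
    have "fst z \<in> S" using that by auto
    note l = ling[OF this] and gU[OF this] gV[OF this]
    then show ?thesis by (simp add: h_def \<phi>_def case_prod_beta linear_simps[OF l])
  qed
  have smg': "smooth_on S (\<lambda>y. g y v (J y w))" for v w
    by (rule smooth_on_apply[OF S, where A="\<lambda>y. g y v" and w="\<lambda>y. J y w"]) (use ling smg smJ in auto)
  have dg: "(\<lambda>y. g y v (J y w)) differentiable (at y)" for v w
    by (rule smooth_on_imp_differentiable[OF smg' y])
  note d = differentiable_data[OF y]
  note hd = d[THEN has_derivative_comp_fst, where t=t] dg[THEN has_derivative_comp_fst, where t=t]
  have DPhi: "\<D> (\<lambda>z. h z v (\<phi> z w)) (y, t) a =
      \<D> (\<lambda>y. g y (fst v) (J y (fst w))) y (fst a)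
      - \<D> (\<lambda>z. \<theta> z (fst w)) y (fst a) * \<eta> y (fst v) - \<theta> y (fst w) * \<D> (\<lambda>z. \<eta> z (fst v)) y (fst a)
      + \<D> (\<lambda>z. \<eta> z (fst w)) y (fst a) * \<theta> y (fst v) + (\<eta> y (fst w) - snd w) * \<D> (\<lambda>z. \<theta> z (fst v)) y (fst a)
      + snd v * \<D> (\<lambda>z. \<theta> z (fst w)) y (fst a)" for v w a
  proof -
    have "\<D> (\<lambda>z. h z v (\<phi> z w)) (y, t) = \<D> (\<lambda>z. g (fst z) (fst v) (J (fst z) (fst w)) - \<theta> (fst z) (fst w) * \<eta> (fst z) (fst v)
      + (\<eta> (fst z) (fst w) - snd w) * \<theta> (fst z) (fst v) + snd v * \<theta> (fst z) (fst w)) (y, t)"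
      by (rule D_cong[OF open_Times[OF S open_UNIV] _ Phi]) (use y in auto)
    also have "\<dots> = (\<lambda>a. \<D> (\<lambda>y. g y (fst v) (J y (fst w))) y (fst a)
      - (\<theta> (fst (y, t)) (fst w) * \<D> (\<lambda>z. \<eta> z (fst v)) y (fst a) + \<D> (\<lambda>z. \<theta> z (fst w)) y (fst a) * \<eta> (fst (y, t)) (fst v))
      + ((\<eta> (fst (y, t)) (fst w) - snd w) * \<D> (\<lambda>z. \<theta> z (fst v)) y (fst a) + (\<D> (\<lambda>z. \<eta> z (fst w)) y (fst a) - 0) * \<theta> (fst (y, t)) (fst v))
      + snd v * \<D> (\<lambda>z. \<theta> z (fst w)) y (fst a))"
      by (intro D_eqI has_derivative_add has_derivative_diff has_derivative_mult has_derivative_mult_right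
          has_derivative_const hd)
    finally show ?thesis by (simp add: algebra_simps)
  qed
  have sym: "\<D> (\<lambda>z. \<theta> z (fst v)) y (fst a) = \<D> (\<lambda>z. \<theta> z (fst a)) y (fst v)"
    for v a :: "'e \<times> real" by (rule point_identities(4)[OF y])
  show ?thesis
    using d\<Omega>[OF y, of "fst u" "fst v" "fst w"] sym[of u v] sym[of u w] sym[of v w]
    unfolding d2_flat_def DPhi d1_flat_def by (simp add: algebra_simps)
qed

lemma quasi_Sasakian_flat_line:
  "quasi_Sasakian_flat (S \<times> UNIV) \<phi> (\<lambda>z. (V (fst z), 0)) (\<lambda>z v. \<eta> (fst z) (fst v)) h"
  unfolding quasi_Sasakian_flat_def
proof (intro conjI allI ballI)
  have oS: "open (S \<times> (UNIV :: real set))" using S by (intro open_Times) auto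
  have pull: "smooth_on (S \<times> (UNIV :: real set)) (\<lambda>z. F (fst z))" if "smooth_on S F"
    for F :: "'e \<Rightarrow> 'x::real_normed_vector"
    by (rule smooth_on_compose[OF oS smooth_on_bounded_linear[OF bounded_linear_fst oS smooth_on_id[OF oS]] that]) auto
  have V: "smooth_on S V" by (rule smooth_on_apply[OF S linJ smJ smU])
  have \<eta>: "smooth_on S (\<lambda>y. \<eta> y v)" for v
    by (rule smooth_on_uminus[OF S smooth_on_apply[OF S lin\<theta> sm\<theta> smJ]])
  show "smooth_on (S \<times> (UNIV :: real set)) (\<lambda>z. \<phi> z v)" for v
    unfolding \<phi>_def case_prod_beta
    by (intro smooth_on_Pair smooth_on_add smooth_on_diff smooth_on_scaleR oS smooth_on_const
        pull[OF V] pull[OF \<eta>] pull[OF smU] pull[OF smJ] pull[OF sm\<theta>])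
  show "smooth_on (S \<times> (UNIV :: real set)) (\<lambda>z. (V (fst z), 0::real))"
    by (intro smooth_on_Pair oS smooth_on_const pull[OF V])
  show "smooth_on (S \<times> (UNIV :: real set)) (\<lambda>z. \<eta> (fst z) (fst v))" for v :: "'e \<times> real" by (rule pull[OF \<eta>])
  show "smooth_on (S \<times> (UNIV :: real set)) (\<lambda>z. h z v w)" for v w
    unfolding h_def case_prod_beta by (intro smooth_on_add oS smooth_on_const pull[OF smg])
  show "nijenhuis_flat \<phi> z v w + d1_flat (\<lambda>z a. \<eta> (fst z) (fst a)) z v w *\<^sub>R (V (fst z), 0) = 0"
    if "z \<in> S \<times> UNIV" for z v w
    using nijenhuis_line[of "fst z" "snd z" v w] that by auto
  show "d2_flat (\<lambda>z v w. h z v (\<phi> z w)) z u v w = 0" if "z \<in> S \<times> UNIV" for z u v w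
    using closed_line[of "fst z" "snd z" u v w] that by auto
qed

end

section \<open>Quasi-Sasakian structures from components\<close>

text \<open>An almost contact metric structure on a single tangent space.\<close>

definition almost_contact_at :: "('e::euclidean_space \<Rightarrow> 'e) \<Rightarrow> 'e \<Rightarrow> ('e \<Rightarrow> real) \<Rightarrow> ('e \<Rightarrow> 'e \<Rightarrow> real) \<Rightarrow> bool" where
  "almost_contact_at \<phi> \<xi> \<eta> h \<longleftrightarrow> linear \<phi> \<and> linear \<eta> \<and> (\<forall>v. linear (h v)) \<and> (\<forall>w. linear (\<lambda>v. h v w)) \<and>
     (\<forall>v w. h v w = h w v) \<and> (\<forall>v. v \<noteq> 0 \<longrightarrow> h v v > 0) \<and>
     (\<forall>v. \<phi> (\<phi> v) = - v + \<eta> v *\<^sub>R \<xi>) \<and> \<eta> \<xi> = 1 \<and> (\<forall>v w. h (\<phi> v) (\<phi> w) = h v w - \<eta> v * \<eta> w)"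

text \<open>As for every almost contact structure, \<open>\<phi> \<xi> = 0\<close> and \<open>\<eta> \<circ> \<phi> = 0\<close> already follow from
  \<open>\<phi>\<^sup>2 = -1 + \<eta> \<otimes> \<xi>\<close> and \<open>\<eta>(\<xi>) = 1\<close>; the compatibility of the metric, applied to
  \<open>v\<close> and \<open>\<phi> w\<close>, then says that \<open>\<phi>\<close> is skew.\<close>

lemma almost_contact_at_skew:
  assumes "almost_contact_at \<phi> \<xi> \<eta> h"
  shows "h v (\<phi> w) = - h w (\<phi> v)"
proof -
  have \<phi>: "linear \<phi>" and \<eta>: "linear \<eta>" and h: "\<And>v. linear (h v)" "\<And>w. linear (\<lambda>v. h v w)"
    and sym: "\<And>v w. h v w = h w v" and pos: "\<And>v. v \<noteq> 0 \<Longrightarrow> h v v > 0"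
    and \<phi>\<phi>: "\<And>v. \<phi> (\<phi> v) = - v + \<eta> v *\<^sub>R \<xi>" and \<eta>\<xi>: "\<eta> \<xi> = 1"
    and h\<phi>: "\<And>v w. h (\<phi> v) (\<phi> w) = h v w - \<eta> v * \<eta> w"
    using assms by (auto simp: almost_contact_at_def)
  have \<phi>\<phi>\<xi>: "\<phi> (\<phi> \<xi>) = 0" by (simp add: \<phi>\<phi> \<eta>\<xi>)
  then have e: "\<phi> \<xi> = \<eta> (\<phi> \<xi>) *\<^sub>R \<xi>"
    using \<phi>\<phi>[of "\<phi> \<xi>"] linear_0[OF \<phi>] by (simp add: neg_eq_iff_add_eq_0 add.commute)
  have "\<eta> (\<phi> \<xi>) *\<^sub>R \<phi> \<xi> = 0"
    using arg_cong[OF e, of \<phi>] \<phi>\<phi>\<xi> by (simp add: linear_scale[OF \<phi>])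
  then have \<phi>\<xi>: "\<phi> \<xi> = 0" using e by auto
  have hxi: "h v \<xi> = \<eta> v" for v
    using h\<phi>[of v \<xi>] linear_0[OF h(1)] by (simp add: \<phi>\<xi> \<eta>\<xi>)
  have \<eta>\<phi>: "\<eta> (\<phi> v) = 0" for v
  proof -
    have "- \<phi> v + \<eta> (\<phi> v) *\<^sub>R \<xi> = \<phi> (- v + \<eta> v *\<^sub>R \<xi>)" by (simp only: \<phi>\<phi>[symmetric])
    also have "\<dots> = - \<phi> v" by (simp only: linear_add[OF \<phi>] linear_neg[OF \<phi>] linear_scale[OF \<phi>] \<phi>\<xi> scaleR_zero_right add_0_right)
    finally have "\<eta> (\<phi> v) *\<^sub>R \<xi> = 0" by simp
    then show ?thesis using \<eta>\<xi> linear_0[OF \<eta>] by auto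
  qed
  have "h (\<phi> v) (\<phi> (\<phi> w)) = h v (\<phi> w)" by (simp add: h\<phi> \<eta>\<phi>)
  moreover have "h (\<phi> v) (\<phi> (\<phi> w)) = - h (\<phi> v) w"
    using h(1) hxi[of "\<phi> v"] \<eta>\<phi> by (simp add: \<phi>\<phi> linear_add linear_neg linear_scale linear_diff)
  ultimately show ?thesis using sym by simp
qed

lemma almost_contact_at_transport:
  assumes "almost_contact_at \<phi> \<xi> \<eta> h" and L: "linear L" "linear L'" "\<And>v. L (L' v) = v" "\<And>v. L' (L v) = v"
  shows "almost_contact_at (\<lambda>v. L (\<phi> (L' v))) (L \<xi>) (\<lambda>v. \<eta> (L' v)) (\<lambda>v w. h (L' v) (L' w))"
proof -
  have lc: "linear (\<lambda>x. f (g x))" if "linear g" "linear f"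
    for f :: "'x::real_vector \<Rightarrow> 'y::real_vector" and g :: "'z::real_vector \<Rightarrow> 'x"
    using linear_compose[OF that] by (simp add: o_def)
  have "L' v \<noteq> 0" if "v \<noteq> 0" for v using that L(1,3) linear_0 by metis
  then show ?thesis
    using assms(1) L unfolding almost_contact_at_def
    by (auto intro!: lc[of L'] lc[of "\<lambda>v. \<phi> (L' v)" L] simp: linear_add linear_neg linear_scale linear_diff
        intro: lc[of L' "\<lambda>v. h v (L' w)" for w])
qed

lemma d2_flat_cong:
  assumes "open S" "y \<in> S" "\<And>z v w. z \<in> S \<Longrightarrow> b z v w = b' z v w"
  shows "d2_flat b y u v w = d2_flat b' y u v w"
proof -
  have "\<D> (\<lambda>y. b y v w) y = \<D> (\<lambda>y. b' y v w) y" for v w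
    by (rule D_cong[OF assms(1,2)]) (rule assms(3))
  then show ?thesis by (simp add: d2_flat_def)
qed

lemma d1_flat_cong:
  assumes "open S" "y \<in> S" "\<And>z v. z \<in> S \<Longrightarrow> a z v = a' z v"
  shows "d1_flat a y v w = d1_flat a' y v w"
proof -
  have "\<D> (\<lambda>y. a y v) y = \<D> (\<lambda>y. a' y v) y" for v
    by (rule D_cong[OF assms(1,2)]) (rule assms(3))
  then show ?thesis by (simp add: d1_flat_def)
qed

context smooth_mfd
begin

lemma fundamental_form_rep:
  "c \<in> atlas M \<Longrightarrow> y \<in> snd c ` fst c \<Longrightarrow>
     bilin_rep M c (fundamental_form h A) y v w = bilin_rep M c h y v (endo_rep M c A y w)"
  by (auto simp: fundamental_form_def bilin_rep_at endo_rep_at)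

lemma smooth_fundamental_form:
  assumes h: "smooth_bilin M h" and A: "smooth_endo M A"
  shows "smooth_bilin M (fundamental_form h A)"
  unfolding smooth_bilin_rep
proof (intro conjI ballI allI)
  fix p v w assume p: "p \<in> points M"
  have l: "linear (h p v)" "linear (\<lambda>v. h p v (A p w))" "linear (A p)" using h A p by (auto simp: smooth_bilin_def smooth_endo_def)
  show "linear (fundamental_form h A p v)" "linear (\<lambda>v. fundamental_form h A p v w)"
    using linear_compose[OF l(3,1)] l(2) by (simp_all add: fundamental_form_def[abs_def] o_def)
next
  fix c e e' assume c: "c \<in> atlas M"
  have S: "open (snd c ` fst c)" by (rule chart_range_open[OF c])
  have "smooth_on (snd c ` fst c) (\<lambda>y. bilin_rep M c h y e (endo_rep M c A y e'))"
    by (rule smooth_on_apply[OF S, where A="\<lambda>y. bilin_rep M c h y e" and w="\<lambda>y. endo_rep M c A y e'"])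
      (use h A c linear_bilin_rep[of h c] in \<open>auto simp: smooth_bilin_rep smooth_endo_rep\<close>)
  then show "smooth_on (snd c ` fst c) (\<lambda>y. bilin_rep M c (fundamental_form h A) y e e')"
    by (rule smooth_on_transform[OF _ S]) (rule fundamental_form_rep[OF c])
qed

lemma smooth_vfield_on_subset:
  assumes "smooth_vfield_on M W X" "openin (mtop M) W'" "W' \<subseteq> W"
  shows "smooth_vfield_on M W' X"
  unfolding smooth_vfield_on_def
proof (intro conjI ballI)
  show "openin (mtop M) W'" by fact
  show "smooth_on (snd c ` (fst c \<inter> W')) (vf_rep M c X)" if "c \<in> atlas M" for c
    by (rule smooth_on_subset[OF smooth_vf_rep[OF assms(1) that]]) (use assms(3) in auto)
qed

lemma quasi_SasakianI:
  fixes \<phi> \<xi> \<eta> h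
  assumes dim: "odd DIM('e)" and acm: "\<And>p. p \<in> points M \<Longrightarrow> almost_contact_at (\<phi> p) (\<xi> p) (\<eta> p) (h p)"
    and flat: "\<And>c. c \<in> atlas M \<Longrightarrow>
      quasi_Sasakian_flat (snd c ` fst c) (endo_rep M c \<phi>) (vf_rep M c \<xi>) (form_rep M c \<eta>) (bilin_rep M c h)"
  shows "quasi_Sasakian M \<phi> \<xi> \<eta> h"
proof -
  have s\<phi>: "smooth_endo M \<phi>" and s\<eta>: "smooth_form1 M \<eta>" and sh: "smooth_bilin M h"
    using acm flat by (auto simp: almost_contact_at_def quasi_Sasakian_flat_def smooth_endo_rep smooth_form1_rep smooth_bilin_rep)
  have s\<xi>: "smooth_vfield_on M (points M) \<xi>"
    unfolding smooth_vfield_on_def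
  proof (intro conjI ballI)
    fix c assume c: "c \<in> atlas M"
    have "fst c \<inter> points M = fst c" using chart_dom_points[OF c] by auto
    then show "smooth_on (snd c ` (fst c \<inter> points M)) (vf_rep M c \<xi>)"
      using flat[OF c] by (simp add: quasi_Sasakian_flat_def)
  qed simp
  have m: "almost_contact_metric M \<phi> \<xi> \<eta> h"
    unfolding almost_contact_metric_def riemannian_metric_def
    using smooth_manifold dim s\<phi> s\<eta> sh s\<xi> acm unfolding almost_contact_at_def by blast
  have n: "nijenhuis M \<phi> X Y p + d1 M \<eta> X Y p *\<^sub>R \<xi> p = 0"
    if XY: "smooth_vfield_on M W X" "smooth_vfield_on M W Y" and p: "p \<in> W" for W X Y p
  proof -
    have pM: "p \<in> points M" using XY(1) p openin_subset by (auto simp: smooth_vfield_on_def)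
    let ?c = "chart_at M p"
    note c = chart_at_in[OF pM]
    show ?thesis
      using nijenhuis_chart[OF s\<phi> XY c p] d1_chart[OF s\<eta> XY c p] vf_rep_at[OF c, of \<xi>] flat[OF c(1)] c
      unfolding quasi_Sasakian_flat_def tcoord_chart_at[OF pM] by auto
  qed
  have c2: "closed_form2 M (fundamental_form h \<phi>)"
    unfolding closed_form2_def
  proof (intro allI impI ballI, elim conjE)
    fix W X Y Z p
    assume XYZ: "smooth_vfield_on M W X" "smooth_vfield_on M W Y" "smooth_vfield_on M W Z" and p: "p \<in> W"
    have pM: "p \<in> points M" using XYZ(1) p openin_subset by (auto simp: smooth_vfield_on_def)
    let ?c = "chart_at M p"
    note c = chart_at_in[OF pM]
    let ?S = "snd ?c ` fst ?c"
    have y: "snd ?c p \<in> ?S" using c by auto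
    have "d2 M (fundamental_form h \<phi>) X Y Z p = d2_flat (bilin_rep M ?c (fundamental_form h \<phi>)) (snd ?c p)
     (vf_rep M ?c X (snd ?c p)) (vf_rep M ?c Y (snd ?c p)) (vf_rep M ?c Z (snd ?c p))"
      by (rule d2_chart[OF smooth_fundamental_form[OF sh s\<phi>] _ XYZ c p])
        (unfold fundamental_form_def, rule almost_contact_at_skew[OF acm])
    also have "\<dots> = d2_flat (\<lambda>y v w. bilin_rep M ?c h y v (endo_rep M ?c \<phi> y w)) (snd ?c p)
     (vf_rep M ?c X (snd ?c p)) (vf_rep M ?c Y (snd ?c p)) (vf_rep M ?c Z (snd ?c p))"
      by (rule d2_flat_cong[OF chart_range_open[OF c(1)] y fundamental_form_rep[OF c(1)]])
    also have "\<dots> = 0" using flat[OF c(1)] y unfolding quasi_Sasakian_flat_def by blast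
    finally show "d2 M (fundamental_form h \<phi>) X Y Z p = 0" .
  qed
  show ?thesis unfolding quasi_Sasakian_def using m n c2 by blast
qed

end

section \<open>Quasi-Vaisman structures in charts\<close>

text \<open>A \<open>J\<close>-invariant proper subspace \<open>T\<close> can be enlarged by \<open>u\<close> and \<open>J u\<close> for any
  \<open>u\<close> outside \<open>T\<close>: the dimension grows by exactly two because \<open>J\<close> has no real eigenvalue
  modulo \<open>T\<close>. Were the dimension odd, this would produce a subspace of too large a dimension.\<close>

lemma complex_structure_even_dim:
  fixes J :: "'e::euclidean_space \<Rightarrow> 'e"
  assumes J: "linear J" "\<And>v. J (J v) = - v"
  shows "even DIM('e)"
proof -
  have step: "\<exists>T. subspace T \<and> (\<forall>v\<in>T. J v \<in> T) \<and> dim T = 2 * n" if "2 * n \<le> Suc DIM('e)" for n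
    using that
  proof (induction n)
    case 0
    show ?case by (rule exI[of _ "{0}"]) (use linear_0[OF J(1)] in auto)
  next
    case (Suc n)
    then obtain T where T: "subspace T" "\<And>v. v \<in> T \<Longrightarrow> J v \<in> T" "dim T = 2 * n" by auto
    then have "T \<noteq> UNIV" using Suc.prems by auto
    then obtain u where u: "u \<notin> T" by auto
    have u': "u \<notin> span T" using u T(1) by (simp add: span_eq_iff[THEN iffD2])
    have Ju: "J u \<notin> span (insert u T)"
    proof
      assume "J u \<in> span (insert u T)"
      then obtain k where k: "J u - k *\<^sub>R u \<in> span T" using span_breakdown_eq by metis
      then have kT: "J u - k *\<^sub>R u \<in> T" using T(1) by (simp add: span_eq_iff[THEN iffD2])
      from T(2)[OF kT] have "- u - k *\<^sub>R J u \<in> T"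
        using J by (simp add: linear_diff linear_scale)
      from subspace_add[OF T(1) this subspace_scale[OF T(1) kT, of k]]
      have "- ((1 + k * k) *\<^sub>R u) \<in> T" by (simp add: algebra_simps)
      from subspace_scale[OF T(1) this, of "- inverse (1 + k * k)"]
      have "(inverse (1 + k * k) * (1 + k * k)) *\<^sub>R u \<in> T" by simp
      moreover have "1 + k * k \<noteq> 0" by (smt (verit) zero_le_square)
      ultimately show False using u by simp
    qed
    let ?T = "span (insert (J u) (insert u T))"
    have "dim (insert (J u) (insert u T)) = 2 * Suc n"
      using Ju u' T(3) by (simp add: dim_insert)
    moreover have "J v \<in> ?T" if "v \<in> ?T" for v
      using that
    proof (induction rule: span_induct_alt)
      case base
      show ?case using linear_0[OF J(1)] by (simp add: span_zero)
    next
      case (step c x y)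
      have "J x \<in> ?T"
        using step.hyps T(2) J(2) by (auto intro: span_base span_neg[OF span_base])
      then show ?case using step.IH J(1) by (simp add: linear_add linear_scale span_add span_scale)
    qed
    ultimately show ?case by (intro exI[of _ ?T]) auto
  qed
  show ?thesis
  proof (rule ccontr)
    assume "odd DIM('e)"
    then obtain n where n: "Suc DIM('e) = 2 * n" by (metis even_Suc evenE)
    from step[of n] n obtain T :: "'e set" where "dim T = Suc DIM('e)" by auto
    then show False using dim_subset_UNIV[of T] by simp
  qed
qed

text \<open>A positive definite form identifies a finite-dimensional space with its dual, so the definite
  description in \<open>metric_dual\<close> denotes.\<close>

lemma metric_dual_works:
  fixes g :: "('a, 'e::euclidean_space) bilin"
  assumes lin: "\<And>v. linear (g p v)" "\<And>w. linear (\<lambda>v. g p v w)" and pos: "\<And>v. v \<noteq> 0 \<Longrightarrow> g p v v > 0"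
    and \<alpha>: "linear (\<alpha> p)"
  shows "g p (metric_dual g \<alpha> p) v = \<alpha> p v"
proof -
  let ?T = "\<lambda>v. \<Sum>b\<in>Basis. g p v b *\<^sub>R b"
  have T: "?T u \<bullet> v = g p u v" for u v
  proof -
    have "g p u v = (\<Sum>b\<in>Basis. (v \<bullet> b) * g p u b)" using linear_expand[OF lin(1), of u v] by simp
    also have "\<dots> = (\<Sum>b\<in>Basis. (g p u b *\<^sub>R b) \<bullet> v)" by (simp add: inner_commute mult.commute)
    finally show ?thesis by (simp only: inner_sum_left)
  qed
  have lT: "linear ?T"
    by (rule linearI) (simp_all add: linear_add[OF lin(2)] linear_scale[OF lin(2)] scaleR_left_distrib
        sum.distrib scaleR_sum_right)
  have uniq: "u = u'" if "\<And>v. g p u v = g p u' v" for u u'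
  proof (rule ccontr)
    assume "u \<noteq> u'"
    then have "g p (u - u') (u - u') > 0" using pos by simp
    then show False using that linear_diff[OF lin(2)] by simp
  qed
  have "inj ?T"
  proof (rule injI)
    fix u u' assume "?T u = ?T u'"
    then have "g p u v = g p u' v" for v using T[of u v] T[of u' v] by simp
    then show "u = u'" by (rule uniq)
  qed
  then have "surj ?T" using lT linear_injective_imp_surjective by blast
  from surjD[OF this, of "\<Sum>b\<in>Basis. \<alpha> p b *\<^sub>R b"]
  obtain u where u: "(\<Sum>b\<in>Basis. \<alpha> p b *\<^sub>R b) = ?T u" by (rule exE)
  have gu: "g p u v = \<alpha> p v" for v
  proof -
    have "g p u v = (\<Sum>b\<in>Basis. \<alpha> p b *\<^sub>R b) \<bullet> v" using T[of u v] u by simp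
    also have "\<dots> = (\<Sum>b\<in>Basis. (\<alpha> p b *\<^sub>R b) \<bullet> v)" by (rule inner_sum_left)
    also have "\<dots> = (\<Sum>b\<in>Basis. (v \<bullet> b) *\<^sub>R \<alpha> p b)" by (simp add: inner_commute mult.commute)
    also have "\<dots> = \<alpha> p v" by (rule linear_expand[OF \<alpha>, symmetric])
    finally show ?thesis .
  qed
  have ex1: "\<exists>!u. \<forall>v. g p u v = \<alpha> p v"
    by (rule ex1I[of _ u]) (use gu uniq in auto)
  show "g p (metric_dual g \<alpha> p) v = \<alpha> p v" using theI'[OF ex1] by (simp add: metric_dual_def)
qed

locale quasi_Vaisman_mfd =
  fixes M :: "('a, 'e::euclidean_space) manifold" and J g \<theta>
  assumes qV: "quasi_Vaisman M J g \<theta>"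
begin

sublocale smooth_mfd M using qV by unfold_locales (simp add: quasi_Vaisman_def)

abbreviation "U \<equiv> quasi_Lee g \<theta>"
abbreviation "V \<equiv> quasi_anti_Lee J g \<theta>"
abbreviation "\<eta>M \<equiv> quasi_anti_Lee_form J \<theta>"

lemma smooth_data: "smooth_endo M J" "smooth_bilin M g" "smooth_form1 M \<theta>" "smooth_vfield_on M (points M) U"
  using qV by (auto simp: quasi_Vaisman_def hermitian_def integrable_almost_complex_def riemannian_metric_def killing_def)

lemma field_identities:
  "\<forall>W X Y. smooth_vfield_on M W X \<and> smooth_vfield_on M W Y \<longrightarrow> (\<forall>p\<in>W. nijenhuis M J X Y p = 0)"
  "\<forall>W X Y. smooth_vfield_on M W X \<and> smooth_vfield_on M W Y \<longrightarrow> (\<forall>p\<in>W. d1 M \<theta> X Y p = 0)"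
  "\<forall>W X. smooth_vfield_on M W X \<longrightarrow>
     (\<forall>p\<in>W. lie_bracket M U (\<lambda>q. J q (X q)) p - J p (lie_bracket M U X p) = 0)"
  "\<forall>W X Y Z. smooth_vfield_on M W X \<and> smooth_vfield_on M W Y \<and> smooth_vfield_on M W Z \<longrightarrow>
     (\<forall>p\<in>W. d2 M (fundamental_form g J) X Y Z p = d1_wedge M \<eta>M \<theta> X Y Z p)"
proof -
  show "\<forall>W X Y. smooth_vfield_on M W X \<and> smooth_vfield_on M W Y \<longrightarrow> (\<forall>p\<in>W. nijenhuis M J X Y p = 0)"
    using qV unfolding quasi_Vaisman_def hermitian_def integrable_almost_complex_def closed_form1_def
      preserves_endo_def by (elim conjE)
  show "\<forall>W X Y. smooth_vfield_on M W X \<and> smooth_vfield_on M W Y \<longrightarrow> (\<forall>p\<in>W. d1 M \<theta> X Y p = 0)"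
    using qV unfolding quasi_Vaisman_def hermitian_def integrable_almost_complex_def closed_form1_def
      preserves_endo_def by (elim conjE)
  show "\<forall>W X. smooth_vfield_on M W X \<longrightarrow>
     (\<forall>p\<in>W. lie_bracket M U (\<lambda>q. J q (X q)) p - J p (lie_bracket M U X p) = 0)"
    using qV unfolding quasi_Vaisman_def hermitian_def integrable_almost_complex_def closed_form1_def
      preserves_endo_def by (elim conjE)
  show "\<forall>W X Y Z. smooth_vfield_on M W X \<and> smooth_vfield_on M W Y \<and> smooth_vfield_on M W Z \<longrightarrow>
     (\<forall>p\<in>W. d2 M (fundamental_form g J) X Y Z p = d1_wedge M \<eta>M \<theta> X Y Z p)"
    using qV unfolding quasi_Vaisman_def hermitian_def integrable_almost_complex_def closed_form1_def
      preserves_endo_def by (elim conjE)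
qed

context
  fixes p assumes p: "p \<in> points M"
begin

lemma linear_data: "linear (J p)" "linear (\<theta> p)" "linear (g p v)" "linear (\<lambda>v. g p v w)"
  using smooth_data p by (auto simp: smooth_endo_def smooth_bilin_def smooth_form1_def)

lemma metric_data: "g p v w = g p w v" "v \<noteq> 0 \<Longrightarrow> g p v v > 0" "g p (J p v) (J p w) = g p v w" "J p (J p v) = - v"
  using qV p by (auto simp: quasi_Vaisman_def hermitian_def integrable_almost_complex_def riemannian_metric_def)

lemma g_U: "g p (U p) v = \<theta> p v" "g p v (U p) = \<theta> p v"
  using metric_dual_works[of g p \<theta> v, OF linear_data(3,4) metric_data(2) linear_data(2)] metric_data(1)
  by (simp_all add: quasi_Lee_def)

lemma \<theta>_U: "\<theta> p (U p) = 1"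
  using qV p g_U by (auto simp: quasi_Vaisman_def)

lemma V_eq: "V p = J p (U p)" by (simp add: quasi_anti_Lee_def)

lemma g_V: "g p v (J p (U p)) = - \<theta> p (J p v)" "g p (J p (U p)) v = - \<theta> p (J p v)"
proof -
  show "g p v (J p (U p)) = - \<theta> p (J p v)"
    using metric_data(3)[of v "J p (U p)"] g_U(2)[of "J p v"] metric_data(4) linear_neg[OF linear_data(3)] by simp
  then show "g p (J p (U p)) v = - \<theta> p (J p v)" by (simp add: metric_data(1)[of v "J p (U p)"])
qed

lemma \<theta>_V: "\<theta> p (J p (U p)) = 0"
  using g_V(1)[of "U p"] g_U(1)[of "J p (U p)"] by simp

lemma line_\<phi>_eq:
  "line_\<phi> J g \<theta> (p, t) (v, s) =
     (J p v - \<theta> p v *\<^sub>R J p (U p) + (- \<theta> p (J p v) - s) *\<^sub>R U p, \<theta> p v)"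
  using linear_data(1) metric_data(4)
  by (simp add: line_\<phi>_def Let_def g_U g_V V_eq linear_diff linear_add linear_scale algebra_simps)

lemma line_\<eta>_eq: "line_\<eta> J g \<theta> (p, t) (v, s) = - \<theta> p (J p v)"
  by (simp add: line_\<eta>_def line_metric_def line_\<xi>_def V_eq g_V)

lemma almost_contact_line: "almost_contact_at (line_\<phi> J g \<theta> (p, t)) (line_\<xi> J g \<theta> (p, t)) (line_\<eta> J g \<theta> (p, t)) (line_metric g (p, t))"
proof -
  note lJ = linear_simps[OF linear_data(1)]
  note l\<theta> = linear_simps[OF linear_data(2)]
  note lg = linear_simps[OF linear_data(3)]
    linear_simps[OF linear_data(4)]
  note eqs = line_\<phi>_eq line_\<eta>_eq
  have 1: "linear (line_\<phi> J g \<theta> (p, t))" "linear (line_\<eta> J g \<theta> (p, t))"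
    by (rule linearI; clarsimp simp: eqs lJ l\<theta> algebra_simps)+
  have 2: "linear (line_metric g (p, t) x)" "linear (\<lambda>x. line_metric g (p, t) x x')" for x x'
    by (cases x; rule linearI; clarsimp simp: line_metric_def lg algebra_simps)
      (cases x'; rule linearI; clarsimp simp: line_metric_def lg algebra_simps)
  have 3: "line_metric g (p, t) x x' = line_metric g (p, t) x' x" for x x'
    by (cases x; cases x') (simp add: line_metric_def metric_data(1) mult.commute)
  have 4: "line_metric g (p, t) x x > 0" if "x \<noteq> 0" for x
  proof -
    obtain v s where x: "x = (v, s)" by (cases x)
    have "g p v v \<ge> 0" using metric_data(2)[of v] linear_0[OF linear_data(3)] by (cases "v = 0") (auto simp: less_imp_le)
    moreover have "g p v v > 0 \<or> s * s > 0" using that metric_data(2)[of v] by (auto simp: x zero_prod_def zero_less_mult_iff)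
    ultimately show ?thesis by (auto simp: x line_metric_def add_nonneg_pos add_pos_nonneg)
  qed
  have 5: "line_\<phi> J g \<theta> (p, t) (line_\<phi> J g \<theta> (p, t) x) = - x + line_\<eta> J g \<theta> (p, t) x *\<^sub>R line_\<xi> J g \<theta> (p, t)" for x
    by (cases x) (simp add: eqs lJ l\<theta> line_\<xi>_def V_eq \<theta>_U \<theta>_V metric_data(4) algebra_simps)
  have 6: "line_\<eta> J g \<theta> (p, t) (line_\<xi> J g \<theta> (p, t)) = 1"
    by (simp add: line_\<xi>_def line_\<eta>_eq V_eq metric_data(4) l\<theta> \<theta>_U)
  have 7: "line_metric g (p, t) (line_\<phi> J g \<theta> (p, t) x) (line_\<phi> J g \<theta> (p, t) x') =
      line_metric g (p, t) x x' - line_\<eta> J g \<theta> (p, t) x * line_\<eta> J g \<theta> (p, t) x'" for x x'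
    by (cases x; cases x') (simp add: eqs line_metric_def lg metric_data(3,4) g_U g_V \<theta>_U \<theta>_V lJ l\<theta> algebra_simps)
  show ?thesis unfolding almost_contact_at_def using 1 2 3 4 5 6 7 by blast
qed

end

lemma fundamental_skew:
  assumes "p \<in> points M"
  shows "fundamental_form g J p v w = - fundamental_form g J p w v"
  using metric_data(3)[OF assms, of v "J p w"] metric_data(4)[OF assms] metric_data(1)[OF assms, of "J p v"]
    linear_neg[OF linear_data(3)[OF assms]]
  by (simp add: fundamental_form_def)

lemma \<eta>M_rep: "c \<in> atlas M \<Longrightarrow> y \<in> snd c ` fst c \<Longrightarrow>
    form_rep M c \<eta>M y v = - form_rep M c \<theta> y (endo_rep M c J y v)"
  by (auto simp: form_rep_at endo_rep_at quasi_anti_Lee_form_def)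

lemma smooth_\<eta>M: "smooth_form1 M \<eta>M"
  unfolding smooth_form1_rep
proof (intro conjI ballI allI)
  show "linear (\<eta>M p)" if "p \<in> points M" for p
    using linear_compose_neg[OF linear_compose[OF linear_data(1)[OF that] linear_data(2)[OF that]]]
    by (simp add: quasi_anti_Lee_form_def[abs_def] o_def)
  fix c e assume c: "c \<in> atlas M"
  have S: "open (snd c ` fst c)" by (rule chart_range_open[OF c])
  have "smooth_on (snd c ` fst c) (\<lambda>y. form_rep M c \<theta> y (endo_rep M c J y e))"
    by (rule smooth_on_apply[OF S, where A="form_rep M c \<theta>" and w="\<lambda>y. endo_rep M c J y e"])
      (use smooth_data c linear_form_rep[of \<theta> c] in \<open>auto simp: smooth_form1_rep smooth_endo_rep\<close>)
  then show "smooth_on (snd c ` fst c) (\<lambda>y. form_rep M c \<eta>M y e)"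
    by (rule smooth_on_transform[OF smooth_on_uminus[OF S] S]) (rule \<eta>M_rep[OF c])
qed

text \<open>Evaluating the hypotheses, which hold for all local fields, on the coordinate fields of \<open>c\<close>
  gives identities between components for arbitrary constant vectors.\<close>

lemma flat_chart:
  assumes c: "c \<in> atlas M"
  shows "flat_quasi_Vaisman (snd c ` fst c) (endo_rep M c J) (bilin_rep M c g) (form_rep M c \<theta>) (vf_rep M c U)"
proof -
  let ?S = "snd c ` fst c"
  have S: "open ?S" by (rule chart_range_open[OF c])
  have fc: "fst c \<inter> points M = fst c" using chart_dom_points[OF c] by auto
  have U: "smooth_vfield_on M (fst c) U"
    by (rule smooth_vfield_on_subset[OF smooth_data(4) chart_dom_open[OF c]]) (use fc in auto)
  note cf = smooth_coord_field[OF c]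
  note sd = smooth_data
  show ?thesis
  proof (rule flat_quasi_Vaisman.intro)
    fix y assume yS: "y \<in> ?S"
    from yS obtain p where p: "p \<in> fst c" and y: "y = snd c p" by auto
    note pM = chart_dom_points[OF c p]
    note at = endo_rep_at[OF c p] bilin_rep_at[OF c p] form_rep_at[OF c p] vf_rep_at[OF c p]
    note cfl = linear_coord_field[OF c p]
    have y': "y \<in> ?S" using y p by auto
    have cfr: "vf_rep M c (coord_field M c e) (snd c p) = e" for e using vf_rep_coord_field[OF c, of y e] y y' by simp
    show "linear (endo_rep M c J y)" by (rule linear_endo_rep[OF _ c y']) (use sd in \<open>auto simp: smooth_endo_def\<close>)
    show "linear (form_rep M c \<theta> y)" by (rule linear_form_rep[OF _ c y']) (use sd in \<open>auto simp: smooth_form1_def\<close>)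
    show "linear (bilin_rep M c g y v)" for v by (rule linear_bilin_rep[OF _ c y']) (use sd in \<open>auto simp: smooth_bilin_def\<close>)
    show "endo_rep M c J y (endo_rep M c J y v) = - v" for v
      using linear_neg[OF linear_tcoord[OF c p]] c p by (simp add: y at metric_data(4)[OF pM])
    show "form_rep M c \<theta> y (vf_rep M c U y) = 1" using c p by (simp add: y at \<theta>_U[OF pM])
    show "form_rep M c \<theta> y (endo_rep M c J y (vf_rep M c U y)) = 0" using c p by (simp add: y at \<theta>_V[OF pM])
    show "bilin_rep M c g y v (vf_rep M c U y) = form_rep M c \<theta> y v" for v using c p by (simp add: y at g_U[OF pM])
    show "bilin_rep M c g y v (endo_rep M c J y (vf_rep M c U y)) = - form_rep M c \<theta> y (endo_rep M c J y v)" for v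
      using c p by (simp add: y at g_V[OF pM])
    show "nijenhuis_flat (endo_rep M c J) y v w = 0" for v w
    proof -
      have "nijenhuis M J (coord_field M c v) (coord_field M c w) p = 0"
        using field_identities(1) cf p by blast
      then show ?thesis
        using nijenhuis_chart[OF sd(1) cf cf c p p, of v w] linear_0[OF linear_tcoord[OF c p]] by (simp add: cfr y)
    qed
    show "d1_flat (form_rep M c \<theta>) y v w = 0" for v w
    proof -
      have "d1 M \<theta> (coord_field M c v) (coord_field M c w) p = 0"
        using field_identities(2) cf p by blast
      then show ?thesis using d1_chart[OF sd(3) cf cf c p p, of v w] by (simp add: cfr y)
    qed
    show "\<D> (\<lambda>y. endo_rep M c J y v) y (vf_rep M c U y) - \<D> (vf_rep M c U) y (endo_rep M c J y v)
        + endo_rep M c J y (\<D> (vf_rep M c U) y v) = 0" for v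
    proof -
      have "lie_bracket M U (\<lambda>q. J q (coord_field M c v q)) p - J p (lie_bracket M U (coord_field M c v) p) = 0"
        using field_identities(3) cf p by blast
      then show ?thesis
        using lie_deriv_endo_chart[OF sd(1) U cf c p p, of v] linear_0[OF linear_tcoord[OF c p]] by (simp add: cfr y)
    qed
    show "d2_flat (\<lambda>y v w. bilin_rep M c g y v (endo_rep M c J y w)) y u v w =
       d1_flat (\<lambda>y v. - form_rep M c \<theta> y (endo_rep M c J y v)) y u v * form_rep M c \<theta> y w +
       d1_flat (\<lambda>y v. - form_rep M c \<theta> y (endo_rep M c J y v)) y v w * form_rep M c \<theta> y u +
       d1_flat (\<lambda>y v. - form_rep M c \<theta> y (endo_rep M c J y v)) y w u * form_rep M c \<theta> y v" for u v w
    proof -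
      have "d2 M (fundamental_form g J) (coord_field M c u) (coord_field M c v) (coord_field M c w) p =
          d1_wedge M \<eta>M \<theta> (coord_field M c u) (coord_field M c v) (coord_field M c w) p"
        using field_identities(4) cf p by blast
      then have "d2_flat (bilin_rep M c (fundamental_form g J)) y u v w =
          d1_flat (form_rep M c \<eta>M) y u v * form_rep M c \<theta> y w +
          d1_flat (form_rep M c \<eta>M) y v w * form_rep M c \<theta> y u +
          d1_flat (form_rep M c \<eta>M) y w u * form_rep M c \<theta> y v"
        using d2_chart[OF smooth_fundamental_form[OF sd(2,1)] fundamental_skew cf cf cf c p p, of u v w]
          d1_chart[OF smooth_\<eta>M cf cf c p p]
        by (simp add: d1_wedge_def cfr at(3) y)
      then show ?thesis
        using d2_flat_cong[OF S y' fundamental_form_rep[OF c, of _ g J]] d1_flat_cong[OF S y' \<eta>M_rep[OF c]]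
        by simp
    qed
  qed (use S sd c fc in \<open>auto simp: smooth_endo_rep smooth_form1_rep smooth_bilin_rep smooth_vfield_on_def\<close>)
qed

end

section \<open>Smooth maps and their tangent maps\<close>

lemma smooth_map_domain_open:
  assumes "smooth_manifold M" "smooth_manifold N" "smooth_map M N F" "c \<in> atlas M" "d \<in> atlas N"
  shows "open (snd c ` {p \<in> fst c. F p \<in> fst d})" "openin (mtop M) {p \<in> fst c. F p \<in> fst d}"
proof -
  interpret M: smooth_mfd M by unfold_locales fact
  interpret N: smooth_mfd N by unfold_locales fact
  have pre: "openin (mtop M) {p \<in> points M. F p \<in> fst d}"
    using assms(3) N.chart_dom_open[OF assms(5)] by (auto simp: smooth_map_def intro: openin_continuous_map_preimage)
  have eq: "{p \<in> fst c. F p \<in> fst d} = fst c \<inter> {p \<in> points M. F p \<in> fst d}"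
    using M.chart_dom_points[OF assms(4)] by auto
  show "open (snd c ` {p \<in> fst c. F p \<in> fst d})" "openin (mtop M) {p \<in> fst c. F p \<in> fst d}"
    unfolding eq using M.chart_image_open[OF assms(4) pre] M.chart_dom_open[OF assms(4)] pre by auto
qed

lemma smooth_map_differentiable:
  assumes "smooth_map M N F" "c \<in> atlas M" "d \<in> atlas N" "p \<in> fst c" "F p \<in> fst d"
  shows "(snd d \<circ> F \<circ> cinv c) differentiable (at (snd c p))"
  by (rule smooth_on_imp_differentiable[of "snd c ` {p \<in> fst c. F p \<in> fst d}"])
    (use assms in \<open>auto simp: smooth_map_def\<close>)

lemma smooth_map_points: "smooth_map M N F \<Longrightarrow> p \<in> points M \<Longrightarrow> F p \<in> points N"
  unfolding smooth_map_def continuous_map_def by auto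

text \<open>The chain rule for coordinate expressions in arbitrary charts. Tangent maps are the case of
  preferred charts, and taking the identity for one of the maps gives the passage to other charts.\<close>

lemma smooth_map_chain:
  assumes M: "smooth_manifold M" and N: "smooth_manifold N"
    and F: "smooth_map M N F" and G: "smooth_map N P G"
    and c: "c \<in> atlas M" and d: "d \<in> atlas N" and e: "e \<in> atlas P"
    and p: "p \<in> fst c" "F p \<in> fst d" "G (F p) \<in> fst e"
  shows "\<D> (snd e \<circ> G \<circ> cinv d) (snd d (F p)) (\<D> (snd d \<circ> F \<circ> cinv c) (snd c p) v) =
    \<D> (snd e \<circ> (G \<circ> F) \<circ> cinv c) (snd c p) v"
proof -
  interpret M: smooth_mfd M by unfold_locales fact
  interpret N: smooth_mfd N by unfold_locales fact
  let ?S = "snd c ` {p \<in> fst c. F p \<in> fst d}"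
  have y: "snd c p \<in> ?S" using p by auto
  have Fp: "(snd d \<circ> F \<circ> cinv c) (snd c p) = snd d (F p)" using c p by simp
  have "\<D> (snd e \<circ> (G \<circ> F) \<circ> cinv c) (snd c p) =
      \<D> (\<lambda>y. (snd e \<circ> G \<circ> cinv d) ((snd d \<circ> F \<circ> cinv c) y)) (snd c p)"
    by (rule D_cong[OF smooth_map_domain_open(1)[OF M N F c d] y]) (use c d in auto)
  then have "\<D> (snd e \<circ> (G \<circ> F) \<circ> cinv c) (snd c p) v =
      \<D> (\<lambda>y. (snd e \<circ> G \<circ> cinv d) ((snd d \<circ> F \<circ> cinv c) y)) (snd c p) v" by simp
  also have "\<dots> = \<D> (snd e \<circ> G \<circ> cinv d) ((snd d \<circ> F \<circ> cinv c) (snd c p)) (\<D> (snd d \<circ> F \<circ> cinv c) (snd c p) v)"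
    by (rule D_compose[OF smooth_map_differentiable[OF F c d p(1,2)]], unfold Fp)
      (rule smooth_map_differentiable[OF G d e p(2,3)])
  finally show ?thesis unfolding Fp by simp
qed

lemma smooth_map_comp:
  assumes M: "smooth_manifold M" and N: "smooth_manifold N" and P: "smooth_manifold P"
    and F: "smooth_map M N F" and G: "smooth_map N P G"
  shows "smooth_map M P (G \<circ> F)"
  unfolding smooth_map_def
proof (intro conjI ballI)
  interpret M: smooth_mfd M by unfold_locales fact
  interpret N: smooth_mfd N by unfold_locales fact
  show "continuous_map (mtop M) (mtop P) (G \<circ> F)"
    using F G by (auto simp: smooth_map_def intro: continuous_map_compose)
  fix c e assume c: "c \<in> atlas M" and e: "e \<in> atlas P"
  show "smooth_on (snd c ` {p \<in> fst c. (G \<circ> F) p \<in> fst e}) (snd e \<circ> (G \<circ> F) \<circ> cinv c)"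
  proof (rule smooth_on_local)
    fix y assume "y \<in> snd c ` {p \<in> fst c. (G \<circ> F) p \<in> fst e}"
    then obtain p where p: "p \<in> fst c" "G (F p) \<in> fst e" "y = snd c p" by auto
    let ?d = "chart_at N (F p)"
    have d: "?d \<in> atlas N" "F p \<in> fst ?d"
      using N.chart_at_in smooth_map_points[OF F M.chart_dom_points[OF c p(1)]] by auto
    have "openin (mtop M) {q \<in> points M. F q \<in> {r \<in> fst ?d. G r \<in> fst e}}"
      by (rule openin_continuous_map_preimage[OF _ smooth_map_domain_open(2)[OF N P G d(1) e]])
        (use F in \<open>simp add: smooth_map_def\<close>)
    from M.chart_image_open[OF c this]
    have T: "open (snd c ` (fst c \<inter> {q \<in> points M. F q \<in> {r \<in> fst ?d. G r \<in> fst e}}))" (is "open ?T") .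
    have "smooth_on ?T (\<lambda>y. (snd e \<circ> G \<circ> cinv ?d) ((snd ?d \<circ> F \<circ> cinv c) y))"
    proof (rule smooth_on_compose[OF T, where f="snd ?d \<circ> F \<circ> cinv c" and g="snd e \<circ> G \<circ> cinv ?d"
          and T="snd ?d ` {r \<in> fst ?d. G r \<in> fst e}"])
      show "smooth_on ?T (snd ?d \<circ> F \<circ> cinv c)"
        by (rule smooth_on_subset[of "snd c ` {p \<in> fst c. F p \<in> fst ?d}"])
          (use F c d in \<open>auto simp: smooth_map_def\<close>)
      show "smooth_on (snd ?d ` {r \<in> fst ?d. G r \<in> fst e}) (snd e \<circ> G \<circ> cinv ?d)"
        using G d e by (auto simp: smooth_map_def)
    qed (use c d in auto)
    then have "smooth_on ?T (snd e \<circ> (G \<circ> F) \<circ> cinv c)"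
      by (rule smooth_on_transform[OF _ T]) (use c d in auto)
    then show "\<exists>T. open T \<and> y \<in> T \<and> smooth_on T (snd e \<circ> (G \<circ> F) \<circ> cinv c)"
      using T p d M.chart_dom_points[OF c] by (intro exI[of _ ?T]) auto
  qed
qed

lemma smooth_map_id:
  assumes "smooth_manifold M"
  shows "smooth_map M M id"
proof -
  interpret M: smooth_mfd M by unfold_locales fact
  have "{p \<in> fst c. id p \<in> fst d} = fst c \<inter> fst d" for c d :: "('a, 'b) chart" by auto
  then show ?thesis using M.transition_smooth by (simp add: smooth_map_def)
qed

lemma smooth_map_cong:
  assumes "smooth_manifold M" "smooth_manifold N" "smooth_map M N F" "\<And>p. p \<in> points M \<Longrightarrow> F' p = F p"
  shows "smooth_map M N F'"
  unfolding smooth_map_def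
proof (intro conjI ballI)
  interpret M: smooth_mfd M by unfold_locales fact
  show "continuous_map (mtop M) (mtop N) F'"
    using assms(3,4) by (auto simp: smooth_map_def intro: continuous_map_eq)
  fix c d assume c: "c \<in> atlas M" and d: "d \<in> atlas N"
  have eq: "{p \<in> fst c. F' p \<in> fst d} = {p \<in> fst c. F p \<in> fst d}"
    using assms(4) M.chart_dom_points[OF c] by auto
  have "smooth_on (snd c ` {p \<in> fst c. F p \<in> fst d}) (snd d \<circ> F \<circ> cinv c)"
    using assms(3) c d by (auto simp: smooth_map_def)
  then show "smooth_on (snd c ` {p \<in> fst c. F' p \<in> fst d}) (snd d \<circ> F' \<circ> cinv c)"
    unfolding eq
    by (rule smooth_on_transform[OF _ smooth_map_domain_open(1)[OF assms(1-3) c d]])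
      (use c assms(4) M.chart_dom_points[OF c] in auto)
qed

lemma tangent_map_comp:
  assumes M: "smooth_manifold M" and N: "smooth_manifold N" and P: "smooth_manifold P"
    and F: "smooth_map M N F" and G: "smooth_map N P G" and p: "p \<in> points M"
  shows "tangent_map M P (G \<circ> F) p v = tangent_map N P G (F p) (tangent_map M N F p v)"
proof -
  interpret M: smooth_mfd M by unfold_locales fact
  interpret N: smooth_mfd N by unfold_locales fact
  interpret P: smooth_mfd P by unfold_locales fact
  have "F p \<in> points N" "G (F p) \<in> points P" using smooth_map_points F G p by metis+
  then show ?thesis
    unfolding tangent_map_def comp_apply[of G F p]
    by (intro smooth_map_chain[OF M N F G, symmetric] M.chart_at_in N.chart_at_in P.chart_at_in p)
qed

lemma tangent_map_cong:
  assumes M: "smooth_manifold M" and W: "openin (mtop M) W" "p \<in> W" and eq: "\<And>q. q \<in> W \<Longrightarrow> F q = G q"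
  shows "tangent_map M N F p = tangent_map M N G p"
proof -
  interpret M: smooth_mfd M by unfold_locales fact
  have p: "p \<in> points M" using W openin_subset by blast
  note c = M.chart_at_in[OF p]
  show ?thesis
    unfolding tangent_map_def eq[OF W(2)]
    by (rule D_cong[OF M.chart_image_open[OF c(1) W(1)]]) (use c W eq in auto)
qed

lemma tangent_map_id:
  assumes M: "smooth_manifold M" and p: "p \<in> points M"
  shows "tangent_map M M id p v = v"
proof -
  interpret M: smooth_mfd M by unfold_locales fact
  show ?thesis
    using M.jac_self[OF M.chart_at_in[OF p], of v] by (simp add: tangent_map_def jac_def)
qed

lemma linear_tangent_map:
  assumes M: "smooth_manifold M" and N: "smooth_manifold N" and F: "smooth_map M N F" and p: "p \<in> points M"
  shows "linear (tangent_map M N F p)"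
proof -
  interpret M: smooth_mfd M by unfold_locales fact
  interpret N: smooth_mfd N by unfold_locales fact
  show ?thesis
    unfolding tangent_map_def
    by (intro D_linear smooth_map_differentiable[OF F] M.chart_at_in N.chart_at_in p smooth_map_points[OF F p])
qed

lemma tcoord_tangent_map:
  assumes M: "smooth_manifold M" and N: "smooth_manifold N" and F: "smooth_map M N F" and p: "p \<in> points M"
    and d: "d \<in> atlas N" "F p \<in> fst d"
  shows "tcoord N d (F p) (tangent_map M N F p v) = \<D> (snd d \<circ> F \<circ> cinv (chart_at M p)) (snd (chart_at M p) p) v"
proof -
  interpret M: smooth_mfd M by unfold_locales fact
  interpret N: smooth_mfd N by unfold_locales fact
  show ?thesis
    using smooth_map_chain[OF M N F smooth_map_id[OF N] M.chart_at_in(1)[OF p] N.chart_at_in(1)[OF smooth_map_points[OF F p]]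
        d(1) M.chart_at_in(2)[OF p] N.chart_at_in(2)[OF smooth_map_points[OF F p]]] d(2)
    by (simp add: tcoord_def tangent_map_def)
qed

section \<open>The product with the line\<close>

definition prod_chart :: "('a, 'e) chart \<Rightarrow> ('a \<times> real, 'e \<times> real) chart" where
  "prod_chart c = (fst c \<times> UNIV, map_prod (snd c) id)"

lemma prod_chart_sel [simp]:
  "fst (prod_chart c) = fst c \<times> UNIV" "snd (prod_chart c) (p, t) = (snd c p, t)"
  by (simp_all add: prod_chart_def)

lemma times_line_sel [simp]:
  "mtop (times_line M) = prod_topology (mtop M) euclideanreal"
  "atlas (times_line M) = prod_chart ` atlas M"
  "chart_at (times_line M) (p, t) = prod_chart (chart_at M p)"
  by (simp_all add: times_line_def prod_chart_def[abs_def])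

lemma prod_chart_image: "snd (prod_chart c) ` (A \<times> B) = (snd c ` A) \<times> B"
  by (force simp: prod_chart_def)

lemma second_countable_prod_euclidean:
  fixes X :: "'a topology"
  assumes "second_countable X"
  shows "second_countable (prod_topology X (euclidean :: 'b::second_countable_topology topology))"
proof -
  obtain \<B> where \<B>: "countable \<B>" "\<And>V. V \<in> \<B> \<Longrightarrow> openin X V"
    "\<And>U x. openin X U \<Longrightarrow> x \<in> U \<Longrightarrow> (\<exists>V \<in> \<B>. x \<in> V \<and> V \<subseteq> U)"
    using assms by (auto simp: second_countable_def)
  obtain \<C> :: "'b set set" where \<C>: "countable \<C>" "topological_basis \<C>" using ex_countable_basis by auto
  show ?thesis
    unfolding second_countable_def
  proof (intro exI[of _ "(\<lambda>(V, C). V \<times> C) ` (\<B> \<times> \<C>)"] conjI ballI allI impI)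
    show "countable ((\<lambda>(V, C). V \<times> C) ` (\<B> \<times> \<C>))" using \<B>(1) \<C>(1) by auto
    show "openin (prod_topology X (euclidean :: 'b topology)) Z" if "Z \<in> (\<lambda>(V, C). V \<times> C) ` (\<B> \<times> \<C>)" for Z
      using that \<B>(2) topological_basis_open[OF \<C>(2)] by (auto simp: openin_prod_Times_iff)
    fix Z x assume "openin (prod_topology X (euclidean :: 'b topology)) Z \<and> x \<in> Z"
    then obtain A B where AB: "openin X A" "open B" "fst x \<in> A" "snd x \<in> B" "A \<times> B \<subseteq> Z"
      unfolding openin_prod_topology_alt by (metis open_openin prod.collapse)
    obtain V where V: "V \<in> \<B>" "fst x \<in> V" "V \<subseteq> A" using \<B>(3) AB by blast
    obtain C where C: "C \<in> \<C>" "snd x \<in> C" "C \<subseteq> B" using topological_basisE[OF \<C>(2) AB(2,4)] by blast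
    show "\<exists>Y\<in>(\<lambda>(V, C). V \<times> C) ` (\<B> \<times> \<C>). x \<in> Y \<and> Y \<subseteq> Z"
      by (rule bexI[of _ "V \<times> C"]) (use V C AB in \<open>auto simp: mem_Times_iff\<close>)
  qed
qed

context smooth_mfd
begin

lemma cinv_prod_chart:
  assumes "c \<in> atlas M" "y \<in> snd c ` fst c"
  shows "cinv (prod_chart c) (y, t) = (cinv c y, t)"
proof -
  obtain p where p: "p \<in> fst c" "y = snd c p" using assms by auto
  have "inj_on (snd (prod_chart c)) (fst c \<times> UNIV)"
    using chart_inj[OF assms(1)] by (auto simp: inj_on_def)
  then have "cinv (prod_chart c) (snd (prod_chart c) (p, t)) = (p, t)"
    using p by (intro inv_into_f_f) auto
  then show ?thesis using p assms(1) by simp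
qed

lemma is_chart_prod_chart:
  assumes c: "c \<in> atlas M"
  shows "is_chart (mtop (times_line M)) (prod_chart c)"
  unfolding is_chart_iff
proof (intro conjI allI impI)
  have ch: "openin (mtop M) (fst c)" "open (snd c ` fst c)" "inj_on (snd c) (fst c)"
    "continuous_map (subtopology (mtop M) (fst c)) euclidean (snd c)"
    "\<And>T. openin (mtop M) T \<Longrightarrow> T \<subseteq> fst c \<Longrightarrow> open (snd c ` T)"
    using atlas_is_chart[OF c] by (auto simp: is_chart_iff)
  show "openin (mtop (times_line M)) (fst (prod_chart c))"
    using ch(1) by (simp add: openin_prod_Times_iff)
  show "open (snd (prod_chart c) ` fst (prod_chart c))"
    using ch(2) by (simp add: prod_chart_image open_Times)
  show "inj_on (snd (prod_chart c)) (fst (prod_chart c))" using ch(3) by (auto simp: inj_on_def)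
  have "continuous_map (prod_topology (subtopology (mtop M) (fst c)) euclideanreal) (prod_topology euclidean euclideanreal)
      (\<lambda>(x, t). (snd c x, t))"
    using ch(4) by (subst continuous_map_prod_top) auto
  moreover have "prod_topology (subtopology (mtop M) (fst c)) euclideanreal = subtopology (mtop (times_line M)) (fst (prod_chart c))"
    by (simp add: prod_topology_subtopology)
  moreover have "(\<lambda>(x, t). (snd c x, t)) = snd (prod_chart c)" by (auto simp: fun_eq_iff)
  ultimately show "continuous_map (subtopology (mtop (times_line M)) (fst (prod_chart c))) euclidean (snd (prod_chart c))"
    by simp
  fix T assume T: "openin (mtop (times_line M)) T \<and> T \<subseteq> fst (prod_chart c)"
  show "open (snd (prod_chart c) ` T)"
  proof (subst open_subopen, intro ballI)
    fix z assume "z \<in> snd (prod_chart c) ` T"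
    then obtain p t where pt: "(p, t) \<in> T" "z = (snd c p, t)" by auto
    have "\<exists>A B. openin (mtop M) A \<and> openin euclideanreal B \<and> p \<in> A \<and> t \<in> B \<and> A \<times> B \<subseteq> T"
      using T pt(1) unfolding times_line_sel openin_prod_topology_alt by blast
    then obtain A B where AB: "openin (mtop M) A" "open B" "p \<in> A" "t \<in> B" "A \<times> B \<subseteq> T"
      unfolding open_openin[symmetric] by blast
    have "A \<subseteq> fst c" using AB T by auto
    then have "open (snd c ` A)" using ch(5) AB by auto
    then have "open ((snd c ` A) \<times> B)" using AB by (simp add: open_Times)
    moreover have "(snd c ` A) \<times> B \<subseteq> snd (prod_chart c) ` T"
      unfolding prod_chart_image[symmetric] by (rule image_mono[OF AB(5)])
    ultimately show "\<exists>T'. open T' \<and> z \<in> T' \<and> T' \<subseteq> snd (prod_chart c) ` T"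
      using AB pt by blast
  qed
qed

lemma prod_transition:
  assumes "c \<in> atlas M" "y \<in> snd c ` fst c"
  shows "(snd (prod_chart d) \<circ> cinv (prod_chart c)) (y, t) = ((snd d \<circ> cinv c) y, t)"
  using cinv_prod_chart[OF assms] by simp

lemma jac_prod_chart:
  assumes c: "c \<in> atlas M" "d \<in> atlas M" "p \<in> fst c" "p \<in> fst d"
  shows "jac (prod_chart c) (prod_chart d) (p, t) (v, s) = (jac c d p v, s)"
proof -
  have S: "open ((snd c ` fst c) \<times> (UNIV::real set))" by (intro open_Times chart_range_open c open_UNIV)
  let ?G = "snd d \<circ> cinv c"
  have "((\<lambda>z. (?G (fst z), snd z)) has_derivative (\<lambda>a. (\<D> ?G (snd c p) (fst a), snd a))) (at (snd c p, t))"
    by (intro has_derivative_Pair has_derivative_snd has_derivative_ident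
        has_derivative_comp_fst[OF jac_differentiable[OF c]])
  then have "((snd (prod_chart d) \<circ> cinv (prod_chart c)) has_derivative (\<lambda>a. (\<D> ?G (snd c p) (fst a), snd a))) (at (snd c p, t))"
  proof (rule has_derivative_cong_open[OF S, THEN iffD2, rotated 2])
    show "(snd c p, t) \<in> (snd c ` fst c) \<times> UNIV" using c by auto
    fix z assume "z \<in> (snd c ` fst c) \<times> (UNIV :: real set)"
    then have "fst z \<in> snd c ` fst c" by auto
    from prod_transition[OF c(1) this, of d "snd z"]
    show "(snd (prod_chart d) \<circ> cinv (prod_chart c)) z = (?G (fst z), snd z)" by simp
  qed
  from D_eqI[OF this] show ?thesis by (simp add: jac_def)
qed

lemma smooth_times_line: "smooth_manifold (times_line M)"
  unfolding smooth_manifold_def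
proof (intro conjI ballI)
  have ne: "points M \<noteq> {}" and H: "Hausdorff_space (mtop M)" and sc: "second_countable (mtop M)"
    using smooth_manifold by (auto simp: smooth_manifold_def)
  show "points (times_line M) \<noteq> {}" using ne by simp
  show "Hausdorff_space (mtop (times_line M))" using H by (simp add: Hausdorff_space_prod_topology)
  show "second_countable (mtop (times_line M))" using sc by (simp add: second_countable_prod_euclidean)
  show "is_chart (mtop (times_line M)) c" if "c \<in> atlas (times_line M)" for c
    using that is_chart_prod_chart by auto
  show "chart_at (times_line M) z \<in> atlas (times_line M)" "z \<in> fst (chart_at (times_line M) z)"
    if "z \<in> points (times_line M)" for z
    using that chart_at_in[of "fst z"] by (cases z; auto)+
  fix C D assume "C \<in> atlas (times_line M)" "D \<in> atlas (times_line M)"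
  then obtain c d where c: "c \<in> atlas M" "d \<in> atlas M" "C = prod_chart c" "D = prod_chart d" by auto
  let ?S = "snd c ` (fst c \<inter> fst d)"
  have S: "open ?S" by (intro chart_image_open c chart_dom_open)
  have S': "open (?S \<times> (UNIV :: real set))" using S by (intro open_Times) auto
  have im: "snd C ` (fst C \<inter> fst D) = ?S \<times> UNIV"
    unfolding c prod_chart_sel by (simp add: prod_chart_image Times_Int_Times)
  have "smooth_on (?S \<times> (UNIV :: real set)) (\<lambda>z. ((snd d \<circ> cinv c) (fst z), snd z))"
    by (intro smooth_on_Pair S' smooth_on_bounded_linear[OF bounded_linear_snd S' smooth_on_id[OF S']]
        smooth_on_compose[OF S' smooth_on_bounded_linear[OF bounded_linear_fst S' smooth_on_id[OF S']] transition_smooth[OF c(1,2)]])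
      auto
  then show "smooth_on (snd C ` (fst C \<inter> fst D)) (snd D \<circ> cinv C)"
    unfolding im
  proof (rule smooth_on_transform[OF _ S'])
    fix z assume "z \<in> ?S \<times> (UNIV :: real set)"
    then have "fst z \<in> snd c ` fst c" by auto
    from prod_transition[OF c(1) this, of d "snd z"]
    show "(snd D \<circ> cinv C) z = ((snd d \<circ> cinv c) (fst z), snd z)" by (simp add: c)
  qed
qed

lemma tcoord_times_line:
  assumes "c \<in> atlas M" "p \<in> fst c"
  shows "tcoord (times_line M) (prod_chart c) (p, t) (v, s) = (tcoord M c p v, s)"
    and "coord_field (times_line M) (prod_chart c) (v, s) (p, t) = (coord_field M c v p, s)"
  using assms chart_at_in[OF chart_dom_points[OF assms]]
  by (simp_all add: tcoord_jac coord_field_jac jac_prod_chart)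

end

context quasi_Vaisman_mfd
begin

sublocale line: smooth_mfd "times_line M"
  by unfold_locales (rule smooth_times_line)

lemma odd_dim_line: "odd DIM('e \<times> real)"
proof -
  have "points M \<noteq> {}" using smooth_manifold unfolding smooth_manifold_def by (elim conjE)
  then obtain p where p: "p \<in> points M" by blast
  have "even DIM('e)" by (rule complex_structure_even_dim[OF linear_data(1)[OF p] metric_data(4)[OF p]])
  then show ?thesis by simp
qed

lemma quasi_Sasakian_flat_times_line:
  assumes "C \<in> atlas (times_line M)"
  shows "quasi_Sasakian_flat (snd C ` fst C) (endo_rep (times_line M) C (line_\<phi> J g \<theta>)) (vf_rep (times_line M) C (line_\<xi> J g \<theta>))
     (form_rep (times_line M) C (line_\<eta> J g \<theta>)) (bilin_rep (times_line M) C (line_metric g))"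
proof -
  obtain c where c: "c \<in> atlas M" and C: "C = prod_chart c" using assms by auto
  interpret F: flat_quasi_Vaisman "snd c ` fst c" "endo_rep M c J" "bilin_rep M c g" "form_rep M c \<theta>" "vf_rep M c U"
    by (rule flat_chart[OF c])
  have im: "snd C ` fst C = (snd c ` fst c) \<times> UNIV" by (simp add: C prod_chart_image)
  have op: "open ((snd c ` fst c) \<times> (UNIV :: real set))" by (intro open_Times F.S open_UNIV)
  have "endo_rep (times_line M) C (line_\<phi> J g \<theta>) z v = F.\<phi> z v \<and>
    vf_rep (times_line M) C (line_\<xi> J g \<theta>) z = (F.V (fst z), 0) \<and>
    form_rep (times_line M) C (line_\<eta> J g \<theta>) z v = F.\<eta> (fst z) (fst v) \<and>
    bilin_rep (times_line M) C (line_metric g) z v w = F.h z v w"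
    if "z \<in> (snd c ` fst c) \<times> UNIV" for z v w
  proof -
    obtain p t where p: "p \<in> fst c" and z: "z = snd C (p, t)" using \<open>z \<in> _\<close> by (auto simp: C)
    have zz: "z = (snd c p, t)" using z by (simp add: C)
    have pC: "(p, t) \<in> fst C" using p by (simp add: C)
    obtain v' s w' r where vw: "v = (v', s)" "w = (w', r)" by (metis surj_pair)
    note pM = chart_dom_points[OF c p]
    have lt: "linear (tcoord M c p)" by (rule linear_tcoord[OF c p])
    note tc = tcoord_times_line[OF c p]
    note atN = line.endo_rep_at[OF assms pC] line.vf_rep_at[OF assms pC] line.form_rep_at[OF assms pC] line.bilin_rep_at[OF assms pC]
    note atM = endo_rep_at[OF c p] vf_rep_at[OF c p] form_rep_at[OF c p] bilin_rep_at[OF c p]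
    have 1: "endo_rep (times_line M) C (line_\<phi> J g \<theta>) z v = F.\<phi> z v"
      unfolding z atN(1) unfolding C prod_chart_sel vw tc(2)[folded C] line_\<phi>_eq[OF pM] tc
      using c p by (simp add: F.\<phi>_def atM linear_diff[OF lt] linear_add[OF lt] linear_scale[OF lt])
    have 2: "vf_rep (times_line M) C (line_\<xi> J g \<theta>) z = (F.V (fst z), 0)"
      unfolding z atN(2) unfolding C line_\<xi>_def using c p by (simp add: tc atM V_eq[OF pM])
    have 3: "form_rep (times_line M) C (line_\<eta> J g \<theta>) z v = F.\<eta> (fst z) (fst v)"
      unfolding z atN(3) unfolding C vw using c p by (simp add: tc atM line_\<eta>_eq[OF pM])
    have 4: "bilin_rep (times_line M) C (line_metric g) z v w = F.h z v w"
      unfolding z atN(4) unfolding C vw using c p by (simp add: tc atM line_metric_def F.h_def)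
    show ?thesis using 1 2 3 4 by simp
  qed
  then show ?thesis
    unfolding im using quasi_Sasakian_flat_transform[OF F.quasi_Sasakian_flat_line order_refl op] by simp
qed

theorem quasi_Sasakian_times_line:
  "quasi_Sasakian (times_line M) (line_\<phi> J g \<theta>) (line_\<xi> J g \<theta>) (line_\<eta> J g \<theta>) (line_metric g)"
  by (rule line.quasi_SasakianI[OF odd_dim_line _ quasi_Sasakian_flat_times_line]) (auto intro: almost_contact_line)

end

section \<open>Quotients by deck transformations\<close>

lemma open_submanifold_sel [simp]:
  "mtop (open_submanifold M W) = subtopology (mtop M) W"
  "atlas (open_submanifold M W) = (\<lambda>c. (fst c \<inter> W, snd c)) ` atlas M"
  by (simp_all add: open_submanifold_def)

text \<open>The group enters only through the orbits of its maps, which are the fibres of \<open>q\<close>.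
  Local injectivity of \<open>q\<close> expresses that the action is free and discontinuous, and the last
  condition is the Hausdorff property of the quotient.\<close>

locale deck_quotient = smooth_mfd N for N :: "('a, 'e::euclidean_space) manifold" +
  fixes q :: "'a \<Rightarrow> 'b" and G :: "('a \<Rightarrow> 'a) set"
  assumes deck_smooth: "\<psi> \<in> G \<Longrightarrow> smooth_map N N \<psi>"
    and q_eq_iff: "z \<in> points N \<Longrightarrow> z' \<in> points N \<Longrightarrow> q z = q z' \<longleftrightarrow> (\<exists>\<psi>\<in>G. \<psi> z = z')"
    and locally_inj: "z \<in> points N \<Longrightarrow> \<exists>W. openin (mtop N) W \<and> z \<in> W \<and> inj_on q W"
    and separated: "z \<in> points N \<Longrightarrow> z' \<in> points N \<Longrightarrow> q z \<noteq> q z' \<Longrightarrow>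
      \<exists>W W'. openin (mtop N) W \<and> openin (mtop N) W' \<and> z \<in> W \<and> z' \<in> W' \<and> q ` W \<inter> q ` W' = {}"
begin

definition "Q = quotient_manifold N q"

definition "qchart W c = (q ` W, snd c \<circ> inv_into W q)"

text \<open>The sheets of the covering \<open>q\<close> that are contained in one chart; they index the charts of the
  quotient.\<close>

definition "sheet W c \<longleftrightarrow> c \<in> atlas N \<and> openin (mtop N) W \<and> W \<subseteq> fst c \<and> inj_on q W"

lemma Q_sel: "mtop Q = quotient_topology (mtop N) q" "atlas Q = {qchart W c | W c. sheet W c}"
  "chart_at Q y = (SOME c. c \<in> atlas Q \<and> y \<in> fst c)"
  by (simp_all add: Q_def quotient_manifold_def Let_def qchart_def sheet_def)

lemma qchart_atlas: "sheet W c \<Longrightarrow> qchart W c \<in> atlas Q"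
  unfolding Q_sel by blast

lemma fst_qchart [simp]: "fst (qchart W c) = q ` W" by (simp add: qchart_def)

lemma quotient_map_q: "quotient_map (mtop N) (mtop Q) q"
  by (simp add: Q_sel quotient_map_quotient_topology)

lemma points_Q: "points Q = q ` points N"
  using quotient_map_q by (simp add: quotient_map_def)

lemma q_points: "z \<in> points N \<Longrightarrow> q z \<in> points Q" by (simp add: points_Q)

lemma continuous_q: "continuous_map (mtop N) (mtop Q) q"
  by (rule quotient_imp_continuous_map[OF quotient_map_q])

lemma deck_points: "\<psi> \<in> G \<Longrightarrow> z \<in> points N \<Longrightarrow> \<psi> z \<in> points N"
  using smooth_map_points deck_smooth by metis

lemma q_deck: "\<psi> \<in> G \<Longrightarrow> z \<in> points N \<Longrightarrow> q (\<psi> z) = q z"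
  using q_eq_iff[of z "\<psi> z"] deck_points by auto

text \<open>The saturation of an open set is the union of its preimages under the deck maps.\<close>

lemma open_q:
  assumes "openin (mtop N) T"
  shows "openin (mtop Q) (q ` T)"
proof -
  have TN: "T \<subseteq> points N" using assms openin_subset by blast
  have "{x \<in> points N. q x \<in> q ` T} = (\<Union>\<psi>\<in>G. {x \<in> points N. \<psi> x \<in> T})"
  proof (intro equalityI subsetI)
    fix x assume "x \<in> {x \<in> points N. q x \<in> q ` T}"
    then obtain t where t: "x \<in> points N" "t \<in> T" "q x = q t" by auto
    then obtain \<psi> where "\<psi> \<in> G" "\<psi> x = t" using q_eq_iff[OF t(1) subsetD[OF TN t(2)]] by auto
    then show "x \<in> (\<Union>\<psi>\<in>G. {x \<in> points N. \<psi> x \<in> T})" using t by auto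
  next
    fix x assume "x \<in> (\<Union>\<psi>\<in>G. {x \<in> points N. \<psi> x \<in> T})"
    then obtain \<psi> where "\<psi> \<in> G" "x \<in> points N" "\<psi> x \<in> T" by auto
    then show "x \<in> {x \<in> points N. q x \<in> q ` T}" using q_deck[of \<psi> x] by (metis (mono_tags, lifting) imageI mem_Collect_eq)
  qed
  moreover have "openin (mtop N) {x \<in> points N. \<psi> x \<in> T}" if "\<psi> \<in> G" for \<psi>
    by (rule openin_continuous_map_preimage[OF _ assms])
      (use deck_smooth[OF that] in \<open>simp add: smooth_map_def\<close>)
  then have "openin (mtop N) (\<Union>\<psi>\<in>G. {x \<in> points N. \<psi> x \<in> T})"
    by (intro openin_Union) auto
  ultimately show ?thesis
    using TN by (auto simp: Q_sel openin_quotient_topology)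
qed

lemma sheetD:
  assumes "sheet W c"
  shows "c \<in> atlas N" "openin (mtop N) W" "W \<subseteq> fst c" "inj_on q W" "W \<subseteq> points N"
  using assms openin_subset by (auto simp: sheet_def)

lemma sheet_exists:
  assumes "z \<in> points N"
  obtains W c where "sheet W c" "z \<in> W"
proof -
  obtain W where W: "openin (mtop N) W" "z \<in> W" "inj_on q W" using locally_inj[OF assms] by blast
  let ?c = "chart_at N z"
  note c = chart_at_in[OF assms]
  have "sheet (W \<inter> fst ?c) ?c"
    unfolding sheet_def using W c chart_dom_open[OF c(1)] by (auto intro: inj_on_subset)
  then show ?thesis using that[of "W \<inter> fst ?c" ?c] W c by auto
qed

lemma snd_qchart: "inj_on q W \<Longrightarrow> z \<in> W \<Longrightarrow> snd (qchart W c) (q z) = snd c z"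
  by (simp add: qchart_def)

lemma qchart_image: "inj_on q W \<Longrightarrow> T \<subseteq> W \<Longrightarrow> snd (qchart W c) ` q ` T = snd c ` T"
  by (force simp: image_iff snd_qchart subset_iff)

lemma inj_qchart: "sheet W c \<Longrightarrow> inj_on (snd (qchart W c)) (q ` W)"
  using chart_inj[of c] by (auto simp: inj_on_def snd_qchart sheet_def subset_iff)

lemma cinv_qchart:
  assumes "sheet W c" "z \<in> W"
  shows "cinv (qchart W c) (snd c z) = q z"
proof -
  have "inv_into (q ` W) (snd (qchart W c)) (snd (qchart W c) (q z)) = q z"
    using assms inj_qchart by (intro inv_into_f_f) auto
  then show ?thesis using assms by (simp add: snd_qchart sheetD)
qed

lemma is_chart_qchart:
  assumes a: "sheet W c"
  shows "is_chart (mtop Q) (qchart W c)"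
  unfolding is_chart_iff
proof (intro conjI allI impI)
  note W = sheetD[OF a]
  show "openin (mtop Q) (fst (qchart W c))" using open_q[OF W(2)] by simp
  have "snd (qchart W c) ` fst (qchart W c) = snd c ` (fst c \<inter> W)"
    using qchart_image[OF W(4) order_refl] W(3) by (simp add: Int_absorb1)
  then show "open (snd (qchart W c) ` fst (qchart W c))" using chart_image_open[OF W(1,2)] by simp
  show "inj_on (snd (qchart W c)) (fst (qchart W c))" using inj_qchart[OF a] by simp
  show "continuous_map (subtopology (mtop Q) (fst (qchart W c))) euclidean (snd (qchart W c))"
    unfolding continuous_map_def
  proof (intro conjI allI impI)
    fix T :: "'e set" assume T: "openin euclidean T"
    have qW: "q ` W \<subseteq> points Q" using W(5) by (auto simp: points_Q)
    have cont: "continuous_map (subtopology (mtop N) (fst c)) euclidean (snd c)"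
      using atlas_is_chart[OF W(1)] by (simp add: is_chart_iff)
    have "openin (mtop N) {x \<in> fst c. snd c x \<in> T}"
      using openin_continuous_map_preimage[OF cont T] chart_dom_open[OF W(1)] chart_dom_points[OF W(1)]
      by (simp add: openin_open_subtopology Int_absorb1 subsetI)
    then have "openin (mtop N) (W \<inter> {x \<in> fst c. snd c x \<in> T})" using W(2) by auto
    note op = open_q[OF this]
    have "{x \<in> topspace (subtopology (mtop Q) (fst (qchart W c))). snd (qchart W c) x \<in> T} =
        q ` (W \<inter> {x \<in> fst c. snd c x \<in> T})"
      using qW W(3) by (auto simp: snd_qchart[OF W(4)] subset_iff)
    then show "openin (subtopology (mtop Q) (fst (qchart W c)))
        {x \<in> topspace (subtopology (mtop Q) (fst (qchart W c))). snd (qchart W c) x \<in> T}"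
      using op open_q[OF W(2)] by (simp add: openin_open_subtopology image_mono)
  qed simp
  fix T assume T: "openin (mtop Q) T \<and> T \<subseteq> fst (qchart W c)"
  then have "openin (mtop N) {x \<in> points N. q x \<in> T}"
    by (intro openin_continuous_map_preimage[OF continuous_q]) auto
  from chart_image_open[OF W(1) openin_Int[OF W(2) this]]
  have "open (snd c ` (W \<inter> {x \<in> points N. q x \<in> T}))" using W(3) by (simp add: Int_absorb1 flip: Int_assoc)
  moreover have "T = q ` (W \<inter> {x \<in> points N. q x \<in> T})" using T W(5) unfolding fst_qchart by blast
  then have "snd (qchart W c) ` T = snd c ` (W \<inter> {x \<in> points N. q x \<in> T})"
    using qchart_image[OF W(4), of "W \<inter> {x \<in> points N. q x \<in> T}" c] by (metis inf_le1)
  ultimately show "open (snd (qchart W c) ` T)" by simp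
qed

text \<open>Two lifts of the same point of the quotient are related by a deck map, which near the first
  lift is the local inverse of \<open>q\<close> through the second one, composed with \<open>q\<close>. This makes
  every coordinate expression involving \<open>q\<close> that of a deck map.\<close>

lemma local_lift:
  assumes c: "c \<in> atlas N" "d \<in> atlas N" "z \<in> fst c"
    and W: "openin (mtop N) W" "W \<subseteq> fst d" "inj_on q W" "q z \<in> q ` W"
  obtains T \<psi> where "openin (mtop N) T" "z \<in> T" "T \<subseteq> fst c" "\<psi> \<in> G"
    "\<And>x. x \<in> T \<Longrightarrow> q x \<in> q ` W" "\<And>x. x \<in> T \<Longrightarrow> \<psi> x \<in> W" "\<And>x. x \<in> T \<Longrightarrow> inv_into W q (q x) = \<psi> x"
    "smooth_on (snd c ` T) (snd d \<circ> \<psi> \<circ> cinv c)" "open (snd c ` T)"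
proof -
  obtain w where w: "w \<in> W" "q z = q w" using W(4) by auto
  have WN: "W \<subseteq> points N" using W(1) openin_subset by blast
  note zN = chart_dom_points[OF c(1,3)]
  obtain \<psi> where \<psi>: "\<psi> \<in> G" "\<psi> z = w" using q_eq_iff[OF zN subsetD[OF WN w(1)]] w by auto
  define T where "T = fst c \<inter> {x \<in> points N. \<psi> x \<in> W}"
  have pre: "openin (mtop N) {x \<in> points N. \<psi> x \<in> W}"
    by (rule openin_continuous_map_preimage[OF _ W(1)])
      (use deck_smooth[OF \<psi>(1)] in \<open>simp add: smooth_map_def\<close>)
  show ?thesis
  proof (rule that[of T \<psi>])
    show "openin (mtop N) T" "z \<in> T" "T \<subseteq> fst c" "\<psi> \<in> G"
      using pre chart_dom_open[OF c(1)] c w \<psi> zN by (auto simp: T_def)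
    fix x assume x: "x \<in> T"
    then show "\<psi> x \<in> W" by (simp add: T_def)
    have qx: "q x = q (\<psi> x)" using q_deck[OF \<psi>(1), of x] x by (simp add: T_def)
    show "q x \<in> q ` W" unfolding qx using \<open>\<psi> x \<in> W\<close> by simp
    show "inv_into W q (q x) = \<psi> x"
      unfolding qx by (rule inv_into_f_f[OF W(3) \<open>\<psi> x \<in> W\<close>])
  next
    show "smooth_on (snd c ` T) (snd d \<circ> \<psi> \<circ> cinv c)"
      by (rule smooth_on_subset[of "snd c ` {p \<in> fst c. \<psi> p \<in> fst d}"])
        (use deck_smooth[OF \<psi>(1)] c W(2) in \<open>auto simp: smooth_map_def T_def\<close>)
    show "open (snd c ` T)" unfolding T_def by (rule chart_image_open[OF c(1) pre])
  qed
qed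

lemma smooth_Q: "smooth_manifold Q"
  unfolding smooth_manifold_def
proof (intro conjI ballI)
  have ne: "points N \<noteq> {}" and sc: "second_countable (mtop N)"
    using smooth_manifold unfolding smooth_manifold_def by blast+
  show "points Q \<noteq> {}" using ne by (simp only: points_Q image_is_empty) simp
  show "Hausdorff_space (mtop Q)"
    unfolding Hausdorff_space_def
  proof (intro allI impI, elim conjE)
    fix y y' assume "y \<in> points Q" "y' \<in> points Q" "y \<noteq> y'"
    then obtain z z' where z: "z \<in> points N" "z' \<in> points N" "y = q z" "y' = q z'" "q z \<noteq> q z'"
      by (auto simp: points_Q)
    obtain W W' where W: "openin (mtop N) W" "openin (mtop N) W'" "z \<in> W" "z' \<in> W'" "q ` W \<inter> q ` W' = {}"
      using separated[OF z(1,2,5)] by blast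
    show "\<exists>U V. openin (mtop Q) U \<and> openin (mtop Q) V \<and> y \<in> U \<and> y' \<in> V \<and> disjnt U V"
      by (rule exI[of _ "q ` W"], rule exI[of _ "q ` W'"]) (use W z open_q in \<open>auto simp: disjnt_def\<close>)
  qed
  show "second_countable (mtop Q)"
    by (rule second_countable_open_map_image[OF continuous_q _ _ sc])
      (auto simp: open_map_def open_q points_Q)
  show "is_chart (mtop Q) C" if "C \<in> atlas Q" for C using that is_chart_qchart by (auto simp: Q_sel)
  show "chart_at Q y \<in> atlas Q" "y \<in> fst (chart_at Q y)" if y: "y \<in> points Q" for y
  proof -
    obtain z where z: "z \<in> points N" "y = q z" using y by (auto simp: points_Q)
    obtain W c where "sheet W c" "z \<in> W" by (rule sheet_exists[OF z(1)])
    then have "qchart W c \<in> atlas Q \<and> y \<in> fst (qchart W c)" using z qchart_atlas by auto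
    then have "chart_at Q y \<in> atlas Q \<and> y \<in> fst (chart_at Q y)"
      unfolding Q_sel(3) by (rule someI)
    then show "chart_at Q y \<in> atlas Q" "y \<in> fst (chart_at Q y)" by auto
  qed
  fix C D assume "C \<in> atlas Q" "D \<in> atlas Q"
  then obtain W c W' d where C: "sheet W c" "C = qchart W c" and D: "sheet W' d" "D = qchart W' d" by (auto simp: Q_sel)
  note Wc = sheetD[OF C(1)] and Wd = sheetD[OF D(1)]
  show "smooth_on (snd C ` (fst C \<inter> fst D)) (snd D \<circ> cinv C)"
  proof (rule smooth_on_local)
    fix y assume "y \<in> snd C ` (fst C \<inter> fst D)"
    then obtain x where "x \<in> q ` W" "x \<in> q ` W'" "y = snd (qchart W c) x" unfolding C D fst_qchart by auto
    then obtain z where z: "z \<in> W" "q z \<in> q ` W'" "y = snd c z"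
      using snd_qchart[OF Wc(4)] by blast
    have zc: "z \<in> fst c" using z Wc by auto
    obtain T \<psi> where T: "openin (mtop N) T" "z \<in> T" "T \<subseteq> fst c" "\<psi> \<in> G" "\<And>x. x \<in> T \<Longrightarrow> q x \<in> q ` W'"
      "\<And>x. x \<in> T \<Longrightarrow> \<psi> x \<in> W'"
      "\<And>x. x \<in> T \<Longrightarrow> inv_into W' q (q x) = \<psi> x" "smooth_on (snd c ` T) (snd d \<circ> \<psi> \<circ> cinv c)"
      using local_lift[OF Wc(1) Wd(1) zc Wd(2-4) z(2)] by metis
    let ?T = "snd c ` (fst c \<inter> (T \<inter> W))"
    have oT: "open ?T" by (rule chart_image_open[OF Wc(1) openin_Int[OF T(1) Wc(2)]])
    have "smooth_on ?T (snd D \<circ> cinv C)"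
    proof (rule smooth_on_transform[OF smooth_on_subset[OF T(8)] oT])
      fix x assume "x \<in> ?T"
      then obtain p where p: "p \<in> T" "p \<in> W" "p \<in> fst c" "x = snd c p" by auto
      show "(snd D \<circ> cinv C) x = (snd d \<circ> \<psi> \<circ> cinv c) x"
        using p Wc(1) T(7)[OF p(1)] unfolding C D p(4) comp_apply cinv_qchart[OF C(1) p(2)]
        by (simp add: qchart_def)
    qed auto
    then show "\<exists>T. open T \<and> y \<in> T \<and> smooth_on T (snd D \<circ> cinv C)"
      using oT z zc T(2) by (intro exI[of _ ?T]) auto
  qed
qed

sublocale Q: smooth_mfd Q by unfold_locales (rule smooth_Q)

lemma smooth_q: "smooth_map N Q q"
  unfolding smooth_map_def
proof (intro conjI ballI)
  show "continuous_map (mtop N) (mtop Q) q" by (rule continuous_q)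
  fix c D assume c: "c \<in> atlas N" and "D \<in> atlas Q"
  then obtain W d where D: "sheet W d" "D = qchart W d" by (auto simp: Q_sel)
  note Wd = sheetD[OF D(1)]
  show "smooth_on (snd c ` {p \<in> fst c. q p \<in> fst D}) (snd D \<circ> q \<circ> cinv c)"
  proof (rule smooth_on_local)
    fix y assume "y \<in> snd c ` {p \<in> fst c. q p \<in> fst D}"
    then obtain z where z: "z \<in> fst c" "q z \<in> q ` W" "y = snd c z" by (auto simp: D)
    obtain T \<psi> where T: "z \<in> T" "T \<subseteq> fst c"
      "\<And>x. x \<in> T \<Longrightarrow> inv_into W q (q x) = \<psi> x" "smooth_on (snd c ` T) (snd d \<circ> \<psi> \<circ> cinv c)" "open (snd c ` T)"
      using local_lift[OF c Wd(1) z(1) Wd(2-4) z(2)] by metis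
    have "smooth_on (snd c ` T) (snd D \<circ> q \<circ> cinv c)"
    proof (rule smooth_on_transform[OF T(4,5)])
      fix x assume "x \<in> snd c ` T"
      then obtain p where p: "p \<in> T" "p \<in> fst c" "x = snd c p" using T(2) by auto
      show "(snd D \<circ> q \<circ> cinv c) x = (snd d \<circ> \<psi> \<circ> cinv c) x"
        using p c T(3)[OF p(1)] by (simp add: D qchart_def)
    qed
    then show "\<exists>T. open T \<and> y \<in> T \<and> smooth_on T (snd D \<circ> q \<circ> cinv c)"
      using T z by (intro exI[of _ "snd c ` T"]) auto
  qed
qed

text \<open>The local inverse of \<open>q\<close>, read in charts, is a deck map as well.\<close>

lemma diffeomorphism_q:
  assumes W: "openin (mtop N) W" "inj_on q W"
  shows "diffeomorphism (open_submanifold N W) (open_submanifold Q (q ` W)) q"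
proof -
  have WN: "W \<subseteq> points N" using W(1) openin_subset by blast
  have qWQ: "q ` W \<subseteq> points Q" using WN by (auto simp: points_Q)
  note qW = open_q[OF W(1)]
  have pts: "points (open_submanifold N W) = W" "points (open_submanifold Q (q ` W)) = q ` W"
    using WN qWQ by auto
  let ?s = "inv_into W q"
  have fwd: "smooth_map (open_submanifold N W) (open_submanifold Q (q ` W)) q"
    unfolding smooth_map_def
  proof (intro conjI ballI)
    show "continuous_map (mtop (open_submanifold N W)) (mtop (open_submanifold Q (q ` W))) q"
      using continuous_q WN by (auto simp: continuous_map_in_subtopology continuous_map_from_subtopology)
    fix c' d' assume "c' \<in> atlas (open_submanifold N W)" "d' \<in> atlas (open_submanifold Q (q ` W))"
    then obtain c d where c: "c \<in> atlas N" "c' = (fst c \<inter> W, snd c)" and d: "d \<in> atlas Q" "d' = (fst d \<inter> q ` W, snd d)"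
      by auto
    have pre: "openin (mtop N) (W \<inter> {p \<in> points N. q p \<in> fst d})"
      using W(1) openin_continuous_map_preimage[OF continuous_q Q.chart_dom_open[OF d(1)]] by auto
    have eq: "snd c' ` {p \<in> fst c'. q p \<in> fst d'} = snd c ` (fst c \<inter> (W \<inter> {p \<in> points N. q p \<in> fst d}))"
      using WN by (auto simp: c d)
    have "smooth_on (snd c ` (fst c \<inter> (W \<inter> {p \<in> points N. q p \<in> fst d}))) (snd d \<circ> q \<circ> cinv c)"
      by (rule smooth_on_subset[of "snd c ` {p \<in> fst c. q p \<in> fst d}"])
        (use smooth_q c d in \<open>auto simp: smooth_map_def\<close>)
    then show "smooth_on (snd c' ` {p \<in> fst c'. q p \<in> fst d'}) (snd d' \<circ> q \<circ> cinv c')"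
      unfolding eq
    proof (rule smooth_on_transform[OF _ chart_image_open[OF c(1) pre]])
      fix x assume "x \<in> snd c ` (fst c \<inter> (W \<inter> {p \<in> points N. q p \<in> fst d}))"
      then obtain p where p: "p \<in> fst c" "p \<in> W" "x = snd c p" by auto
      have "inv_into (fst c \<inter> W) (snd c) (snd c p) = p"
        using p chart_inj[OF c(1)] by (intro inv_into_f_f) (auto intro: inj_on_subset)
      then show "(snd d' \<circ> q \<circ> cinv c') x = (snd d \<circ> q \<circ> cinv c) x"
        using p c(1) by (simp add: c(2) d(2))
    qed
  qed
  have bwd: "smooth_map (open_submanifold Q (q ` W)) (open_submanifold N W) ?s"
    unfolding smooth_map_def
  proof (intro conjI ballI)
    have preq: "{y \<in> q ` W. ?s y \<in> T} = q ` (T \<inter> W)" for T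
      using W(2) by auto
    show "continuous_map (mtop (open_submanifold Q (q ` W))) (mtop (open_submanifold N W)) ?s"
      unfolding continuous_map_def pts
    proof (intro conjI allI impI)
      show "?s \<in> q ` W \<rightarrow> W" using W(2) by auto
      fix T assume "openin (mtop (open_submanifold N W)) T"
      then have T: "openin (mtop N) T" "T \<subseteq> W" using W(1) by (auto simp: openin_open_subtopology)
      then show "openin (mtop (open_submanifold Q (q ` W))) {y \<in> q ` W. ?s y \<in> T}"
        unfolding preq using open_q[of "T \<inter> W"] W(1) qW by (auto simp: openin_open_subtopology)
    qed
    fix d' c' assume "d' \<in> atlas (open_submanifold Q (q ` W))" "c' \<in> atlas (open_submanifold N W)"
    then obtain c D where c: "c \<in> atlas N" "c' = (fst c \<inter> W, snd c)" and D: "D \<in> atlas Q" "d' = (fst D \<inter> q ` W, snd D)"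
      by auto
    obtain W' d where d: "sheet W' d" "D = qchart W' d" using D by (auto simp: Q_sel)
    note Wd = sheetD[OF d(1)]
    show "smooth_on (snd d' ` {y \<in> fst d'. ?s y \<in> fst c'}) (snd c' \<circ> ?s \<circ> cinv d')"
    proof (rule smooth_on_local)
      fix y assume "y \<in> snd d' ` {y \<in> fst d'. ?s y \<in> fst c'}"
      then obtain x where x: "x \<in> q ` W'" "x \<in> q ` W" "?s x \<in> fst c" "y = snd (qchart W' d) x"
        by (auto simp: c D d)
      then obtain z where z: "z \<in> W'" "q z \<in> q ` W" "?s (q z) \<in> fst c" "y = snd d z"
        using snd_qchart[OF Wd(4)] by blast
      have zd: "z \<in> fst d" using z Wd by auto
      have Wc: "openin (mtop N) (W \<inter> fst c)" "W \<inter> fst c \<subseteq> fst c" "inj_on q (W \<inter> fst c)"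
        using W chart_dom_open[OF c(1)] by (auto intro: inj_on_subset)
      have qz: "q z \<in> q ` (W \<inter> fst c)"
        using z(3) inv_into_into[OF z(2)] f_inv_into_f[OF z(2)] by (intro image_eqI[of _ q "?s (q z)"]) auto
      obtain T \<psi> where T: "openin (mtop N) T" "z \<in> T" "T \<subseteq> fst d" and "\<psi> \<in> G"
        and T': "\<And>x. x \<in> T \<Longrightarrow> q x \<in> q ` (W \<inter> fst c)" "\<And>x. x \<in> T \<Longrightarrow> \<psi> x \<in> W \<inter> fst c"
        "\<And>x. x \<in> T \<Longrightarrow> inv_into (W \<inter> fst c) q (q x) = \<psi> x" "smooth_on (snd d ` T) (snd c \<circ> \<psi> \<circ> cinv d)"
        "open (snd d ` T)"
        using local_lift[OF Wd(1) c(1) zd Wc qz] by metis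
      let ?T = "snd d ` (fst d \<inter> (T \<inter> W'))"
      have oT: "open ?T" by (rule chart_image_open[OF Wd(1) openin_Int[OF T(1) Wd(2)]])
      have "smooth_on ?T (snd c' \<circ> ?s \<circ> cinv d')"
      proof (rule smooth_on_transform[OF smooth_on_subset[OF T'(4)] oT])
        fix x assume "x \<in> ?T"
        then obtain p where p: "p \<in> T" "p \<in> W'" "p \<in> fst d" "x = snd d p" by auto
        have "q p = q (\<psi> p)"
          using T'(3)[OF p(1)] f_inv_into_f[OF T'(1)[OF p(1)]] by simp
        then have s: "?s (q p) = \<psi> p" using T'(2)[OF p(1)] W(2) by simp
        have "inv_into (q ` W' \<inter> q ` W) (snd (qchart W' d)) (snd (qchart W' d) (q p)) = q p"
          using p(2) T'(1)[OF p(1)] inj_qchart[OF d(1)] by (intro inv_into_f_f) (auto intro: inj_on_subset)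
        then show "(snd c' \<circ> ?s \<circ> cinv d') x = (snd c \<circ> \<psi> \<circ> cinv d) x"
          using p s Wd(1) by (simp add: c(2) D(2) d(2) snd_qchart[OF Wd(4)])
      qed auto
      then show "\<exists>T. open T \<and> y \<in> T \<and> smooth_on T (snd c' \<circ> ?s \<circ> cinv d')"
        using oT z zd T(2) by (intro exI[of _ ?T]) auto
    qed
  qed
  show ?thesis
    unfolding diffeomorphism_def pts using fwd bwd W(2) by (simp add: bij_betw_def)
qed

theorem local_diffeomorphism_q: "local_diffeomorphism N Q q"
  unfolding local_diffeomorphism_def
  using smooth_q locally_inj open_q diffeomorphism_q by meson

abbreviation "dq \<equiv> tangent_map N Q q"

text \<open>The charts of the quotient are chosen such that \<open>q\<close> is the identity in coordinates.\<close>

lemma tcoord_dq: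
  assumes a: "sheet W c" and z: "z \<in> W"
  shows "tcoord Q (qchart W c) (q z) (dq z v) = tcoord N c z v"
proof -
  note W = sheetD[OF a]
  have zN: "z \<in> points N" using W z by auto
  let ?k = "chart_at N z"
  note k = chart_at_in[OF zN]
  have C: "qchart W c \<in> atlas Q" "q z \<in> fst (qchart W c)" using qchart_atlas[OF a] z by auto
  have "\<D> (snd (qchart W c) \<circ> q \<circ> cinv ?k) (snd ?k z) = \<D> (snd c \<circ> cinv ?k) (snd ?k z)"
    by (rule D_cong[OF chart_image_open[OF k(1) W(2)]]) (use k z in \<open>auto simp: snd_qchart[OF W(4)]\<close>)
  then show ?thesis
    using tcoord_tangent_map[OF smooth_manifold smooth_Q smooth_q zN C] by (simp add: tcoord_def)
qed

lemma dq_bij: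
  assumes z: "z \<in> points N"
  shows "linear (dq z)" "linear (inv (dq z))" "inv (dq z) (dq z v) = v" "dq z (inv (dq z) w) = w"
proof -
  obtain W c where a: "sheet W c" "z \<in> W" by (rule sheet_exists[OF z])
  have c: "c \<in> atlas N" "z \<in> fst c" using sheetD[OF a(1)] a(2) by auto
  have C: "qchart W c \<in> atlas Q" "q z \<in> fst (qchart W c)" using qchart_atlas[OF a(1)] a(2) by auto
  have dq: "dq z v = coord_field Q (qchart W c) (tcoord N c z v) (q z)" for v
    using Q.coord_field_tcoord[OF C, of "dq z v"] by (simp add: tcoord_dq[OF a])
  show l: "linear (dq z)" by (rule linear_tangent_map[OF smooth_manifold smooth_Q smooth_q z])
  have "bij (dq z)"
  proof (rule o_bij)
    show "(\<lambda>w. coord_field N c (tcoord Q (qchart W c) (q z) w) z) \<circ> dq z = id"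
      by (rule ext) (simp add: tcoord_dq[OF a] c)
    show "dq z \<circ> (\<lambda>w. coord_field N c (tcoord Q (qchart W c) (q z) w) z) = id"
      by (rule ext) (use C in \<open>simp add: dq c\<close>)
  qed
  then show i: "inv (dq z) (dq z v) = v" "dq z (inv (dq z) w) = w" for v w
    by (simp_all add: bij_is_inj bij_is_surj surj_f_inv_f)
  show "linear (inv (dq z))"
  proof (rule linearI)
    show "inv (dq z) (x + y) = inv (dq z) x + inv (dq z) y" for x y
      using i linear_add[OF l, of "inv (dq z) x" "inv (dq z) y"] by metis
    show "inv (dq z) (r *\<^sub>R x) = r *\<^sub>R inv (dq z) x" for r x
      using i linear_scale[OF l, of r "inv (dq z) x"] by metis
  qed
qed

lemma dq_deck:
  assumes \<psi>: "\<psi> \<in> G" and z: "z \<in> points N"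
  shows "dq (\<psi> z) (tangent_map N N \<psi> z v) = dq z v"
proof -
  have "tangent_map N Q (q \<circ> \<psi>) z v = dq (\<psi> z) (tangent_map N N \<psi> z v)"
    by (rule tangent_map_comp[OF smooth_manifold smooth_manifold smooth_Q deck_smooth[OF \<psi>] smooth_q z])
  moreover have "tangent_map N Q (q \<circ> \<psi>) z = dq z"
    by (rule tangent_map_cong[OF smooth_manifold openin_topspace z]) (simp add: q_deck[OF \<psi>])
  ultimately show ?thesis by simp
qed

end

section \<open>Descent of invariant structures\<close>

locale invariant_structure = deck_quotient N q G
  for N :: "('a, 'e::euclidean_space) manifold" and q :: "'a \<Rightarrow> 'b" and G +
  fixes \<phi> :: "('a, 'e) endo" and \<xi> :: "('a, 'e) vfield" and \<eta> :: "('a, 'e) form1" and h :: "('a, 'e) bilin"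
  assumes inv\<phi>: "\<psi> \<in> G \<Longrightarrow> z \<in> points N \<Longrightarrow> tangent_map N N \<psi> z (\<phi> z v) = \<phi> (\<psi> z) (tangent_map N N \<psi> z v)"
    and inv\<xi>: "\<psi> \<in> G \<Longrightarrow> z \<in> points N \<Longrightarrow> tangent_map N N \<psi> z (\<xi> z) = \<xi> (\<psi> z)"
    and inv\<eta>: "\<psi> \<in> G \<Longrightarrow> z \<in> points N \<Longrightarrow> \<eta> (\<psi> z) (tangent_map N N \<psi> z v) = \<eta> z v"
    and invh: "\<psi> \<in> G \<Longrightarrow> z \<in> points N \<Longrightarrow>
      h (\<psi> z) (tangent_map N N \<psi> z v) (tangent_map N N \<psi> z w) = h z v w"
begin

text \<open>The structure is pushed forward from an arbitrary point of each fibre; by invariance the choice is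
  immaterial, as stated in \<open>related\<close>.\<close>

definition "lift y = (SOME z. z \<in> points N \<and> q z = y)"

definition "\<phi>Q y w = dq (lift y) (\<phi> (lift y) (inv (dq (lift y)) w))"
definition "\<xi>Q y = dq (lift y) (\<xi> (lift y))"
definition "\<eta>Q y w = \<eta> (lift y) (inv (dq (lift y)) w)"
definition "hQ y w w' = h (lift y) (inv (dq (lift y)) w) (inv (dq (lift y)) w')"

lemma lift: "y \<in> points Q \<Longrightarrow> lift y \<in> points N" "y \<in> points Q \<Longrightarrow> q (lift y) = y"
proof -
  have "lift y \<in> points N \<and> q (lift y) = y" if y: "y \<in> points Q"
  proof -
    obtain z where "z \<in> points N \<and> q z = y" using y by (auto simp: points_Q)
    then show ?thesis unfolding lift_def by (rule someI)
  qed
  then show "y \<in> points Q \<Longrightarrow> lift y \<in> points N" "y \<in> points Q \<Longrightarrow> q (lift y) = y" by auto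
qed

lemma related:
  assumes z: "z \<in> points N"
  shows "dq z (\<xi> z) = \<xi>Q (q z)" "dq z (\<phi> z v) = \<phi>Q (q z) (dq z v)" "\<eta>Q (q z) (dq z v) = \<eta> z v"
    "hQ (q z) (dq z v) (dq z w) = h z v w"
proof -
  let ?s = "lift (q z)"
  have s: "?s \<in> points N" "q ?s = q z" using lift q_points[OF z] by auto
  then obtain \<psi> where \<psi>: "\<psi> \<in> G" "\<psi> ?s = z" using q_eq_iff[OF s(1) z] by auto
  let ?T = "tangent_map N N \<psi> ?s"
  have dT: "dq z (?T u) = dq ?s u" for u using dq_deck[OF \<psi>(1) s(1)] \<psi>(2) by simp
  have Ti: "?T (inv (dq ?s) (dq z v)) = v" for v
    using dT[of "inv (dq ?s) (dq z v)"] dq_bij(3)[OF z, of v] dq_bij(3)[OF z, of "?T (inv (dq ?s) (dq z v))"]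
    by (simp add: dq_bij(4)[OF s(1)])
  show "dq z (\<xi> z) = \<xi>Q (q z)"
    using inv\<xi>[OF \<psi>(1) s(1)] dT[of "\<xi> ?s"] \<psi>(2) by (simp add: \<xi>Q_def)
  show "dq z (\<phi> z v) = \<phi>Q (q z) (dq z v)"
    using inv\<phi>[OF \<psi>(1) s(1), of "inv (dq ?s) (dq z v)"] dT[of "\<phi> ?s (inv (dq ?s) (dq z v))"] \<psi>(2) Ti[of v]
    by (simp add: \<phi>Q_def)
  show "\<eta>Q (q z) (dq z v) = \<eta> z v"
    using inv\<eta>[OF \<psi>(1) s(1), of "inv (dq ?s) (dq z v)"] \<psi>(2) Ti[of v] by (simp add: \<eta>Q_def)
  show "hQ (q z) (dq z v) (dq z w) = h z v w"
    using invh[OF \<psi>(1) s(1), of "inv (dq ?s) (dq z v)" "inv (dq ?s) (dq z w)"] \<psi>(2) Ti[of v] Ti[of w]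
    by (simp add: hQ_def)
qed

lemma almost_contact_related_q: "almost_contact_related N \<phi> \<xi> \<eta> h Q \<phi>Q \<xi>Q \<eta>Q hQ q"
  unfolding almost_contact_related_def Let_def using related by blast

text \<open>In the chart of \<open>Q\<close> coming from a sheet in a chart \<open>c\<close> of \<open>N\<close>, the pushed forward
  tensors have the same components as the original ones in \<open>c\<close>.\<close>

theorem quasi_Sasakian_Q:
  assumes dim: "odd DIM('e)" and acm: "\<And>z. z \<in> points N \<Longrightarrow> almost_contact_at (\<phi> z) (\<xi> z) (\<eta> z) (h z)"
    and flat: "\<And>c. c \<in> atlas N \<Longrightarrow>
      quasi_Sasakian_flat (snd c ` fst c) (endo_rep N c \<phi>) (vf_rep N c \<xi>) (form_rep N c \<eta>) (bilin_rep N c h)"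
  shows "quasi_Sasakian Q \<phi>Q \<xi>Q \<eta>Q hQ"
proof (rule Q.quasi_SasakianI[OF dim])
  fix y assume "y \<in> points Q"
  note s = lift[OF this]
  show "almost_contact_at (\<phi>Q y) (\<xi>Q y) (\<eta>Q y) (hQ y)"
    using almost_contact_at_transport[OF acm[OF s(1)] dq_bij(1,2,4,3)[OF s(1)]]
    by (simp add: \<phi>Q_def[abs_def] \<xi>Q_def \<eta>Q_def[abs_def] hQ_def[abs_def])
next
  fix C assume CQ: "C \<in> atlas Q"
  then obtain W c where a: "sheet W c" and C: "C = qchart W c" by (auto simp: Q_sel)
  note W = sheetD[OF a]
  have im: "snd C ` fst C = snd c ` W" unfolding C fst_qchart by (rule qchart_image[OF W(4) order_refl])
  have "endo_rep Q C \<phi>Q y v = endo_rep N c \<phi> y v \<and> vf_rep Q C \<xi>Q y = vf_rep N c \<xi> y \<and>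
      form_rep Q C \<eta>Q y v = form_rep N c \<eta> y v \<and> bilin_rep Q C hQ y v w = bilin_rep N c h y v w"
    if y: "y \<in> snd c ` W" for y v w
  proof -
    obtain z where z: "z \<in> W" "y = snd c z" using y by auto
    have zN: "z \<in> points N" and zc: "z \<in> fst c" using z W by auto
    have qz: "q z \<in> fst C" using z by (simp add: C)
    have yC: "y = snd C (q z)" using z by (simp add: C snd_qchart[OF W(4)])
    have cf: "coord_field Q C v (q z) = dq z (coord_field N c v z)" for v
    proof -
      have "tcoord Q C (q z) (dq z (coord_field N c v z)) = v"
        unfolding C tcoord_dq[OF a z(1)] by (rule tcoord_coord_field[OF W(1) zc])
      then show ?thesis using Q.coord_field_tcoord[OF CQ qz, of "dq z (coord_field N c v z)"] by simp
    qed
    have "endo_rep Q C \<phi>Q (snd C (q z)) v = endo_rep N c \<phi> (snd c z) v"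
      unfolding Q.endo_rep_at[OF CQ qz] endo_rep_at[OF W(1) zc] cf related(2)[OF zN, symmetric]
      unfolding C by (rule tcoord_dq[OF a z(1)])
    moreover have "vf_rep Q C \<xi>Q (snd C (q z)) = vf_rep N c \<xi> (snd c z)"
      unfolding Q.vf_rep_at[OF CQ qz] vf_rep_at[OF W(1) zc] related(1)[OF zN, symmetric]
      unfolding C by (rule tcoord_dq[OF a z(1)])
    moreover have "form_rep Q C \<eta>Q (snd C (q z)) v = form_rep N c \<eta> (snd c z) v"
      unfolding Q.form_rep_at[OF CQ qz] form_rep_at[OF W(1) zc] cf by (rule related(3)[OF zN])
    moreover have "bilin_rep Q C hQ (snd C (q z)) v w = bilin_rep N c h (snd c z) v w"
      unfolding Q.bilin_rep_at[OF CQ qz] bilin_rep_at[OF W(1) zc] cf by (rule related(4)[OF zN])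
    ultimately show ?thesis using z(2) yC by simp
  qed
  moreover have "open (snd c ` W)"
    using Q.chart_range_open[OF CQ] by (simp add: im)
  ultimately show "quasi_Sasakian_flat (snd C ` fst C) (endo_rep Q C \<phi>Q) (vf_rep Q C \<xi>Q) (form_rep Q C \<eta>Q) (bilin_rep Q C hQ)"
    unfolding im using quasi_Sasakian_flat_transform[OF flat[OF W(1)] image_mono[OF W(3)]] by simp
qed

end

section \<open>The mapping torus\<close>

lemma
  assumes f: "bij_betw f S S"
  shows int_iterate_in: "x \<in> S \<Longrightarrow> int_iterate S f k x \<in> S"
    and int_iterate_succ: "x \<in> S \<Longrightarrow> int_iterate S f (k + 1) x = f (int_iterate S f k x)"
    and int_iterate_pred: "x \<in> S \<Longrightarrow> int_iterate S f (k - 1) x = inv_into S f (int_iterate S f k x)"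
    and int_iterate_add: "x \<in> S \<Longrightarrow> int_iterate S f (j + k) x = int_iterate S f j (int_iterate S f k x)"
proof -
  have fS: "f x \<in> S" if "x \<in> S" for x using f that by (auto simp: bij_betw_def)
  have gS: "inv_into S f x \<in> S" if "x \<in> S" for x using f that by (metis bij_betw_def inv_into_into)
  have fg: "f (inv_into S f x) = x" if "x \<in> S" for x using f that by (simp add: bij_betw_inv_into_right)
  have gf: "inv_into S f (f x) = x" if "x \<in> S" for x using f that by (simp add: bij_betw_inv_into_left)
  have pow: "(f ^^ n) x \<in> S" "(inv_into S f ^^ n) x \<in> S" if "x \<in> S" for n x
    using that by (induction n) (auto simp: fS gS)
  show inS: "int_iterate S f k x \<in> S" if "x \<in> S" for k x
    using that pow by (auto simp: int_iterate_def)
  show succ: "int_iterate S f (k + 1) x = f (int_iterate S f k x)" if x: "x \<in> S" for k x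
  proof (cases "k \<ge> 0")
    case True
    then show ?thesis by (simp add: int_iterate_def nat_add_distrib)
  next
    case False
    define m where "m = nat (- k - 1)"
    then have k: "nat (- k) = Suc m" and k1: "k + 1 = - int m" using False by auto
    have "f (int_iterate S f k x) = (inv_into S f ^^ m) x"
      using False pow(2)[OF x, of m] by (simp add: int_iterate_def k fg)
    also have "\<dots> = int_iterate S f (k + 1) x"
      unfolding k1 by (cases "m = 0") (simp_all add: int_iterate_def)
    finally show ?thesis by simp
  qed
  show pred: "int_iterate S f (k - 1) x = inv_into S f (int_iterate S f k x)" if x: "x \<in> S" for k x
    using succ[OF x, of "k - 1"] gf[OF inS[OF x, of "k - 1"]] by simp
  show "int_iterate S f (j + k) x = int_iterate S f j (int_iterate S f k x)" if x: "x \<in> S" for j k x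
  proof (induction j rule: int_induct[where k=0])
    case base
    show ?case by (simp add: int_iterate_def)
  next
    case (step1 i)
    then show ?case using succ[OF x, of "i + k"] succ[OF inS[OF x], of i k] by (simp add: algebra_simps)
  next
    case (step2 i)
    then show ?case using pred[OF x, of "i + k"] pred[OF inS[OF x], of i k] by (simp add: algebra_simps)
  qed
qed

lemma int_iterate_0 [simp]: "int_iterate S f 0 x = x"
  by (simp add: int_iterate_def)

definition shift :: "real \<Rightarrow> ('a \<Rightarrow> 'a) \<Rightarrow> 'a \<times> real \<Rightarrow> 'a \<times> real" where
  "shift b F = (\<lambda>(x, t). (F x, t + b))"

lemma shift_apply: "shift b F (p, t) = (F p, t + b)"
  by (simp add: shift_def)

context smooth_mfd
begin

lemma shift_rep:
  assumes "c \<in> atlas M" "y \<in> snd c ` fst c"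
  shows "(snd (prod_chart d) \<circ> shift b F \<circ> cinv (prod_chart c)) (y, t) = ((snd d \<circ> F \<circ> cinv c) y, t + b)"
  using cinv_prod_chart[OF assms] by (simp add: shift_def)

lemma smooth_shift:
  assumes F: "smooth_map M M F"
  shows "smooth_map (times_line M) (times_line M) (shift b F)"
  unfolding smooth_map_def
proof (intro conjI ballI)
  have "continuous_map euclideanreal euclideanreal (\<lambda>t. t + b)"
    by (simp add: continuous_on_add continuous_on_id)
  then show "continuous_map (mtop (times_line M)) (mtop (times_line M)) (shift b F)"
    unfolding times_line_sel shift_def
    by (subst continuous_map_prod_top) (use F in \<open>simp add: smooth_map_def\<close>)
  fix C D assume "C \<in> atlas (times_line M)" "D \<in> atlas (times_line M)"
  then obtain c d where c: "c \<in> atlas M" "d \<in> atlas M" "C = prod_chart c" "D = prod_chart d" by auto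
  let ?S = "snd c ` {p \<in> fst c. F p \<in> fst d}"
  have S: "open (?S \<times> (UNIV :: real set))"
    by (intro open_Times open_UNIV smooth_map_domain_open(1)[OF smooth_manifold smooth_manifold F c(1,2)])
  have "{z \<in> fst C. shift b F z \<in> fst D} = {p \<in> fst c. F p \<in> fst d} \<times> UNIV"
    by (auto simp: c shift_def)
  then have im: "snd C ` {z \<in> fst C. shift b F z \<in> fst D} = ?S \<times> UNIV" by (simp add: c(3) prod_chart_image)
  have smF: "smooth_on ?S (snd d \<circ> F \<circ> cinv c)" using F c by (auto simp: smooth_map_def)
  have "smooth_on (?S \<times> (UNIV :: real set)) (\<lambda>z. ((snd d \<circ> F \<circ> cinv c) (fst z), snd z + b))"
    by (intro smooth_on_Pair S smooth_on_add smooth_on_const smooth_on_bounded_linear[OF bounded_linear_snd S smooth_on_id[OF S]]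
        smooth_on_compose[OF S smooth_on_bounded_linear[OF bounded_linear_fst S smooth_on_id[OF S]] smF])
      auto
  then show "smooth_on (snd C ` {z \<in> fst C. shift b F z \<in> fst D}) (snd D \<circ> shift b F \<circ> cinv C)"
    unfolding im
  proof (rule smooth_on_transform[OF _ S])
    fix z assume "z \<in> ?S \<times> (UNIV :: real set)"
    then have "fst z \<in> snd c ` fst c" by auto
    from shift_rep[OF c(1) this, of d b F "snd z"]
    show "(snd D \<circ> shift b F \<circ> cinv C) z = ((snd d \<circ> F \<circ> cinv c) (fst z), snd z + b)" by (simp add: c)
  qed
qed

lemma tangent_map_shift:
  assumes F: "smooth_map M M F" and p: "p \<in> points M"
  shows "tangent_map (times_line M) (times_line M) (shift b F) (p, t) (v, s) = (tangent_map M M F p v, s)"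
proof -
  let ?c = "chart_at M p" and ?d = "chart_at M (F p)"
  note c = chart_at_in[OF p] and d = chart_at_in[OF smooth_map_points[OF F p]]
  let ?G = "snd ?d \<circ> F \<circ> cinv ?c"
  have S: "open ((snd ?c ` fst ?c) \<times> (UNIV::real set))" by (intro open_Times chart_range_open c open_UNIV)
  have "((\<lambda>z. (?G (fst z), snd z + b)) has_derivative (\<lambda>a. (\<D> ?G (snd ?c p) (fst a), snd a + 0))) (at (snd ?c p, t))"
    by (intro has_derivative_Pair has_derivative_add has_derivative_const has_derivative_snd has_derivative_ident
        has_derivative_comp_fst[OF smooth_map_differentiable[OF F c(1) d(1) c(2) d(2)]])
  then have "((snd (prod_chart ?d) \<circ> shift b F \<circ> cinv (prod_chart ?c)) has_derivative
      (\<lambda>a. (\<D> ?G (snd ?c p) (fst a), snd a + 0))) (at (snd ?c p, t))"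
  proof (rule has_derivative_cong_open[OF S, THEN iffD2, rotated 2])
    show "(snd ?c p, t) \<in> (snd ?c ` fst ?c) \<times> UNIV" using c by auto
    fix z assume "z \<in> (snd ?c ` fst ?c) \<times> (UNIV :: real set)"
    then have "fst z \<in> snd ?c ` fst ?c" by auto
    from shift_rep[OF c(1) this, of ?d b F "snd z"]
    show "(snd (prod_chart ?d) \<circ> shift b F \<circ> cinv (prod_chart ?c)) z = (?G (fst z), snd z + b)" by simp
  qed
  from D_eqI[OF this] show ?thesis by (simp add: tangent_map_def shift_def)
qed

end

context quasi_Vaisman_mfd
begin

definition "symmetry F \<longleftrightarrow> smooth_map M M F \<and> preserves_quasi_Vaisman M J g \<theta> F"

lemma symmetryD:
  assumes "symmetry F" "p \<in> points M"
  shows "smooth_map M M F" "F p \<in> points M" "linear (tangent_map M M F p)"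
    "tangent_map M M F p (J p v) = J (F p) (tangent_map M M F p v)"
    "g (F p) (tangent_map M M F p v) (tangent_map M M F p w) = g p v w"
    "\<theta> (F p) (tangent_map M M F p v) = \<theta> p v"
proof -
  show F: "smooth_map M M F" using assms by (simp add: symmetry_def)
  show "F p \<in> points M" by (rule smooth_map_points[OF F assms(2)])
  show "linear (tangent_map M M F p)" by (rule linear_tangent_map[OF smooth_manifold smooth_manifold F assms(2)])
qed (use assms in \<open>unfold symmetry_def preserves_quasi_Vaisman_def, blast+\<close>)

text \<open>The quasi-Lee field is determined by \<open>g\<close> and \<open>\<theta>\<close>: the difference of \<open>F\<^sub>* U\<close> and
  \<open>U\<close> has square length \<open>1 - 2 \<theta>(F\<^sub>* U) + 1 = 0\<close>.\<close>

lemma symmetry_U: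
  assumes F: "symmetry F" and p: "p \<in> points M"
  shows "tangent_map M M F p (U p) = U (F p)"
proof (rule ccontr)
  assume ne: "tangent_map M M F p (U p) \<noteq> U (F p)"
  let ?u = "tangent_map M M F p (U p)" and ?u' = "U (F p)"
  note Fp = symmetryD(2)[OF F p]
  have "g (F p) (?u - ?u') (?u - ?u') = g (F p) ?u ?u - 2 * \<theta> (F p) ?u + 1"
    using g_U[OF Fp] \<theta>_U[OF Fp]
    by (simp add: linear_diff[OF linear_data(2)[OF Fp]] linear_diff[OF linear_data(3)[OF Fp]]
        linear_diff[OF linear_data(4)[OF Fp]])
  also have "\<dots> = 0" using symmetryD(5,6)[OF F p] g_U[OF p] \<theta>_U[OF p] by simp
  finally show False using metric_data(2)[OF Fp, of "?u - ?u'"] ne by simp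
qed

lemma symmetry_comp:
  assumes F: "symmetry F" and F': "symmetry F'"
  shows "symmetry (F' \<circ> F)"
proof -
  have sm: "smooth_map M M F" "smooth_map M M F'" using F F' by (auto simp: symmetry_def)
  note tc = tangent_map_comp[OF smooth_manifold smooth_manifold smooth_manifold sm]
  show ?thesis
    unfolding symmetry_def preserves_quasi_Vaisman_def
    using smooth_map_comp[OF smooth_manifold smooth_manifold smooth_manifold sm]
      symmetryD[OF F] symmetryD(4-6)[OF F' symmetryD(2)[OF F]] by (simp add: tc)
qed

lemma symmetry_cong:
  assumes F: "symmetry F" and eq: "\<And>p. p \<in> points M \<Longrightarrow> F' p = F p"
  shows "symmetry F'"
proof -
  have "tangent_map M M F' p = tangent_map M M F p" if "p \<in> points M" for p
    by (rule tangent_map_cong[OF smooth_manifold openin_topspace that]) (rule eq)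
  then show ?thesis
    using F eq smooth_map_cong[OF smooth_manifold smooth_manifold, of F F']
    by (simp add: symmetry_def preserves_quasi_Vaisman_def)
qed

lemma symmetry_id: "symmetry id"
  using smooth_map_id[OF smooth_manifold] tangent_map_id[OF smooth_manifold]
  by (simp add: symmetry_def preserves_quasi_Vaisman_def)

lemma symmetry_inv:
  assumes F: "symmetry F" and F': "smooth_map M M F'"
    and inv: "\<And>p. p \<in> points M \<Longrightarrow> F (F' p) = p" "\<And>p. p \<in> points M \<Longrightarrow> F' (F p) = p"
  shows "symmetry F'"
proof -
  have sm: "smooth_map M M F" using F by (simp add: symmetry_def)
  have "tangent_map M M F' p (J p v) = J (F' p) (tangent_map M M F' p v) \<and>
      g (F' p) (tangent_map M M F' p v) (tangent_map M M F' p w) = g p v w \<and>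
      \<theta> (F' p) (tangent_map M M F' p v) = \<theta> p v" if p: "p \<in> points M" for p v w
  proof -
    let ?A = "tangent_map M M F (F' p)" and ?B = "tangent_map M M F' p"
    have F'p: "F' p \<in> points M" using smooth_map_points[OF F' p] .
    have id: "tangent_map M M (H \<circ> K) r u = u"
      if "\<And>p. p \<in> points M \<Longrightarrow> H (K p) = p" "r \<in> points M" for H K r u
      using tangent_map_cong[OF smooth_manifold openin_topspace that(2), of "H \<circ> K" id M] that(1)
        tangent_map_id[OF smooth_manifold that(2)] by simp
    have AB: "?A (?B u) = u" for u
      using tangent_map_comp[OF smooth_manifold smooth_manifold smooth_manifold F' sm p, of u] id[of F F' p u, OF inv(1) p] by simp
    have BA: "?B (?A u) = u" for u
      using tangent_map_comp[OF smooth_manifold smooth_manifold smooth_manifold sm F' F'p, of u]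
        id[of F' F "F' p" u, OF inv(2) F'p] inv(1)[OF p] by simp
    have "?B (J p v) = ?B (?A (J (F' p) (?B v)))"
      using symmetryD(4)[OF F F'p, of "?B v"] inv(1)[OF p] AB by simp
    then show ?thesis
      using BA AB symmetryD(5)[OF F F'p, of "?B v" "?B w"] symmetryD(6)[OF F F'p, of "?B v"] inv(1)[OF p] by simp
  qed
  then show ?thesis using F' by (simp add: symmetry_def preserves_quasi_Vaisman_def)
qed

lemma symmetry_line:
  fixes b :: real
  assumes F: "symmetry F" and z: "z \<in> points (times_line M)"
  defines "T \<equiv> tangent_map (times_line M) (times_line M) (shift b F) z"
  shows "T (line_\<phi> J g \<theta> z v) = line_\<phi> J g \<theta> (shift b F z) (T v)"
    and "T (line_\<xi> J g \<theta> z) = line_\<xi> J g \<theta> (shift b F z)"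
    and "line_\<eta> J g \<theta> (shift b F z) (T v) = line_\<eta> J g \<theta> z v"
    and "line_metric g (shift b F z) (T v) (T w) = line_metric g z v w"
proof -
  obtain p t v' s w' r where e: "z = (p, t)" "v = (v', s)" "w = (w', r)" by (metis surj_pair)
  have p: "p \<in> points M" using z by (simp add: e)
  note D = symmetryD[OF F p]
  note T = tangent_map_shift[OF D(1) p]
  note l = linear_simps[OF D(3)]
  have \<theta>J: "\<theta> (F p) (J (F p) (tangent_map M M F p x)) = \<theta> p (J p x)" for x
    using D(6)[of "J p x"] by (simp add: D(4))
  show "T (line_\<phi> J g \<theta> z v) = line_\<phi> J g \<theta> (shift b F z) (T v)"
    by (simp add: T_def e T line_\<phi>_eq[OF p] line_\<phi>_eq[OF D(2)] shift_apply l D(4,6) \<theta>J symmetry_U[OF F p])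
  show "T (line_\<xi> J g \<theta> z) = line_\<xi> J g \<theta> (shift b F z)"
    by (simp add: T_def e T line_\<xi>_def V_eq[OF p] V_eq[OF D(2)] shift_apply D(4) symmetry_U[OF F p])
  show "line_\<eta> J g \<theta> (shift b F z) (T v) = line_\<eta> J g \<theta> z v"
    by (simp add: T_def e T line_\<eta>_eq[OF p] line_\<eta>_eq[OF D(2)] shift_apply \<theta>J)
  show "line_metric g (shift b F z) (T v) (T w) = line_metric g z v w"
    by (simp add: T_def e T line_metric_def shift_apply D(5))
qed

end

locale quasi_Vaisman_torus = quasi_Vaisman_mfd M J g \<theta>
  for M :: "('a, 'e::euclidean_space) manifold" and J g \<theta> +
  fixes f :: "'a \<Rightarrow> 'a" and a :: real
  assumes isometry: "riemannian_isometry M g f" and preserves: "preserves_quasi_Vaisman M J g \<theta> f"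
    and a: "a > 0"
begin

abbreviation "it \<equiv> int_iterate (points M) f"
abbreviation "deck k \<equiv> shift (of_int k * a) (it k)"

lemma f_diffeo: "bij_betw f (points M) (points M)" "smooth_map M M f" "smooth_map M M (inv_into (points M) f)"
  using isometry by (auto simp: riemannian_isometry_def diffeomorphism_def)

lemma symmetry_it: "symmetry (it k)"
proof (induction k rule: int_induct[where k=0])
  case base
  show ?case by (rule symmetry_cong[OF symmetry_id]) simp
next
  case (step1 i)
  have "symmetry f" using f_diffeo preserves by (simp add: symmetry_def)
  from symmetry_comp[OF step1(2) this] show ?case
    by (rule symmetry_cong) (simp add: int_iterate_succ[OF f_diffeo(1)])
next
  case (step2 i)
  have "symmetry f" using f_diffeo preserves by (simp add: symmetry_def)
  then have "symmetry (inv_into (points M) f)"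
    by (rule symmetry_inv[OF _ f_diffeo(3)])
      (use f_diffeo(1) in \<open>auto simp: bij_betw_inv_into_right bij_betw_inv_into_left\<close>)
  from symmetry_comp[OF step2(2) this] show ?case
    by (rule symmetry_cong) (simp add: int_iterate_pred[OF f_diffeo(1)])
qed

lemma torus_orbit_eq: "torus_orbit M f a z = range (\<lambda>k. deck k z)"
  by (auto simp: torus_orbit_def shift_def split: prod.splits)

lemma deck_add: "z \<in> points (times_line M) \<Longrightarrow> deck (j + k) z = deck j (deck k z)"
  by (cases z) (simp add: shift_def int_iterate_add[OF f_diffeo(1)] algebra_simps)

lemma torus_orbit_eq_iff:
  assumes z: "z \<in> points (times_line M)"
  shows "torus_orbit M f a z = torus_orbit M f a z' \<longleftrightarrow> (\<exists>k. deck k z = z')"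
proof
  have 0: "deck 0 z = z" for z by (cases z) (simp add: shift_def)
  show "\<exists>k. deck k z = z'" if eq: "torus_orbit M f a z = torus_orbit M f a z'"
  proof -
    have "deck 0 z' \<in> torus_orbit M f a z'" unfolding torus_orbit_eq by (rule rangeI)
    then have "z' \<in> torus_orbit M f a z" using 0 eq by simp
    then show ?thesis by (auto simp: torus_orbit_eq)
  qed
  show "torus_orbit M f a z = torus_orbit M f a z'" if ex: "\<exists>k. deck k z = z'"
  proof -
    obtain k where k: "z' = deck k z" using ex by auto
    have "deck j z' = deck (j + k) z" for j using deck_add[OF z, of j k] by (simp add: k)
    then have 1: "deck j z' \<in> range (\<lambda>k. deck k z)" for j
      using rangeI[of "\<lambda>k. deck k z" "j + k"] by simp
    have "deck j z = deck (j - k) z'" for j using deck_add[OF z, of "j - k" k] by (simp add: k)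
    then have 2: "deck j z \<in> range (\<lambda>k. deck k z')" for j
      using rangeI[of "\<lambda>k. deck k z'" "j - k"] by simp
    show ?thesis unfolding torus_orbit_eq using 1 2 by blast
  qed
qed

lemma multiple_lt: "\<bar>of_int k * a\<bar> < a \<Longrightarrow> k = 0" for k :: int
proof -
  assume "\<bar>of_int k * a\<bar> < a"
  then have "\<bar>of_int k\<bar> * a < 1 * a" using a by (simp add: abs_mult)
  then have "\<bar>of_int k :: real\<bar> < 1" using a by (simp only: mult_less_cancel_right_pos)
  then show "k = 0" by linarith
qed

text \<open>A nontrivial deck map moves the coordinate \<open>t\<close> by at least \<open>a\<close>, so \<open>q\<close> is injective on
  strips of width \<open>a\<close>. For the separation of two orbits let \<open>t\<close> and \<open>s\<close> be the second
  coordinates of their representatives. If \<open>s - t\<close> is a multiple \<open>k a\<close>, then on narrow strips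
  only the \<open>k\<close>-th deck map matters and the Hausdorff property of \<open>M\<close> applies to the first
  coordinates; otherwise narrow strips around \<open>t\<close> and \<open>s\<close> have disjoint orbits.\<close>

sublocale torus: deck_quotient "times_line M" "torus_orbit M f a" "range deck"
proof
  fix \<psi> :: "'a \<times> real \<Rightarrow> 'a \<times> real" assume "\<psi> \<in> range deck"
  then show "smooth_map (times_line M) (times_line M) \<psi>"
    using smooth_shift symmetry_it by (auto simp: symmetry_def)
next
  fix z z' assume "z \<in> points (times_line M)"
  then show "torus_orbit M f a z = torus_orbit M f a z' \<longleftrightarrow> (\<exists>\<psi>\<in>range deck. \<psi> z = z')"
    using torus_orbit_eq_iff[of z z'] by auto
next
  fix z assume z: "z \<in> points (times_line M)"
  obtain x t where xt: "z = (x, t)" by (cases z)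
  define W where "W = points M \<times> {t - a / 2<..<t + a / 2}"
  have "inj_on (torus_orbit M f a) W"
  proof (rule inj_onI)
    fix w w' assume w: "w \<in> W" "w' \<in> W" and eq: "torus_orbit M f a w = torus_orbit M f a w'"
    have "w \<in> points (times_line M)" using w by (auto simp: W_def)
    then obtain k where k: "deck k w = w'" using torus_orbit_eq_iff eq by metis
    then have "snd w' = snd w + of_int k * a" by (auto simp: shift_def case_prod_beta)
    then have "\<bar>of_int k * a\<bar> < a" using w by (auto simp: W_def)
    then have "k = 0" by (rule multiple_lt)
    then show "w = w'" using k by (simp add: shift_def case_prod_beta)
  qed
  moreover have "openin (mtop (times_line M)) W" by (simp add: W_def openin_prod_Times_iff)
  ultimately show "\<exists>W. openin (mtop (times_line M)) W \<and> z \<in> W \<and> inj_on (torus_orbit M f a) W"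
    using z a by (intro exI[of _ W]) (auto simp: xt W_def)
next
  fix z z' assume z: "z \<in> points (times_line M)" "z' \<in> points (times_line M)"
    and ne: "torus_orbit M f a z \<noteq> torus_orbit M f a z'"
  obtain x t y s where e: "z = (x, t)" "z' = (y, s)" by (metis surj_pair)
  have xy: "x \<in> points M" "y \<in> points M" using z by (auto simp: e)
  have disj: "torus_orbit M f a ` W \<inter> torus_orbit M f a ` W' = {}"
    if WN: "W \<subseteq> points (times_line M)"
      and sep: "\<And>k p r. (p, r) \<in> W \<Longrightarrow> (it k p, r + of_int k * a) \<in> W' \<Longrightarrow> False" for W W'
  proof -
    have False if w: "w \<in> W" "w' \<in> W'" "torus_orbit M f a w = torus_orbit M f a w'" for w w'
    proof -
      obtain k where "deck k w = w'" using torus_orbit_eq_iff w WN by (metis subsetD)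
      then show False using w sep[of "fst w" "snd w" k] by (simp add: shift_def case_prod_beta)
    qed
    then show ?thesis by blast
  qed
  show "\<exists>W W'. openin (mtop (times_line M)) W \<and> openin (mtop (times_line M)) W' \<and> z \<in> W \<and> z' \<in> W' \<and>
      torus_orbit M f a ` W \<inter> torus_orbit M f a ` W' = {}"
  proof (cases "\<exists>k. s = t + of_int k * a")
    case True
    then obtain k where k: "s = t + of_int k * a" by auto
    have "it k x \<noteq> y"
    proof
      assume "it k x = y"
      then have "deck k z = z'" by (simp add: e shift_def k)
      then show False using ne torus_orbit_eq_iff[OF z(1)] by blast
    qed
    moreover have "Hausdorff_space (mtop M)" using smooth_manifold unfolding smooth_manifold_def by (elim conjE)
    ultimately obtain A B where AB: "openin (mtop M) A" "openin (mtop M) B" "it k x \<in> A" "y \<in> B" "disjnt A B"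
      using xy int_iterate_in[OF f_diffeo(1) xy(1)] unfolding Hausdorff_space_def by metis
    define A' where "A' = {p \<in> points M. it k p \<in> A}"
    have A': "openin (mtop M) A'"
      unfolding A'_def by (rule openin_continuous_map_preimage[OF _ AB(1)])
        (use symmetry_it[of k] in \<open>simp add: symmetry_def smooth_map_def\<close>)
    let ?W = "A' \<times> {t - a / 2<..<t + a / 2}" and ?W' = "B \<times> {s - a / 2<..<s + a / 2}"
    have "torus_orbit M f a ` ?W \<inter> torus_orbit M f a ` ?W' = {}"
    proof (rule disj)
      show "?W \<subseteq> points (times_line M)" by (auto simp: A'_def)
      fix j p r assume pr: "(p, r) \<in> ?W" "(it j p, r + of_int j * a) \<in> ?W'"
      then have "\<bar>of_int (j - k) * a\<bar> < a" by (auto simp: k algebra_simps abs_less_iff)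
      then have "j = k" using multiple_lt[of "j - k"] by simp
      then show False using pr AB(5) by (auto simp: A'_def disjnt_def)
    qed
    then show ?thesis
      using A' AB a xy by (intro exI[of _ ?W] exI[of _ ?W']) (auto simp: e openin_prod_Times_iff A'_def)
  next
    case False
    define u where "u = (s - t) / a"
    have s: "s = t + u * a" using a by (simp add: u_def)
    \<comment> \<open>the distance of \<open>u\<close> to the nearest integer\<close>
    define \<epsilon> where "\<epsilon> = min (u - of_int \<lfloor>u\<rfloor>) (of_int \<lfloor>u\<rfloor> + 1 - u)"
    have "u \<noteq> of_int \<lfloor>u\<rfloor>" using False s by metis
    then have \<epsilon>: "\<epsilon> > 0" unfolding \<epsilon>_def by linarith
    have far: "\<bar>u - of_int k\<bar> \<ge> \<epsilon>" for k :: int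
    proof (cases "k \<le> \<lfloor>u\<rfloor>")
      case True
      then have "of_int k \<le> (of_int \<lfloor>u\<rfloor> :: real)" by simp
      then show ?thesis by (simp add: \<epsilon>_def)
    next
      case False
      then have "of_int (\<lfloor>u\<rfloor> + 1) \<le> (of_int k :: real)" by (simp only: of_int_le_iff)
      then show ?thesis by (simp add: \<epsilon>_def)
    qed
    let ?W = "points M \<times> {t - \<epsilon> * a / 2<..<t + \<epsilon> * a / 2}" and ?W' = "points M \<times> {s - \<epsilon> * a / 2<..<s + \<epsilon> * a / 2}"
    have "torus_orbit M f a ` ?W \<inter> torus_orbit M f a ` ?W' = {}"
    proof (rule disj)
      fix j p r assume pr: "(p, r) \<in> ?W" "(it j p, r + of_int j * a) \<in> ?W'"
      then have "\<bar>(u - of_int j) * a\<bar> < \<epsilon> * a" by (auto simp: s algebra_simps abs_less_iff)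
      then have "\<bar>u - of_int j\<bar> * a < \<epsilon> * a" using a by (simp add: abs_mult)
      then have "\<bar>u - of_int j\<bar> < \<epsilon>" using a by (simp only: mult_less_cancel_right_pos)
      then show False using far[of j] by linarith
    qed auto
    then show ?thesis
      using a \<epsilon> xy by (intro exI[of _ ?W] exI[of _ ?W']) (auto simp: e openin_prod_Times_iff)
  qed
qed

sublocale torus: invariant_structure "times_line M" "torus_orbit M f a" "range deck"
    "line_\<phi> J g \<theta>" "line_\<xi> J g \<theta>" "line_\<eta> J g \<theta>" "line_metric g"
  by unfold_locales (use symmetry_line[OF symmetry_it] in auto)

lemma mapping_torus_eq: "mapping_torus M f a = torus.Q"
  by (simp add: mapping_torus_def torus.Q_def)

end

theorem mainTheorem7:
  fixes M :: "('a, 'e::euclidean_space) manifold"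
    and J :: "'a \<Rightarrow> 'e \<Rightarrow> 'e"
    and g :: "'a \<Rightarrow> 'e \<Rightarrow> 'e \<Rightarrow> real"
    and \<theta> :: "'a \<Rightarrow> 'e \<Rightarrow> real"
    and f :: "'a \<Rightarrow> 'a"
    and a :: real
  assumes "quasi_Vaisman M J g \<theta>"
    and "riemannian_isometry M g f"
    and "preserves_quasi_Vaisman M J g \<theta> f"
    and "a > 0"
  defines "\<phi> \<equiv> line_\<phi> J g \<theta>"
    and "\<xi> \<equiv> line_\<xi> J g \<theta>"
    and "\<eta> \<equiv> line_\<eta> J g \<theta>"
    and "h \<equiv> line_metric g"
    and "\<pi> \<equiv> torus_orbit M f a"
  shows "quasi_Sasakian (times_line M) \<phi> \<xi> \<eta> h \<and>
    smooth_manifold (mapping_torus M f a) \<and>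
    local_diffeomorphism (times_line M) (mapping_torus M f a) \<pi> \<and>
    (\<exists>\<phi>' \<xi>' \<eta>' h'.
       quasi_Sasakian (mapping_torus M f a) \<phi>' \<xi>' \<eta>' h' \<and>
       almost_contact_related (times_line M) \<phi> \<xi> \<eta> h (mapping_torus M f a) \<phi>' \<xi>' \<eta>' h' \<pi>)"
proof -
  interpret quasi_Vaisman_torus M J g \<theta> f a using assms(1-4) by unfold_locales
  have "quasi_Sasakian torus.Q torus.\<phi>Q torus.\<xi>Q torus.\<eta>Q torus.hQ"
    by (rule torus.quasi_Sasakian_Q[OF odd_dim_line _ quasi_Sasakian_flat_times_line]) (auto intro: almost_contact_line)
  then show ?thesis
    unfolding \<phi>_def \<xi>_def \<eta>_def h_def \<pi>_def mapping_torus_eq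
    using quasi_Sasakian_times_line torus.smooth_Q torus.local_diffeomorphism_q torus.almost_contact_related_q
    by blast
qed

end
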